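(* Let $k=\mathbb{F}_q$ be a finite field with $q\equiv1\pmod3$, and let $C_f$ be a cyclic triple cover of $\mathbb{P}^1$ of genus $g$, given by an equation $y^3=f(x)$ with $f\in k[x]$ a cube-free polynomial. If Frobenius induces on the set of the $g+2$ ramification points of $C_f\to\mathbb{P}^1$ a permutation $\sigma$ with $c_i(\sigma)$ cycles of length $i$, then the characteristic polynomial $\mathfrak{ch}_\rho(C_f)$ of Frobenius on $H^1_c(C_f,\overline{\mathbb{Q}}_\ell)^\rho$ satisfies $$\mathfrak{ch}_\rho(C_f)\bmod(1-\rho)\;=\;\frac{1}{(x-1)^2}\prod_{i=1}^{g+2}(x^i-1)^{c_i(\sigma)}$$ as polynomials in $(\mathbb{Z}/3\mathbb{Z})[x]$.
   Context: $\rho$ is a primitive cube root of unity, with a fixed embedding $\mathbb{Z}[\rho]\subset\overline{\mathbb{Q}}_\ell$, $\ell\nmid q$; $\tilde\rho\in k$ is a fixed primitive cube root of unity. $C_f$ denotes the smooth projective (geometrically irreducible) curve over $\bar k$ with affine equation $y^3=f(x)$, base changed from $k$, with automorphism $\alpha:(x,y)\mapsto(x,\tilde\rho y)$. The space $H^1_c(C_f,\overline{\mathbb{Q}}_\ell)$ splits into the $\rho$- and $\rho^2$-eigenspaces of $\alpha$, each of dimension $g$; $H^1_c(C_f,\overline{\mathbb{Q}}_\ell)^\rho$ is the $\rho$-eigenspace. Let $\alpha_1(C_f),\dots,\alpha_g(C_f)$ be the eigenvalues of the geometric $q$-Frobenius $F_q$ on it, and $\mathfrak{ch}_\rho(C_f)=\prod_{i=1}^g(x-\alpha_i(C_f))\in\mathbb{Z}[\rho][x]$.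 Concretely, $\sum_i\alpha_i(C_f)^n=-\sum_{a\in\mathbb{P}^1(\mathbb{F}_{q^n})}\chi_n(f(a))$ for all $n\ge1$, where $\chi_n:\mathbb{F}_{q^n}\to\{0\}\cup\mu_3$ is the cubic residue symbol ($\chi_n(0)=0$, $\chi_n(a)=\rho^i$ if $a^{(q^n-1)/3}=\tilde\rho^i$), and $f(\infty)$ is the leading coefficient of $f$ if $3\mid\deg f$ and $0$ otherwise. Reduction modulo $(1-\rho)$ uses $\mathbb{Z}[\rho]/(1-\rho)=\mathbb{Z}/3\mathbb{Z}$. *)

theory Defs
  imports
    "HOL-Algebra.Algebraic_Closure_Type"
    "HOL-Computational_Algebra.Computational_Algebra"
    "HOL-Combinatorics.Orbits"
    "HOL-Library.Multiset"
    "HOL-Library.Numeral_Type"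
begin

text \<open>
  Throughout, the type \<open>'k\<close> is the finite field $k$ with $q$ elements, \<open>'k alg_closure\<close> is
  its algebraic closure, and $\mathbb{F}_{q^n}$ is the set of $a \in \bar k$ with $a^{q^n} = a$.
  The type \<open>'l\<close> is the field of coefficients of the cohomology: any algebraically closed field of
  characteristic 0, for instance $\overline{\mathbb{Q}}_\ell$, in which a primitive cube root of
  unity \<open>\<rho>\<close> is chosen.  The polynomial \<open>f\<close> is assumed nowhere below to be cube-free; the
  definitions describe the smooth projective curve $C_f$ when it is.
\<close>

definition cube_free :: "'a::comm_semiring_1 \<Rightarrow> bool" where
  "cube_free a \<longleftrightarrow> (\<forall>d. d ^ 3 dvd a \<longrightarrow> d dvd 1)"

abbreviation geom :: "'k::field poly \<Rightarrow> 'k alg_closure poly" where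
  "geom \<equiv> map_poly to_ac"


section \<open>The function field and the genus\<close>

text \<open>
  $y^3 - f(x)$ as a polynomial in $y$ over $F = K(x)$.  If it is irreducible, the function field of
  $C_f$ is $F[y]/(y^3 - f)$; its elements are represented by the polynomials in $y$ of degree less
  than 3.
\<close>
definition kummer_poly :: "'a::field poly \<Rightarrow> 'a poly fract poly" where
  "kummer_poly f = monom 1 3 - [:to_fract f:]"

text \<open>
  The integral closure in the function field of a subring \<open>A\<close> of $F$.  The element represented by
  \<open>z\<close> is a zero of \<open>p\<close> iff $p(z)$, computed in $F[y]$, is divisible by $y^3 - f$.
\<close>
definition integral_closure :: "'a::field poly \<Rightarrow> 'a poly fract set \<Rightarrow> 'a poly fract poly set" where
  "integral_closure f A = {z. degree z < 3 \<and>
     (\<exists>p. lead_coeff p = 1 \<and> (\<forall>i. coeff p i \<in> A) \<and> kummer_poly f dvd pcompose p z)}"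

definition x_elt :: "'a::field poly fract" where
  "x_elt = to_fract [:0, 1:]"

text \<open>The rings $K[x]$, $K[x^{-1}]$ and $K[x, x^{-1}]$, as subrings of $K(x)$.\<close>

definition ring_x :: "'a::field poly fract set" where
  "ring_x = range to_fract"

definition ring_inv_x :: "'a::field poly fract set" where
  "ring_inv_x = {to_fract p / x_elt ^ n | p n. degree p \<le> n}"

definition ring_x_inv_x :: "'a::field poly fract set" where
  "ring_x_inv_x = {to_fract p / x_elt ^ n | p n. True}"

definition scalar_mult :: "'a::field \<Rightarrow> 'a poly fract poly \<Rightarrow> 'a poly fract poly" where
  "scalar_mult c = smult (to_fract [:c:])"

text \<open>\<open>n\<close> is the dimension of the quotient space \<open>V / W\<close>: there are \<open>n\<close> vectors in \<open>V\<close>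
  whose classes modulo \<open>W\<close> form a basis.\<close>
definition quotient_dim ::
    "'a::field poly fract poly set \<Rightarrow> 'a poly fract poly set \<Rightarrow> nat \<Rightarrow> bool" where
  "quotient_dim V W n \<longleftrightarrow> (\<exists>B. finite B \<and> card B = n \<and> B \<subseteq> V \<and>
     (\<forall>c. (\<Sum>b\<in>B. scalar_mult (c b) b) \<in> W \<longrightarrow> (\<forall>b\<in>B. c b = 0)) \<and>
     (\<forall>v\<in>V. \<exists>c. v - (\<Sum>b\<in>B. scalar_mult (c b) b) \<in> W))"

text \<open>
  The genus $\dim H^1(C, \mathcal{O}_C)$ of the smooth projective curve $C$ over an algebraically
  closed field with the above function field, computed as Cech cohomology for the covering of $C$
  by the inverse images $U_0$, $U_\infty$ of the affine lines $\mathbb{P}^1 - \{\infty\}$ and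
  $\mathbb{P}^1 - \{0\}$.  As $C$ is the normalisation of $\mathbb{P}^1$ in its function field, the
  regular functions on $U_0$, $U_\infty$ and $U_0 \cap U_\infty$ are the integral closures of
  $K[x]$, $K[x^{-1}]$ and $K[x, x^{-1}]$.
\<close>
definition genus :: "'a::alg_closed_field poly \<Rightarrow> nat" where
  "genus f = (THE n. quotient_dim
     (integral_closure f ring_x_inv_x)
     {u + v | u v. u \<in> integral_closure f ring_x \<and> v \<in> integral_closure f ring_inv_x} n)"


section \<open>Points, ramification and Frobenius\<close>

text \<open>
  Points of $\mathbb{P}^1$ are elements of the type \<open>'a option\<close>, with \<open>None\<close> for $\infty$.  The
  value of \<open>f\<close> at $\infty$ is the value at $\infty$ of $f(x) / x^{3m}$ with $m$ the least
  integer such that $3m \geq \deg f$.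
\<close>
definition eval_P1 :: "'a::field poly \<Rightarrow> 'a option \<Rightarrow> 'a" where
  "eval_P1 f a = (case a of
      None \<Rightarrow> if 3 dvd degree f then lead_coeff f else 0
    | Some b \<Rightarrow> poly f b)"

text \<open>
  The geometric points of $C_f$, as pairs of a point of $\mathbb{P}^1$ and the value of the
  coordinate $y$ (of $y / x^m$ over $\infty$).  Where $f$ vanishes, its order (at $\infty$: the order
  of $f(x) / x^{3m}$) is prime to 3, since $f$ is cube-free; so there is exactly one point of the
  smooth curve over such a point, although the plane model may be singular there.
\<close>
definition curve_points :: "'k::field poly \<Rightarrow> ('k alg_closure option \<times> 'k alg_closure) set" where
  "curve_points f = {(a, y). y ^ 3 = eval_P1 (geom f) a}"

text \<open>The points at which the covering of degree 3 given by \<open>fst\<close> is ramified: those lying in a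
  fibre with fewer than 3 points.\<close>
definition ramification_points ::
    "'k::field poly \<Rightarrow> ('k alg_closure option \<times> 'k alg_closure) set" where
  "ramification_points f =
     {P \<in> curve_points f. card {Q \<in> curve_points f. fst Q = fst P} < 3}"

definition frobenius ::
    "'k::finite_field alg_closure option \<times> 'k alg_closure \<Rightarrow> 'k alg_closure option \<times> 'k alg_closure"
  where "frobenius = (\<lambda>(a, y). (map_option (\<lambda>b. b ^ CARD('k)) a, y ^ CARD('k)))"

text \<open>The number of cycles of length \<open>i\<close> of a permutation \<open>\<sigma>\<close> of a set \<open>R\<close>
  (fixed points are cycles of length 1).\<close>
definition cycle_count :: "'a set \<Rightarrow> ('a \<Rightarrow> 'a) \<Rightarrow> nat \<Rightarrow> nat" where
  "cycle_count R \<sigma> i = card {C. (\<exists>P\<in>R. C = orbit \<sigma> P) \<and> card C = i}"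


section \<open>The characteristic polynomial of Frobenius\<close>

definition P1_points :: "nat \<Rightarrow> 'k::finite_field alg_closure option set" where
  "P1_points n = insert None (Some ` {a. a ^ (CARD('k) ^ n) = a})"

text \<open>The cubic residue symbol $\chi_n$ on $\mathbb{F}_{q^n}$, where \<open>r\<close> is the chosen primitive
  cube root of unity in $k$.\<close>
definition cubic_symbol ::
    "'k::finite_field \<Rightarrow> 'l::field \<Rightarrow> nat \<Rightarrow> 'k alg_closure \<Rightarrow> 'l" where
  "cubic_symbol r \<rho> n a = (if a = 0 then 0
     else \<rho> ^ (LEAST i. a ^ ((CARD('k) ^ n - 1) div 3) = to_ac r ^ i))"

text \<open>
  The trace of the \<open>n\<close>-th power of the geometric $q$-Frobenius on $H^1_c(C_f)^\rho$, as given by the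
  Lefschetz trace formula.
\<close>
definition frobenius_trace ::
    "'k::finite_field \<Rightarrow> 'l::field \<Rightarrow> 'k poly \<Rightarrow> nat \<Rightarrow> 'l" where
  "frobenius_trace r \<rho> f n =
     - (\<Sum>a\<in>P1_points n. cubic_symbol r \<rho> n (eval_P1 (geom f) a))"

text \<open>
  The eigenvalues of Frobenius on $H^1_c(C_f)^\rho$, with multiplicities.  The libraries have no
  etale cohomology; but this space has dimension $g$, and in characteristic 0 a family of $g$
  elements is determined by its power sums.
\<close>
definition frobenius_eigenvalues ::
    "'k::finite_field \<Rightarrow> 'l::{alg_closed_field, field_char_0} \<Rightarrow> 'k poly \<Rightarrow> 'l multiset" where
  "frobenius_eigenvalues r \<rho> f = (THE M. size M = genus (geom f) \<and>
     (\<forall>n\<ge>1. (\<Sum>\<alpha>\<in>#M. \<alpha> ^ n) = frobenius_trace r \<rho> f n))"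

definition ch_rho ::
    "'k::finite_field \<Rightarrow> 'l::{alg_closed_field, field_char_0} \<Rightarrow> 'k poly \<Rightarrow> 'l poly" where
  "ch_rho r \<rho> f = (\<Prod>\<alpha>\<in>#frobenius_eigenvalues r \<rho> f. [:- \<alpha>, 1:])"


section \<open>Reduction modulo $1 - \rho$\<close>

definition eisenstein :: "'l::field \<Rightarrow> 'l set" where
  "eisenstein \<rho> = {of_int a + of_int b * \<rho> | a b. True}"

text \<open>The reduction $\mathbb{Z}[\rho] \to \mathbb{Z}[\rho]/(1-\rho) = \mathbb{Z}/3\mathbb{Z}$,
  meaningless outside $\mathbb{Z}[\rho]$.  The type \<open>3\<close> is the ring of integers modulo 3.\<close>
definition reduce :: "'l::field \<Rightarrow> 'l \<Rightarrow> 3" where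
  "reduce \<rho> z = (THE c. \<exists>m w. c = of_int m \<and> w \<in> eisenstein \<rho> \<and> z = of_int m + (1 - \<rho>) * w)"

end

theory Submission
  imports Defs
begin

text \<open>
  Write $\chi(h)$ for the cubic residue symbol of the resultant of \<open>h\<close> and \<open>f\<close>, a character on the
  monic polynomials \<open>h\<close> over $k$.  Grouping the points $a \in \mathbb{F}_{q^n}$ by their
  characteristic polynomials shows that the sums $\sum_a \chi_n(f(a))$ are the coefficients of
  $T L'/L$ with $L(T) = \sum_h \chi(h) T^{\deg h}$.  As $\chi(h)$ depends only on \<open>h\<close> modulo the
  radical of \<open>f\<close> and is nontrivial, $L$ is a polynomial; with its Euler factor at infinity it has
  degree at most $g$, where $g$ is two less than the number of ramification points by a computation
  of the Cech cohomology: the integral closures are free, with basis $1, y, y^2 / B$ on the affine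
  part, $B$ being the product over the double roots of \<open>f\<close>.  So the eigenvalues of Frobenius are
  the reciprocal roots of this polynomial, padded by zeros if its degree is less than $g$.

  Modulo $1 - \rho$ all nonzero values of $\chi$ become 1, and $L$ becomes the L-series of the
  trivial character modulo the radical of \<open>f\<close>.  Comparing logarithmic derivatives, this is
  $\prod_C (1 - T^{|C|}) / (1 - q T)$ with \<open>C\<close> ranging over the Frobenius orbits of roots of \<open>f\<close>,
  and $q = 1$ in $\mathbb{Z}/3\mathbb{Z}$.
\<close>

section \<open>Valuations and the integral closure\<close>

text \<open>\<open>genus\<close> and \<open>frobenius_eigenvalues\<close> are definite descriptions,
  so existence and uniqueness have to be shown for both: a basis and an exchange argument for the
  Cech quotient, a factorization of the L-polynomial and the determination of a multiset by its
  power sums for the eigenvalues. The bound g on the degree is delicate if 3 divides deg f. The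
  vanishing of the sums over monics of large degree only bounds the degree of L by g + 1, and L must
  have a zero that cancels the Euler factor at infinity. It comes from summing the character over
  all polynomials of small degree, where scaling by constants does not change its values. A
  logarithmic derivative does not determine a power series over Z/3, where n = 0 for 3 | n. So the
  L-series of the trivial character is lifted to the integers, identified there with the product
  over orbits, and only the resulting identity is reduced. Series are turned back into polynomials
  by reversal with a prescribed degree, since top coefficients of the L-series may vanish.\<close>

locale valuation =
  fixes v :: "'b::field \<Rightarrow> int"
  assumes mult: "x \<noteq> 0 \<Longrightarrow> y \<noteq> 0 \<Longrightarrow> v (x * y) = v x + v y"
    and add: "x \<noteq> 0 \<Longrightarrow> y \<noteq> 0 \<Longrightarrow> x + y \<noteq> 0 \<Longrightarrow> min (v x) (v y) \<le> v (x + y)"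
begin

lemma v_one [simp]: "v 1 = 0"
  using mult[of 1 1] by simp

lemma v_power: "x \<noteq> 0 \<Longrightarrow> v (x ^ n) = int n * v x"
  by (induction n) (auto simp: mult algebra_simps)

lemma v_minus_one: "v (- 1) = 0"
  using mult[of "-1" "-1"] by simp

lemma v_uminus: "v (- x) = v x"
  using mult[of "-1" x] v_minus_one by (cases "x = 0") auto

end

lemma pcompose_power: "pcompose (p ^ n) q = pcompose p q ^ n"
  for p q :: "'b::comm_ring_1 poly"
  by (induction n) (simp_all add: pcompose_1 pcompose_mult)

text \<open>The weight of $y = \sqrt[3]{c}$ is a third of $v(c)$; everything is scaled by 3.\<close>

definition weight_ge :: "('b::field \<Rightarrow> int) \<Rightarrow> 'b \<Rightarrow> nat \<Rightarrow> int \<Rightarrow> 'b \<Rightarrow> bool" where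
  "weight_ge v c i N x \<longleftrightarrow> x = 0 \<or> N \<le> 3 * v x + int i * v c"

definition gauss_ge :: "('b::field \<Rightarrow> int) \<Rightarrow> 'b \<Rightarrow> int \<Rightarrow> 'b poly \<Rightarrow> bool" where
  "gauss_ge v c N u \<longleftrightarrow> (\<forall>i. weight_ge v c i N (coeff u i))"

definition cubic :: "'b::field \<Rightarrow> 'b poly" where
  "cubic c = monom 1 3 - [:c:]"

lemma coeff_cubic: "coeff (cubic c) i = (if i = 3 then 1 else if i = 0 then - c else 0)"
  by (auto simp: cubic_def coeff_pCons split: nat.split)

lemma degree_cubic [simp]: "degree (cubic c) = 3"
proof (rule antisym)
  show "degree (cubic c) \<le> 3"
    by (rule degree_le) (auto simp: coeff_cubic)
  show "3 \<le> degree (cubic c)"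
    by (rule le_degree) (auto simp: coeff_cubic)
qed

lemma cubic_nonzero [simp]: "cubic c \<noteq> 0"
  using degree_cubic[of c] by (metis degree_0 zero_neq_numeral)

lemma dvd_diff_mult:
  fixes k :: "'b::comm_ring_1"
  assumes "k dvd a - b" "k dvd a' - b'"
  shows "k dvd a * a' - b * b'"
proof -
  have "a * a' - b * b' = (a - b) * a' + b * (a' - b')"
    by (simp add: algebra_simps)
  then show ?thesis using assms by (metis dvd_add dvd_mult dvd_mult2)
qed

lemma dvd_diff_power:
  fixes k :: "'b::comm_ring_1"
  assumes "k dvd a - b"
  shows "k dvd a ^ n - b ^ n"
  by (induction n) (auto intro: dvd_diff_mult assms)

lemma dvd_diff_trans:
  fixes k :: "'b::comm_ring_1"
  assumes "k dvd a - b" "k dvd b - c"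
  shows "k dvd a - c"
  using dvd_add[OF assms] by simp

lemma degree_lt_3:
  fixes z :: "'b::zero poly"
  assumes "degree z < 3"
  shows "z = [:coeff z 0, coeff z 1, coeff z 2:]"
  using assms
  by (intro poly_eqI) (auto simp: coeff_pCons coeff_eq_0 numeral_2_eq_2 split: nat.split)

locale cubic_valuation = valuation v for v :: "'b::field \<Rightarrow> int" +
  fixes c \<omega> :: 'b
  assumes c: "c \<noteq> 0" and \<omega>: "\<omega>\<^sup>2 + \<omega> + 1 = 0" and three: "(3::'b) \<noteq> 0" "v 3 = 0"
begin

abbreviation "wt \<equiv> weight_ge v c"
abbreviation "G \<equiv> gauss_ge v c"

lemma wt_add: "wt i N x \<Longrightarrow> wt i N y \<Longrightarrow> wt i N (x + y)"
  using add[of x y] by (cases "x = 0"; cases "y = 0"; cases "x + y = 0") (auto simp: weight_ge_def)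

lemma wt_uminus: "wt i N x \<Longrightarrow> wt i N (- x)"
  by (auto simp: weight_ge_def v_uminus)

lemma wt_sum: "(\<And>a. a \<in> A \<Longrightarrow> wt i N (g a)) \<Longrightarrow> wt i N (sum g A)"
  by (induction A rule: infinite_finite_induct) (auto intro: wt_add simp: weight_ge_def[of _ _ _ _ 0])

lemma wt_mult: "wt i M x \<Longrightarrow> wt j N y \<Longrightarrow> wt (i + j) (M + N) (x * y)"
  by (cases "x = 0"; cases "y = 0") (auto simp: weight_ge_def mult algebra_simps)

lemma G_0 [simp]: "G N 0"
  by (simp add: gauss_ge_def weight_ge_def)

lemma G_add: "G N p \<Longrightarrow> G N q \<Longrightarrow> G N (p + q)"
  by (auto simp: gauss_ge_def intro: wt_add)

lemma G_diff: "G N p \<Longrightarrow> G N q \<Longrightarrow> G N (p - q)"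
  unfolding gauss_ge_def coeff_diff
  by (metis diff_conv_add_uminus wt_add wt_uminus)

lemma G_sum: "(\<And>a. a \<in> A \<Longrightarrow> G N (g a)) \<Longrightarrow> G N (sum g A)"
  by (induction A rule: infinite_finite_induct) (auto intro: G_add)

lemma G_mult: "G M p \<Longrightarrow> G N q \<Longrightarrow> G (M + N) (p * q)"
  unfolding gauss_ge_def
proof
  fix n
  assume "\<forall>i. wt i M (coeff p i)" "\<forall>i. wt i N (coeff q i)"
  then have "wt (i + (n - i)) (M + N) (coeff p i * coeff q (n - i))" for i
    by (intro wt_mult) auto
  then have "i \<le> n \<Longrightarrow> wt n (M + N) (coeff p i * coeff q (n - i))" for i
    by (metis le_add_diff_inverse)
  then show "wt n (M + N) (coeff (p * q) n)"
    unfolding coeff_mult by (intro wt_sum) auto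
qed

lemma G_mono: "G N u \<Longrightarrow> M \<le> N \<Longrightarrow> G M u"
  by (force simp: gauss_ge_def weight_ge_def)

lemma G_ex: "\<exists>N. G N u"
proof -
  define N where "N = Min ((\<lambda>i. 3 * v (coeff u i) + int i * v c) ` {..degree u})"
  have "wt i N (coeff u i)" for i
  proof (cases "i \<le> degree u")
    case True
    then have "N \<le> 3 * v (coeff u i) + int i * v c"
      unfolding N_def by (intro Min_le) auto
    then show ?thesis by (simp add: weight_ge_def)
  next
    case False
    then show ?thesis by (simp add: weight_ge_def coeff_eq_0)
  qed
  then show ?thesis unfolding gauss_ge_def by blast
qed

lemma G_of_nat_mult: "G N u \<Longrightarrow> G N (of_nat k * u)"
  by (induction k) (auto simp: algebra_simps intro: G_add)

lemma G_smult: "a = 0 \<or> 0 \<le> v a \<Longrightarrow> G N u \<Longrightarrow> G N (smult a u)"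
  using wt_mult[of 0 0 a _ N] by (cases "a = 0") (auto simp: gauss_ge_def weight_ge_def[of _ _ 0])

text \<open>Replacing y^3 by \<open>c\<close> preserves the weight, so division by
  \<open>cubic c\<close> with remainder costs nothing in the bound.\<close>

lemma G_reduce:
  assumes "G N u"
  shows "\<exists>u'. degree u' < 3 \<and> G N u' \<and> cubic c dvd u - u'"
  using assms
proof (induction "degree u" arbitrary: u rule: less_induct)
  case less
  show ?case
  proof (cases "degree u < 3")
    case True
    with less.prems show ?thesis by (intro exI[of _ u]) auto
  next
    case False
    define d where "d = degree u"
    define l where "l = coeff u d"
    define u1 where "u1 = u - monom l (d - 3) * cubic c"
    have d3: "d \<ge> 3" using False by (simp add: d_def)
    have u1_alt: "u1 = u - monom l d + monom (l * c) (d - 3)"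
      using d3 by (simp add: u1_def cubic_def right_diff_distrib mult_monom flip: monom_0)
    have "wt d N l" using less.prems by (auto simp: gauss_ge_def l_def)
    then have "G N (monom l d)" "G N (monom (l * c) (d - 3))"
      using d3 c by (cases "l = 0"; auto simp: gauss_ge_def weight_ge_def mult of_nat_diff algebra_simps)+
    then have G1: "G N u1" unfolding u1_alt by (intro G_add G_diff less.prems)
    have deg: "degree u1 < d"
    proof (rule degree_lessI)
      show "u1 \<noteq> 0 \<or> d > 0" using d3 by auto
      show "\<forall>k\<ge>d. coeff u1 k = 0"
        using d3 by (auto simp: u1_alt l_def coeff_eq_0 d_def)
    qed
    obtain u' where u': "degree u' < 3" "G N u'" "cubic c dvd u1 - u'"
      using less.hyps[OF _ G1] deg by (auto simp: d_def)
    have "cubic c dvd u - u1" by (simp add: u1_def)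
    then show ?thesis using u' dvd_diff_trans by blast
  qed
qed

text \<open>Integral elements are power-bounded.  The power-bounded elements form a ring that is stable
  under $y \mapsto \omega y$, hence contain the components $z_i y^i$ of each of their members; this
  avoids the proof that the integral elements form a ring.\<close>

definition power_bounded :: "'b poly \<Rightarrow> bool" where
  "power_bounded z \<longleftrightarrow> (\<exists>N. \<forall>n. \<exists>u. G N u \<and> cubic c dvd z ^ n - u)"

text \<open>The bounds for y^k and z^(n-k) do not depend on the exponents, so they bound every term
  of the binomial expansion; binomial coefficients are integers and cannot lower a bound.\<close>

lemma power_bounded_add:
  assumes "power_bounded y" "power_bounded z"
  shows "power_bounded (y + z)"
proof -
  obtain M U where U: "\<And>n. G M (U n)" "\<And>n. cubic c dvd y ^ n - U n"
    using assms(1) unfolding power_bounded_def by metis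
  obtain N V where V: "\<And>n. G N (V n)" "\<And>n. cubic c dvd z ^ n - V n"
    using assms(2) unfolding power_bounded_def by metis
  have "\<exists>u. G (M + N) u \<and> cubic c dvd (y + z) ^ n - u" for n
  proof (intro exI conjI)
    let ?u = "\<Sum>k\<le>n. of_nat (n choose k) * (U k * V (n - k))"
    show "G (M + N) ?u"
      by (intro G_sum G_of_nat_mult G_mult U V)
    have "(y + z) ^ n - ?u =
      (\<Sum>k\<le>n. of_nat (n choose k) * (y ^ k * z ^ (n - k) - U k * V (n - k)))"
      by (simp add: binomial_ring sum_subtractf algebra_simps)
    also have "cubic c dvd \<dots>"
      by (intro dvd_sum dvd_mult dvd_diff_mult U V)
    finally show "cubic c dvd (y + z) ^ n - ?u" .
  qed
  then show ?thesis unfolding power_bounded_def by blast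
qed

lemma power_bounded_smult:
  assumes "power_bounded z" "a = 0 \<or> 0 \<le> v a"
  shows "power_bounded (smult a z)"
proof -
  obtain N U where U: "\<And>n. G N (U n)" "\<And>n. cubic c dvd z ^ n - U n"
    using assms(1) unfolding power_bounded_def by metis
  have "\<exists>u. G N u \<and> cubic c dvd smult a z ^ n - u" for n
  proof (intro exI conjI)
    show "G N (smult (a ^ n) (U n))"
      using assms(2) by (intro G_smult U) (cases "a = 0"; cases "n = 0"; auto simp: v_power)
    show "cubic c dvd smult a z ^ n - smult (a ^ n) (U n)"
      using U(2)[of n] by (simp add: smult_power dvd_smult flip: smult_diff_right)
  qed
  then show ?thesis unfolding power_bounded_def by blast
qed

lemma power_bounded_power:
  assumes "power_bounded z"
  shows "power_bounded (z ^ k)"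
  using assms unfolding power_bounded_def by (metis power_mult)

lemma power_bounded_cong:
  assumes "power_bounded z" "cubic c dvd y - z"
  shows "power_bounded y"
  using assms unfolding power_bounded_def by (meson dvd_diff_trans dvd_diff_power)

lemma v_\<omega>: "\<omega> \<noteq> 0" "\<omega> ^ 3 = 1" "v \<omega> = 0"
proof -
  show "\<omega> \<noteq> 0" using \<omega> by auto
  have "\<omega> ^ 3 - 1 = (\<omega> - 1) * (\<omega>\<^sup>2 + \<omega> + 1)"
    by (simp add: power2_eq_square power3_eq_cube algebra_simps)
  then show "\<omega> ^ 3 = 1" using \<omega> by simp
  then show "v \<omega> = 0" using v_power[OF \<open>\<omega> \<noteq> 0\<close>, of 3] by simp
qed

text \<open>The substitution fixes \<open>cubic c\<close>, because \<omega>^3 = 1, and preserves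
  weights, because \<open>v \<omega> = 0\<close>.\<close>

lemma power_bounded_conj:
  assumes "power_bounded z"
  shows "power_bounded (pcompose z [:0, \<omega>:])"
proof -
  obtain N U where U: "\<And>n. G N (U n)" "\<And>n. cubic c dvd z ^ n - U n"
    using assms(1) unfolding power_bounded_def by metis
  have inv: "pcompose (cubic c) [:0, \<omega>:] = cubic c"
    using v_\<omega> by (intro poly_eqI) (auto simp: coeff_pcompose_linear coeff_cubic)
  have "\<exists>u. G N u \<and> cubic c dvd pcompose z [:0, \<omega>:] ^ n - u" for n
  proof (intro exI conjI)
    show "G N (pcompose (U n) [:0, \<omega>:])"
      using U(1)[of n] wt_mult[of 0 0 "\<omega> ^ i" i N "coeff (U n) i" for i] v_\<omega>
      by (auto simp: gauss_ge_def weight_ge_def[of _ _ 0] coeff_pcompose_linear v_power)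
    have "pcompose (cubic c) [:0, \<omega>:] dvd pcompose (z ^ n - U n) [:0, \<omega>:]"
      using U(2)[of n] by (metis dvd_def pcompose_mult)
    then show "cubic c dvd pcompose z [:0, \<omega>:] ^ n - pcompose (U n) [:0, \<omega>:]"
      by (simp add: inv pcompose_diff pcompose_power)
  qed
  then show ?thesis unfolding power_bounded_def by blast
qed

text \<open>If \<open>v a\<close> is negative, the valuations of the powers of a are unbounded
  below. A constant is its own remainder modulo \<open>cubic c\<close>, so by
  \<open>G_reduce\<close> no congruent polynomial can satisfy a better bound.\<close>

lemma power_bounded_const:
  assumes "power_bounded [:a:]"
  shows "a = 0 \<or> 0 \<le> v a"
proof (rule ccontr)
  assume contra: "\<not> ?thesis"
  obtain N U where U: "\<And>n. G N (U n)" "\<And>n. cubic c dvd [:a:] ^ n - U n"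
    using assms unfolding power_bounded_def by metis
  have bd: "N \<le> 3 * (int n * v a)" for n
  proof -
    obtain u' where u': "degree u' < 3" "G N u'" "cubic c dvd U n - u'"
      using G_reduce[OF U(1)] by blast
    have "cubic c dvd [:a:] ^ n - u'" using dvd_diff_trans U(2) u'(3) by blast
    moreover have pw: "[:a:] ^ n = [:a ^ n:]"
      by (induction n) (auto simp: one_pCons)
    moreover have "degree ([:a ^ n:] - u') < 3"
      using u'(1) by (intro le_less_trans[OF degree_diff_le_max]) auto
    ultimately have "[:a ^ n:] = u'"
      by (metis degree_cubic dvd_imp_degree_le leD right_minus_eq)
    then have "wt 0 N (a ^ n)" using u'(2) by (metis gauss_ge_def coeff_pCons_0)
    then show ?thesis using contra by (auto simp: weight_ge_def v_power)
  qed
  have "v a \<le> - 1" using contra by auto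
  then have "int (nat (\<bar>N\<bar> + 1)) * v a \<le> int (nat (\<bar>N\<bar> + 1)) * (- 1)"
    by (intro mult_left_mono) auto
  then show False using bd[of "nat (\<bar>N\<bar> + 1)"] by auto
qed

text \<open>Modulo \<open>cubic c\<close> the equation puts all powers of z into the span of the z^i
  with i < m, with coefficients of nonnegative valuation; these finitely many powers have a common
  bound.\<close>

lemma integral_imp_power_bounded:
  assumes p: "lead_coeff p = 1" "\<forall>i. coeff p i = 0 \<or> 0 \<le> v (coeff p i)"
    and dvd: "cubic c dvd pcompose p z"
  shows "power_bounded z"
proof -
  define m where "m = degree p"
  have red: "\<exists>r. (\<forall>i\<ge>m. coeff r i = 0) \<and> (\<forall>i. wt 0 0 (coeff r i)) \<and>
      cubic c dvd z ^ n - pcompose r z" for n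
  proof (cases "m = 0")
    case True
    \<comment> \<open>An equation of degree 0 makes \<open>cubic c\<close> a divisor of 1, so every
      congruence holds.\<close>
    then have "p = 1" using p(1) by (auto simp: m_def elim!: degree_eq_zeroE)
    then have "cubic c dvd 1" using dvd by (simp add: pcompose_1)
    then show ?thesis by (intro exI[of _ 0]) (auto simp: weight_ge_def intro: dvd_trans[OF _ one_dvd])
  next
    case False
    show ?thesis
    proof (induction n)
      case 0
      show ?case using False by (intro exI[of _ 1]) (auto simp: weight_ge_def coeff_1 pcompose_1)
    next
      case (Suc n)
      then obtain r where r: "\<forall>i\<ge>m. coeff r i = 0" "\<forall>i. wt 0 0 (coeff r i)"
        "cubic c dvd z ^ n - pcompose r z" by blast
      \<comment> \<open>Multiplication by the unknown, then removal of the term of degree m by means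
        of the monic \<open>p\<close>.\<close>
      define r' where "r' = pCons 0 r - smult (coeff r (m - 1)) p"
      have 1: "\<forall>i\<ge>m. coeff r' i = 0"
      proof safe
        fix i assume "i \<ge> m"
        then show "coeff r' i = 0"
          using r(1) p(1) False
          by (cases "i = m") (auto simp: r'_def coeff_pCons m_def coeff_eq_0 split: nat.split)
      qed
      have "wt 0 0 (coeff p i)" for i
        using p(2)[rule_format, of i] by (auto simp: weight_ge_def)
      then have "wt 0 0 (coeff r (m - 1) * coeff p i)" for i
        using wt_mult[of 0 0 _ 0 0] r(2) by auto
      moreover have "wt 0 0 (coeff (pCons 0 r) i)" for i
        using r(2) by (auto simp: coeff_pCons weight_ge_def split: nat.split)
      ultimately have 2: "\<forall>i. wt 0 0 (coeff r' i)"
        unfolding r'_def coeff_diff coeff_smult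
        by (metis diff_conv_add_uminus wt_add wt_uminus)
      have "z ^ Suc n - pcompose r' z =
        z * (z ^ n - pcompose r z) + smult (coeff r (m - 1)) (pcompose p z)"
        by (simp add: r'_def pcompose_diff pcompose_smult pcompose_pCons algebra_simps)
      also have "cubic c dvd \<dots>"
        by (intro dvd_add dvd_mult r(3) dvd_smult dvd)
      finally show ?case using 1 2 by blast
    qed
  qed
  define Ni where "Ni i = (SOME N. G N (z ^ i))" for i
  have Ni: "G (Ni i) (z ^ i)" for i unfolding Ni_def by (rule someI_ex[OF G_ex])
  define N where "N = Min (insert 0 (Ni ` {..<m}))"
  have GN: "G N (z ^ i)" if "i < m" for i
    using that by (intro G_mono[OF Ni]) (auto simp: N_def)
  have "\<exists>u. G N u \<and> cubic c dvd z ^ n - u" for n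
  proof -
    obtain r where r: "\<forall>i\<ge>m. coeff r i = 0" "\<forall>i. wt 0 0 (coeff r i)"
        "cubic c dvd z ^ n - pcompose r z" using red by blast
    have "pcompose r z = (\<Sum>i\<le>degree r. smult (coeff r i) (z ^ i))"
      by (simp add: pcompose_altdef poly_altdef coeff_map_poly degree_map_poly)
    moreover have "G N (smult (coeff r i) (z ^ i))" for i
      using r(1,2) GN by (cases "i < m") (auto intro!: G_smult simp: weight_ge_def)
    ultimately have "G N (pcompose r z)" by (auto intro: G_sum)
    then show ?thesis using r(3) by blast
  qed
  then show ?thesis unfolding power_bounded_def by blast
qed

text \<open>The sums of the three conjugates of z, twisted by powers of \<omega>, isolate 3 z0, 3 z1
  y and 3 z2 y^2. The cubes of the last two are constants modulo \<open>cubic c\<close>, to which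
  \<open>power_bounded_const\<close> applies; 3 is a unit for \<open>v\<close>.\<close>

lemma power_bounded_imp_G:
  assumes z: "degree z < 3" and bd: "power_bounded z"
  shows "G 0 z"
proof -
  obtain z0 z1 z2 where z_eq: "z = [:z0, z1, z2:]" using degree_lt_3[OF z] by blast
  have sq: "\<omega>\<^sup>2 = - 1 - \<omega>"
    using \<omega> by (simp add: algebra_simps eq_neg_iff_add_eq_0)
  then have mul: "\<omega> * \<omega> = - 1 - \<omega>" "\<omega> * (\<omega> * a) = - a - \<omega> * a" for a
    by (simp_all add: power2_eq_square flip: mult.assoc) (simp add: algebra_simps)
  define y where "y = pcompose z [:0, \<omega>:]"
  define x where "x = pcompose y [:0, \<omega>:]"
  have y: "y = [:z0, \<omega> * z1, - z2 - \<omega> * z2:]" and x: "x = [:z0, - z1 - \<omega> * z1, \<omega> * z2:]"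
    unfolding y_def x_def z_eq by (simp_all add: pcompose_pCons mul algebra_simps)
  have bdy: "power_bounded y" and bdx: "power_bounded x"
    unfolding x_def y_def by (intro power_bounded_conj bd)+
  have bs: "power_bounded (smult (\<omega> ^ i) u)" if "power_bounded u" for i u
    using that v_\<omega> by (intro power_bounded_smult) (auto simp: v_power)
  have n27: "(27::'b) \<noteq> 0"
    using three(1) power_eq_0_iff[of "3::'b" 3] by simp
  have v27: "v 27 = 0"
    using v_power[OF three(1), of 3] three(2) by simp
  have "z + y + x = [:3 * z0:]" by (simp add: z_eq x y)
  then have "power_bounded [:3 * z0:]"
    using power_bounded_add[OF power_bounded_add[OF bd bdy] bdx] by simp
  then have 0: "z0 = 0 \<or> 0 \<le> v z0"
    using power_bounded_const[of "3 * z0"] three mult[of 3 z0] by (cases "z0 = 0") auto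
  have "z + smult (\<omega> ^ 2) y + smult (\<omega> ^ 1) x = [:0, 3 * z1:]"
    unfolding sq by (simp add: z_eq x y mul algebra_simps)
  then have "power_bounded ([:0, 3 * z1:] ^ 3)"
    using power_bounded_power power_bounded_add[OF power_bounded_add[OF bd bs[OF bdy]] bs[OF bdx]]
    by metis
  moreover have "cubic c dvd [:27 * z1 ^ 3 * c:] - [:0, 3 * z1:] ^ 3"
  proof -
    have "[:27 * z1 ^ 3 * c:] - [:0, 3 * z1:] ^ 3 = smult (- 27 * z1 ^ 3) (cubic c)"
      by (rule poly_eqI)
        (auto simp: coeff_cubic power3_eq_cube coeff_pCons algebra_simps split: nat.split)
    then show ?thesis by (simp add: dvd_smult)
  qed
  ultimately have "27 * z1 ^ 3 * c = 0 \<or> 0 \<le> v (27 * z1 ^ 3 * c)"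
    using power_bounded_cong power_bounded_const by blast
  then have 1: "z1 = 0 \<or> 0 \<le> 3 * v z1 + v c"
    using c n27 by (cases "z1 = 0") (auto simp: mult v27 v_power)
  have "z + smult (\<omega> ^ 1) y + smult (\<omega> ^ 2) x = [:0, 0, 3 * z2:]"
    unfolding sq by (simp add: z_eq x y mul algebra_simps)
  then have "power_bounded ([:0, 0, 3 * z2:] ^ 3)"
    using power_bounded_power power_bounded_add[OF power_bounded_add[OF bd bs[OF bdy]] bs[OF bdx]]
    by metis
  moreover have "cubic c dvd [:27 * z2 ^ 3 * c\<^sup>2:] - [:0, 0, 3 * z2:] ^ 3"
  proof -
    have "[:27 * z2 ^ 3 * c\<^sup>2:] - [:0, 0, 3 * z2:] ^ 3 =
        smult (- 27 * z2 ^ 3) (cubic c * (monom 1 3 + [:c:]))"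
      by (simp add: cubic_def power3_eq_cube power2_eq_square algebra_simps monom_altdef)
    then show ?thesis by (simp add: dvd_smult)
  qed
  ultimately have "27 * z2 ^ 3 * c\<^sup>2 = 0 \<or> 0 \<le> v (27 * z2 ^ 3 * c\<^sup>2)"
    using power_bounded_cong power_bounded_const by blast
  then have 2: "z2 = 0 \<or> 0 \<le> 3 * v z2 + 2 * v c"
    using c n27 by (cases "z2 = 0") (auto simp: mult v27 v_power)
  show ?thesis
    using 0 1 2 unfolding gauss_ge_def
    by (auto simp: z_eq weight_ge_def coeff_pCons split: nat.split)
qed

lemma nonneg_closed:
  shows "x = 0 \<or> 0 \<le> v x \<Longrightarrow> y = 0 \<or> 0 \<le> v y \<Longrightarrow> x + y = 0 \<or> 0 \<le> v (x + y)"
    and "x = 0 \<or> 0 \<le> v x \<Longrightarrow> y = 0 \<or> 0 \<le> v y \<Longrightarrow> x * y = 0 \<or> 0 \<le> v (x * y)"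
    and "x = 0 \<or> 0 \<le> v x \<Longrightarrow> - x = 0 \<or> 0 \<le> v (- x)"
  using wt_add[of 0 0 x y] wt_mult[of 0 0 x 0 0 y] wt_uminus[of 0 0 x]
  by (auto simp: weight_ge_def)

end

text \<open>The characteristic polynomial of z0 + z1 y + z2 y^2, that is, the product of T minus
  each of its three conjugates. Differences are written with unary minus to match the closure rules
  in \<open>nonneg_closed\<close>.\<close>

definition min_poly_coeffs :: "'b::field \<Rightarrow> 'b \<Rightarrow> 'b \<Rightarrow> 'b \<Rightarrow> 'b poly" where
  "min_poly_coeffs c z0 z1 z2 =
    [:- (z0 ^ 3) + 3 * (z0 * (z1 * z2 * c)) + (- (z1 ^ 3 * c) + - (z2 ^ 3 * c\<^sup>2)),
      3 * (z0 * z0 + - (z1 * z2 * c)), - (3 * z0), 1:]"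

lemma cubic_dvd_min_poly:
  "cubic c dvd pcompose (min_poly_coeffs c z0 z1 z2) [:z0, z1, z2:]"
proof -
  \<comment> \<open>With u = z1 y + z2 y^2 the value is u^3 - 3 z1 z2 c u - z1^3 c - z2^3 c^2; its
    terms pair up to multiples of y^3 - c.\<close>
  have "pcompose (min_poly_coeffs c z0 z1 z2) [:z0, z1, z2:] = cubic c *
    ([:z1 ^ 3:] + smult (z2 ^ 3) (monom 1 3 + [:c:]) + [:0, 3 * z1\<^sup>2 * z2, 3 * z1 * z2\<^sup>2:])"
    by (simp add: min_poly_coeffs_def cubic_def pcompose_pCons power3_eq_cube power2_eq_square
        algebra_simps monom_altdef)
  then show ?thesis by simp
qed

text \<open>Power-boundedness gives one inclusion, the characteristic polynomial the other.
  Arbitrary intersections \<open>A\<close> of valuation rings are allowed, so that K[x], K[x^-1] and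
  K[x, x^-1] are covered by one proof.\<close>

lemma integral_closure_eq:
  fixes f :: "'a::field poly"
  assumes v: "\<And>v. v \<in> S \<Longrightarrow> cubic_valuation v (to_fract f) \<omega>"
    and A: "A = {x. \<forall>v\<in>S. x = 0 \<or> 0 \<le> v x}"
  shows "integral_closure f A = {z. degree z < 3 \<and> (\<forall>v\<in>S. gauss_ge v (to_fract f) 0 z)}"
proof (rule equalityI; rule subsetI)
  fix z assume "z \<in> integral_closure f A"
  then obtain p where p: "degree z < 3" "lead_coeff p = 1" "\<forall>i. coeff p i \<in> A"
      "cubic (to_fract f) dvd pcompose p z"
    unfolding integral_closure_def kummer_poly_def cubic_def by auto
  have "gauss_ge v (to_fract f) 0 z" if "v \<in> S" for v
  proof -
    interpret cubic_valuation v "to_fract f" \<omega> using v that .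
    have "power_bounded z"
      using integral_imp_power_bounded p(2-4) A that by blast
    then show ?thesis using power_bounded_imp_G p(1) by blast
  qed
  with p(1) show "z \<in> {z. degree z < 3 \<and> (\<forall>v\<in>S. gauss_ge v (to_fract f) 0 z)}" by blast
next
  fix z assume z: "z \<in> {z. degree z < 3 \<and> (\<forall>v\<in>S. gauss_ge v (to_fract f) 0 z)}"
  define c where "c = to_fract f"
  define z0 z1 z2 where "z0 = coeff z 0" "z1 = coeff z 1" "z2 = coeff z 2"
  note z_defs = z0_z1_z2_def
  have z_eq: "z = [:z0, z1, z2:]"
    using z degree_lt_3 unfolding z_defs by blast
  let ?p = "min_poly_coeffs c z0 z1 z2"
  have "coeff ?p i \<in> A" for i
    unfolding A
  proof (intro CollectI ballI)
    fix v assume vS: "v \<in> S"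
    interpret cubic_valuation v c \<omega> using v[OF vS] by (simp add: c_def)
    have "G 0 z" using z vS by (auto simp: c_def)
    then have w: "z0 = 0 \<or> 0 \<le> v z0" "z1 = 0 \<or> 0 \<le> 3 * v z1 + v c"
      "z2 = 0 \<or> 0 \<le> 3 * v z2 + 2 * v c"
      unfolding z_defs gauss_ge_def weight_ge_def
      by (auto dest: spec[of _ 0] spec[of _ 1] spec[of _ 2])
    have t: "(3::'a poly fract) = 0 \<or> 0 \<le> v 3" using three by simp
    have a: "z1 ^ 3 * c = 0 \<or> 0 \<le> v (z1 ^ 3 * c)"
      using w(2) c by (cases "z1 = 0") (auto simp: mult v_power)
    have b: "z2 ^ 3 * c\<^sup>2 = 0 \<or> 0 \<le> v (z2 ^ 3 * c\<^sup>2)"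
      using w(3) c by (cases "z2 = 0") (auto simp: mult v_power)
    have d: "z1 * z2 * c = 0 \<or> 0 \<le> v (z1 * z2 * c)"
      using w(2,3) c by (cases "z1 = 0"; cases "z2 = 0") (auto simp: mult)
    have e: "z0 ^ 3 = 0 \<or> 0 \<le> v (z0 ^ 3)"
      using w(1) by (cases "z0 = 0") (auto simp: v_power)
    define Q where "Q x \<longleftrightarrow> x = 0 \<or> 0 \<le> v x" for x
    note closed = nonneg_closed[folded Q_def]
    note Q = a[folded Q_def] b[folded Q_def] d[folded Q_def] e[folded Q_def] t[folded Q_def]
      w(1)[folded Q_def]
    have "Q 0" "Q 1" by (simp_all add: Q_def)
    moreover have "Q (- (z0 ^ 3) + 3 * (z0 * (z1 * z2 * c)) + (- (z1 ^ 3 * c) + - (z2 ^ 3 * c\<^sup>2)))"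
      "Q (3 * (z0 * z0 + - (z1 * z2 * c)))" "Q (- (3 * z0))"
      by (intro closed Q)+
    ultimately have "Q (coeff ?p i)"
      unfolding min_poly_coeffs_def coeff_pCons by (simp only: coeff_0 split: nat.split) blast
    then show "coeff ?p i = 0 \<or> 0 \<le> v (coeff ?p i)" by (simp add: Q_def)
  qed
  moreover have "lead_coeff ?p = 1" by (simp add: min_poly_coeffs_def)
  moreover have "kummer_poly f dvd pcompose ?p z"
    using cubic_dvd_min_poly[of c z0 z1 z2] unfolding z_eq by (simp add: c_def cubic_def kummer_poly_def)
  ultimately show "z \<in> integral_closure f A"
    using z unfolding integral_closure_def by blast
qed

section \<open>The places of the projective line\<close>

definition fract_val :: "('a::idom \<Rightarrow> int) \<Rightarrow> 'a fract \<Rightarrow> int" where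
  "fract_val w z = (SOME k. \<exists>p q. p \<noteq> 0 \<and> q \<noteq> 0 \<and> z = Fract p q \<and> k = w p - w q)"

locale prevaluation =
  fixes w :: "'a::idom \<Rightarrow> int"
  assumes w_mult: "p \<noteq> 0 \<Longrightarrow> q \<noteq> 0 \<Longrightarrow> w (p * q) = w p + w q"
    and w_add: "p \<noteq> 0 \<Longrightarrow> q \<noteq> 0 \<Longrightarrow> p + q \<noteq> 0 \<Longrightarrow> min (w p) (w q) \<le> w (p + q)"
begin

lemma fract_val_Fract:
  assumes "p \<noteq> 0" "q \<noteq> 0"
  shows "fract_val w (Fract p q) = w p - w q"
  unfolding fract_val_def
proof (rule some_equality)
  fix k assume "\<exists>p' q'. p' \<noteq> 0 \<and> q' \<noteq> 0 \<and> Fract p q = Fract p' q' \<and> k = w p' - w q'"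
  then obtain p' q' where *: "p' \<noteq> 0" "q' \<noteq> 0" "Fract p q = Fract p' q'" "k = w p' - w q'" by blast
  then have "p * q' = p' * q" using assms by (simp add: eq_fract)
  then have "w p + w q' = w p' + w q" using * assms w_mult by metis
  with * show "k = w p - w q" by simp
qed (use assms in blast)

lemma Fract_nonzeroE:
  assumes "z \<noteq> (0 :: 'a fract)"
  obtains p q where "z = Fract p q" "p \<noteq> 0" "q \<noteq> 0"
  using assms by (metis Fract_cases_nonzero)

sublocale valuation "fract_val w"
proof
  fix x y :: "'a fract" assume "x \<noteq> 0" "y \<noteq> 0"
  then obtain p q r s where x: "x = Fract p q" "p \<noteq> 0" "q \<noteq> 0" and y: "y = Fract r s" "r \<noteq> 0" "s \<noteq> 0"
    by (metis Fract_nonzeroE)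
  show "fract_val w (x * y) = fract_val w x + fract_val w y"
    using x y by (simp add: fract_val_Fract w_mult)
  assume "x + y \<noteq> 0"
  then have nz: "p * s + r * q \<noteq> 0" using x y by (auto simp: Zero_fract_def eq_fract)
  then have "min (w (p * s)) (w (r * q)) \<le> w (p * s + r * q)"
    using x y by (intro w_add) auto
  then show "min (fract_val w x) (fract_val w y) \<le> fract_val w (x + y)"
    using x y nz by (simp add: fract_val_Fract w_mult)
qed

end

definition ord_at :: "'a::field \<Rightarrow> 'a poly fract \<Rightarrow> int" where
  "ord_at a = fract_val (\<lambda>p. int (Polynomial.order a p))"

definition ord_inf :: "'a::field poly fract \<Rightarrow> int" where
  "ord_inf = fract_val (\<lambda>p. - int (degree p))"

interpretation order: prevaluation "\<lambda>p. int (Polynomial.order (a::'a::field) p)" for a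
proof
  fix p q :: "'a poly" assume nz: "p \<noteq> 0" "q \<noteq> 0"
  then show "int (Polynomial.order a (p * q)) = int (Polynomial.order a p) + int (Polynomial.order a q)"
    by (simp add: order_mult)
  assume s: "p + q \<noteq> 0"
  let ?m = "min (Polynomial.order a p) (Polynomial.order a q)"
  have "[:- a, 1:] ^ ?m dvd p" "[:- a, 1:] ^ ?m dvd q"
    by (simp_all add: order_divides)
  then have "[:- a, 1:] ^ ?m dvd p + q" by (rule dvd_add)
  then have "?m \<le> Polynomial.order a (p + q)" using s by (simp add: order_divides)
  then show "min (int (Polynomial.order a p)) (int (Polynomial.order a q)) \<le>
      int (Polynomial.order a (p + q))"
    by simp
qed

interpretation degree: prevaluation "\<lambda>p. - int (degree (p::'a::field poly))"
proof
  fix p q :: "'a poly" assume nz: "p \<noteq> 0" "q \<noteq> 0"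
  then show "- int (degree (p * q)) = - int (degree p) + - int (degree q)"
    by (simp add: degree_mult_eq)
  show "min (- int (degree p)) (- int (degree q)) \<le> - int (degree (p + q))"
    using degree_add_le_max[of p q] by linarith
qed

lemma valuation_ord_at: "valuation (ord_at a)"
  unfolding ord_at_def by (rule order.valuation_axioms)

lemma valuation_ord_inf: "valuation ord_inf"
  unfolding ord_inf_def by (rule degree.valuation_axioms)

lemma ord_at_Fract: "p \<noteq> 0 \<Longrightarrow> q \<noteq> 0 \<Longrightarrow>
    ord_at a (Fract p q) = int (Polynomial.order a p) - int (Polynomial.order a q)"
  unfolding ord_at_def by (rule order.fract_val_Fract)

lemma ord_inf_Fract: "p \<noteq> 0 \<Longrightarrow> q \<noteq> 0 \<Longrightarrow>
    ord_inf (Fract p q) = int (degree q) - int (degree p)"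
  unfolding ord_inf_def by (subst degree.fract_val_Fract) auto

lemma ord_at_to_fract: "p \<noteq> 0 \<Longrightarrow> ord_at a (to_fract p) = int (Polynomial.order a p)"
  unfolding to_fract_def by (subst ord_at_Fract) auto

lemma ord_inf_to_fract: "p \<noteq> 0 \<Longrightarrow> ord_inf (to_fract p) = - int (degree p)"
  unfolding to_fract_def by (subst ord_inf_Fract) auto

lemma x_elt_nonzero [simp]: "x_elt \<noteq> 0"
  by (simp add: x_elt_def)

lemma to_fract_power: "to_fract (p ^ n) = to_fract p ^ n"
  by (induction n) simp_all

lemma x_elt_power: "x_elt ^ n = to_fract (monom 1 n)"
  by (simp add: x_elt_def monom_altdef to_fract_power)

lemma to_fract_div_x_elt: "to_fract p / x_elt ^ n = Fract p (monom 1 n)"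
  by (simp add: x_elt_power Fract_conv_to_fract)

lemma ord_inf_x_elt: "p \<noteq> 0 \<Longrightarrow> ord_inf (to_fract p / x_elt ^ n) = int n - int (degree p)"
  by (simp add: to_fract_div_x_elt ord_inf_Fract degree_monom_eq)

lemma order_monom_nonzero:
  fixes a :: "'a::field"
  shows "a \<noteq> 0 \<Longrightarrow> Polynomial.order a (monom 1 n) = 0"
  by (rule order_0I) (auto simp: poly_monom)

lemma ord_at_x_elt: "p \<noteq> 0 \<Longrightarrow> a \<noteq> 0 \<Longrightarrow> 0 \<le> ord_at a (to_fract p / x_elt ^ n)"
  by (simp add: to_fract_div_x_elt ord_at_Fract order_monom_nonzero)

text \<open>In a representation with denominator of least degree, a root of the denominator in
  \<open>T\<close> would also be a root of the numerator, since z has no pole there; cancelling the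
  linear factor contradicts minimality.\<close>

lemma integral_denominator:
  fixes z :: "'a::field poly fract"
  assumes "z \<noteq> 0" "\<And>a. a \<in> T \<Longrightarrow> 0 \<le> ord_at a z"
  obtains p q where "z = Fract p q" "p \<noteq> 0" "q \<noteq> 0" "\<And>a. a \<in> T \<Longrightarrow> poly q a \<noteq> 0"
proof -
  define Q where "Q d \<longleftrightarrow> (\<exists>p q. z = Fract p q \<and> p \<noteq> 0 \<and> q \<noteq> 0 \<and> degree q = d)" for d
  have "\<exists>d. Q d" using assms(1) unfolding Q_def by (metis Fract_cases_nonzero)
  then have QL: "Q (LEAST d. Q d)" and least: "\<And>d. Q d \<Longrightarrow> (LEAST d. Q d) \<le> d"
    by (auto intro: LeastI Least_le)
  from QL obtain p q where pq: "z = Fract p q" "p \<noteq> 0" "q \<noteq> 0" "degree q = (LEAST d. Q d)"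
    unfolding Q_def by blast
  have "poly q a \<noteq> 0" if "a \<in> T" for a
  proof
    assume q0: "poly q a = 0"
    then have "Polynomial.order a q > 0" using pq by (simp add: order_gt_0_iff)
    moreover have "int (Polynomial.order a p) - int (Polynomial.order a q) \<ge> 0"
      using assms(2)[OF that] pq by (simp add: ord_at_Fract)
    ultimately have "poly p a = 0" using order_root[of p a] by auto
    then obtain p' q' where p': "p = [:- a, 1:] * p'" and q': "q = [:- a, 1:] * q'"
      using q0 by (auto simp: poly_eq_0_iff_dvd dvd_def)
    have nz: "p' \<noteq> 0" "q' \<noteq> 0" using pq p' q' by auto
    have "z = Fract p' q'"
      using pq(1) unfolding p' q' by (subst (asm) mult_fract_cancel) auto
    then have "Q (degree q')" using nz unfolding Q_def by blast
    moreover have "degree q = Suc (degree q')"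
      unfolding q' using nz by (subst degree_mult_eq) auto
    ultimately show False using least[of "degree q'"] pq(4) by simp
  qed
  then show ?thesis using that pq by blast
qed

lemma ring_x_eq: "ring_x = {z. \<forall>a::'a::alg_closed_field. z = 0 \<or> 0 \<le> ord_at a z}"
proof (rule equalityI; rule subsetI)
  fix z :: "'a poly fract" assume "z \<in> ring_x"
  then obtain p where "z = to_fract p" unfolding ring_x_def by blast
  then show "z \<in> {z. \<forall>a. z = 0 \<or> 0 \<le> ord_at a z}"
    by (cases "p = 0") (auto simp: ord_at_to_fract)
next
  fix z :: "'a poly fract" assume *: "z \<in> {z. \<forall>a. z = 0 \<or> 0 \<le> ord_at a z}"
  show "z \<in> ring_x"
  proof (cases "z = 0")
    case True
    then show ?thesis unfolding ring_x_def by (metis rangeI to_fract_0)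
  next
    case False
    then obtain p q where pq: "z = Fract p q" "q \<noteq> 0" "\<And>a. poly q a \<noteq> 0"
      using * by (auto elim!: integral_denominator[of z UNIV])
    then have "degree q = 0" using alg_closed_imp_poly_has_root[of q] by auto
    then obtain c where c: "q = [:c:]" "c \<noteq> 0" using pq(2) by (metis degree_eq_zeroE pCons_0_0)
    then have "z = to_fract (smult (1 / c) p)"
      unfolding pq(1) to_fract_def by (simp add: eq_fract)
    then show ?thesis unfolding ring_x_def by blast
  qed
qed

text \<open>The ideal x^-m K[x^-1]: functions without poles outside x = 0 that vanish at infinity to
  order at least m.\<close>

definition ring_inv :: "nat \<Rightarrow> 'a::field poly fract set" where
  "ring_inv m = insert 0 {to_fract p / x_elt ^ n | p n. degree p + m \<le> n}"

lemma ring_x_inv_x_eq: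
  "ring_x_inv_x = {z. \<forall>a::'a::alg_closed_field. a \<noteq> 0 \<longrightarrow> z = 0 \<or> 0 \<le> ord_at a z}"
proof (rule equalityI; rule subsetI)
  fix z :: "'a poly fract" assume "z \<in> ring_x_inv_x"
  then obtain p n where "z = to_fract p / x_elt ^ n" unfolding ring_x_inv_x_def by blast
  then show "z \<in> {z. \<forall>a. a \<noteq> 0 \<longrightarrow> z = 0 \<or> 0 \<le> ord_at a z}"
    by (cases "p = 0") (auto simp: ord_at_x_elt)
next
  fix z :: "'a poly fract" assume *: "z \<in> {z. \<forall>a. a \<noteq> 0 \<longrightarrow> z = 0 \<or> 0 \<le> ord_at a z}"
  show "z \<in> ring_x_inv_x"
  proof (cases "z = 0")
    case True
    then have "z = to_fract 0 / x_elt ^ 0" by simp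
    then show ?thesis unfolding ring_x_inv_x_def by blast
  next
    case False
    then obtain p q where pq: "z = Fract p q" "q \<noteq> 0" "\<And>a. a \<noteq> 0 \<Longrightarrow> poly q a \<noteq> 0"
      using * by (auto elim!: integral_denominator[of z "- {0}"])
    obtain r where r: "q = [:- 0, 1:] ^ Polynomial.order 0 q * r" "\<not> [:- 0, 1:] dvd r"
      using order_decomp[OF pq(2), of 0] by blast
    have "poly r a \<noteq> 0" for a
    proof (cases "a = 0")
      case True
      then show ?thesis using r(2) by (simp add: poly_eq_0_iff_dvd)
    next
      case False
      from pq(3)[OF this] have "poly ([:- 0, 1:] ^ Polynomial.order 0 q * r) a \<noteq> 0"
        using r(1) by simp
      then show ?thesis by auto
    qed
    then have "degree r = 0" using alg_closed_imp_poly_has_root[of r] by auto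
    moreover have "r \<noteq> 0" using r(2) by auto
    ultimately obtain c where c: "r = [:c:]" "c \<noteq> 0" by (metis degree_eq_zeroE pCons_0_0)
    have q: "q = monom c (Polynomial.order 0 q)"
      by (subst r(1)) (simp add: c monom_altdef)
    have "z = to_fract (smult (1 / c) p) / x_elt ^ Polynomial.order 0 q"
      unfolding pq(1) to_fract_div_x_elt using c pq(2)
      by (subst q) (simp add: eq_fract smult_monom flip: mult_smult_right)
    then show ?thesis unfolding ring_x_inv_x_def by blast
  qed
qed

lemma ring_inv_eq:
  "ring_inv m = {z \<in> ring_x_inv_x. z = (0 :: 'a::alg_closed_field poly fract) \<or> int m \<le> ord_inf z}"
proof (rule equalityI; rule subsetI)
  fix z :: "'a poly fract" assume "z \<in> ring_inv m"
  then show "z \<in> {z \<in> ring_x_inv_x. z = 0 \<or> int m \<le> ord_inf z}"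
  proof (cases "z = 0")
    case True
    then show ?thesis by (simp add: ring_x_inv_x_eq)
  next
    case False
    then obtain p n where "z = to_fract p / x_elt ^ n" "degree p + m \<le> n"
      using \<open>z \<in> ring_inv m\<close> unfolding ring_inv_def by blast
    then show ?thesis using False
      by (cases "p = 0") (auto simp: ord_inf_x_elt ring_x_inv_x_def)
  qed
next
  fix z :: "'a poly fract" assume *: "z \<in> {z \<in> ring_x_inv_x. z = 0 \<or> int m \<le> ord_inf z}"
  then obtain p n where z: "z = to_fract p / x_elt ^ n" unfolding ring_x_inv_x_def by blast
  show "z \<in> ring_inv m"
  proof (cases "z = 0")
    case False
    then have "p \<noteq> 0" "int m \<le> ord_inf z" using z * by auto
    then have "degree p + m \<le> n" using z by (simp add: ord_inf_x_elt)
    then show ?thesis using z unfolding ring_inv_def by blast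
  qed (simp add: ring_inv_def)
qed

lemma ring_inv_x_eq: "ring_inv_x = (ring_inv 0 :: 'a::field poly fract set)"
proof -
  have "(0 :: 'a poly fract) = to_fract 0 / x_elt ^ 0" by simp
  then have "0 \<in> (ring_inv_x :: 'a poly fract set)"
    unfolding ring_inv_x_def by (metis (mono_tags, lifting) CollectI degree_0 le0)
  then show ?thesis unfolding ring_inv_def ring_inv_x_def by auto
qed

lemma cubic_valuation_places:
  fixes f :: "'a::field poly"
  assumes "f \<noteq> 0" "\<omega>\<^sup>2 + \<omega> + 1 = 0" "(3::'a) \<noteq> 0"
  shows "cubic_valuation (ord_at a) (to_fract f) (to_fract [:\<omega>:])"
    and "cubic_valuation ord_inf (to_fract f) (to_fract [:\<omega>:])"
proof -
  have 3: "(3 :: 'a poly fract) = to_fract [:3:]"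
    by (metis numeral_poly of_nat_fract of_nat_numeral to_fract_def)
  have "to_fract [:\<omega>:] ^ 2 + to_fract [:\<omega>:] + 1 = to_fract [:\<omega>\<^sup>2 + \<omega> + 1:]"
    by (simp add: power2_eq_square one_pCons flip: to_fract_1 to_fract_add to_fract_mult)
  also have "\<dots> = 0" using assms(2) by simp
  finally have \<omega>: "to_fract [:\<omega>:] ^ 2 + to_fract [:\<omega>:] + 1 = 0" .
  have nz: "[:3::'a:] \<noteq> 0" using assms(3) by simp
  have "(3 :: 'a poly fract) \<noteq> 0" unfolding 3 using nz by (subst to_fract_eq_0_iff)
  moreover have "ord_at a 3 = 0" "ord_inf (3 :: 'a poly fract) = 0"
    unfolding 3 using nz assms(3) by (simp_all add: ord_at_to_fract ord_inf_to_fract order_0I)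
  ultimately show "cubic_valuation (ord_at a) (to_fract f) (to_fract [:\<omega>:])"
    "cubic_valuation ord_inf (to_fract f) (to_fract [:\<omega>:])"
    using assms(1) \<omega>
    by (auto simp: cubic_valuation_def cubic_valuation_axioms_def valuation_ord_at valuation_ord_inf)
qed


section \<open>The genus of a cyclic triple cover\<close>

definition double_root_poly :: "'a::field poly \<Rightarrow> 'a poly" where
  "double_root_poly f = (\<Prod>a\<in>{a. Polynomial.order a f = 2}. [:- a, 1:])"

text \<open>The coefficient of $y^i$ in a function that is regular over $x \neq \infty$ has denominator
  \<open>denom f i\<close>; after multiplication with it, the coefficient of a function that is regular at
  infinity vanishes there to order \<open>inf_order f i\<close>.\<close>

definition denom :: "'a::field poly \<Rightarrow> nat \<Rightarrow> 'a poly fract" where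
  "denom f i = (if i = 2 then to_fract (double_root_poly f) else 1)"

definition inf_order :: "'a::field poly \<Rightarrow> nat \<Rightarrow> nat" where
  "inf_order f i = (if i = 2 then (2 * degree f + 2) div 3 - degree (double_root_poly f)
     else (i * degree f + 2) div 3)"

lemma order_linear_factor:
  fixes a b :: "'a::field"
  shows "Polynomial.order a [:- b, 1:] = (if a = b then 1 else 0)"
proof (cases "a = b")
  case True
  then show ?thesis using order_power_n_n[of b 1] by simp
next
  case False
  then show ?thesis by (auto intro!: order_0I simp: algebra_simps)
qed

lemma order_prod:
  fixes g :: "'b \<Rightarrow> 'a::field poly"
  assumes "finite S" "\<And>x. x \<in> S \<Longrightarrow> g x \<noteq> 0"
  shows "Polynomial.order a (\<Prod>x\<in>S. g x) = (\<Sum>x\<in>S. Polynomial.order a (g x))"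
  using assms by (induction S rule: finite_induct) (auto simp: order_mult order_0I)

lemma double_root_poly:
  fixes f :: "'a::field poly"
  assumes "f \<noteq> 0"
  shows "finite {a. Polynomial.order a f = 2}"
    and "double_root_poly f \<noteq> 0"
    and "degree (double_root_poly f) = card {a. Polynomial.order a f = 2}"
    and "Polynomial.order a (double_root_poly f) = (if Polynomial.order a f = 2 then 1 else 0)"
proof -
  have "{a. Polynomial.order a f = 2} \<subseteq> {a. poly f a = 0}" by (auto simp: order_root)
  then show fin: "finite {a. Polynomial.order a f = 2}"
    using poly_roots_finite[OF assms] finite_subset by blast
  then show "double_root_poly f \<noteq> 0" by (auto simp: double_root_poly_def)
  show "degree (double_root_poly f) = card {a. Polynomial.order a f = 2}"
    unfolding double_root_poly_def by (subst degree_prod_sum_eq) auto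
  show "Polynomial.order a (double_root_poly f) = (if Polynomial.order a f = 2 then 1 else 0)"
    unfolding double_root_poly_def using fin
    by (subst order_prod) (auto simp: order_linear_factor)
qed

lemma proots_prod_linear: "proots (\<Prod>x\<in>#A. [:- x, 1:]) = A"
  for A :: "'a::idom multiset"
proof (induction A)
  case (add x A)
  have "(\<Prod>x\<in>#A. [:- x, 1:]) \<noteq> 0" by (auto simp: prod_mset_zero_iff)
  then show ?case using add by (simp add: proots_mult del: mult_pCons_left)
qed simp

lemma alg_closed_factorization_proots:
  fixes p :: "'a::alg_closed_field poly"
  assumes "p \<noteq> 0"
  shows "size (proots p) = degree p" "p = smult (lead_coeff p) (\<Prod>x\<in>#proots p. [:- x, 1:])"
proof -
  obtain A where A: "size A = degree p" "p = smult (lead_coeff p) (\<Prod>x\<in>#A. [:- x, 1:])"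
    using alg_closed_imp_factorization[OF assms] by blast
  have "proots p = A" using assms by (subst A(2)) (simp add: proots_prod_linear)
  then show "size (proots p) = degree p" "p = smult (lead_coeff p) (\<Prod>x\<in>#proots p. [:- x, 1:])"
    using A by simp_all
qed

lemma less_3_cases: "i < 3 \<Longrightarrow> (i = 0 \<Longrightarrow> P) \<Longrightarrow> (i = 1 \<Longrightarrow> P) \<Longrightarrow> (i = 2 \<Longrightarrow> P) \<Longrightarrow> P" for i :: nat
  by linarith

locale triple_cover =
  fixes f :: "'a::alg_closed_field poly" and \<omega> :: 'a
  assumes f: "f \<noteq> 0" and cube_free: "\<And>a. Polynomial.order a f \<le> 2"
    and \<omega>: "\<omega>\<^sup>2 + \<omega> + 1 = 0" and three: "(3::'a) \<noteq> 0"
begin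

abbreviation "c \<equiv> to_fract f"

lemma roots_eq:
  "{a. poly f a = 0} = {a. Polynomial.order a f = 1} \<union> {a. Polynomial.order a f = 2}"
proof safe
  fix a assume "poly f a = 0" "Polynomial.order a f \<noteq> 2"
  then show "Polynomial.order a f = 1" using cube_free[of a] f order_gt_0_iff[of f a] by linarith
qed (auto simp: order_root)

lemma finite_order_eq:
  assumes "k > 0"
  shows "finite {a. Polynomial.order a f = k}"
proof (rule finite_subset)
  show "{a. Polynomial.order a f = k} \<subseteq> {a. poly f a = 0}"
    using assms by (auto simp: order_root)
qed (rule poly_roots_finite[OF f])

lemma degree_f:
  "degree f = card {a. Polynomial.order a f = 1} + 2 * card {a. Polynomial.order a f = 2}"
proof -
  have "degree f = (\<Sum>a\<in>{a. poly f a = 0}. Polynomial.order a f)"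
    using alg_closed_factorization_proots(1)[OF f] f by (simp add: size_multiset_overloaded_eq)
  also have "\<dots> = (\<Sum>a | Polynomial.order a f = 1. 1) + (\<Sum>a | Polynomial.order a f = 2. 2)"
    unfolding roots_eq
  proof (subst sum.union_disjoint)
  qed (use finite_order_eq in \<open>auto intro!: arg_cong2[where f = "(+)"] sum.cong\<close>)
  finally show ?thesis by simp
qed

lemma denom_nonzero [simp]: "denom f i \<noteq> 0"
  using double_root_poly(2)[OF f] by (auto simp: denom_def)

text \<open>At a root of multiplicity e the condition is 3 \<open>ord_at a z\<close> \<ge> - i e.
  For i, e \<le> 2 an integer satisfying it is nonnegative, except that i = e = 2 admits -1: hence
  the simple denominators at double roots for i = 2 only.\<close>

lemma weight_ge_ord_at:
  assumes "i < 3"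
  shows "weight_ge (ord_at a) c i 0 z \<longleftrightarrow> z * denom f i = 0 \<or> 0 \<le> ord_at a (z * denom f i)"
proof (cases "z = 0")
  case False
  interpret valuation "ord_at a" by (rule valuation_ord_at)
  have e: "Polynomial.order a f = 0 \<or> Polynomial.order a f = 1 \<or> Polynomial.order a f = 2"
    using cube_free[of a] by linarith
  show ?thesis
    using assms False
    by (elim less_3_cases; use e double_root_poly(2,4)[OF f] f in
        \<open>auto simp: weight_ge_def denom_def mult ord_at_to_fract split: if_splits\<close>)
qed (simp add: weight_ge_def)

text \<open>The condition is 3 \<open>ord_inf z\<close> \<ge> i deg f, and (i deg f + 2) div 3
  rounds up. For i = 2 the denominator shifts the order by its degree; the inequality below ensures
  that the subtraction in \<open>inf_order\<close> is not truncated.\<close>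

lemma weight_ge_ord_inf:
  assumes "i < 3"
  shows "weight_ge ord_inf c i 0 z \<longleftrightarrow>
    z * denom f i = 0 \<or> int (inf_order f i) \<le> ord_inf (z * denom f i)"
proof (cases "z = 0")
  case False
  interpret valuation ord_inf by (rule valuation_ord_inf)
  have "degree (double_root_poly f) \<le> (2 * degree f + 2) div 3"
    using degree_f double_root_poly(3)[OF f] by linarith
  then show ?thesis
    using assms False
    by (elim less_3_cases; use double_root_poly(2)[OF f] f in
        \<open>auto simp: weight_ge_def denom_def inf_order_def mult ord_inf_to_fract\<close>)
qed (simp add: weight_ge_def)

lemma gauss_ge_iff:
  assumes "degree z < 3"
  shows "gauss_ge v c 0 z \<longleftrightarrow> (\<forall>i<3. weight_ge v c i 0 (coeff z i))"
  using assms unfolding gauss_ge_def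
  by (metis coeff_eq_0 not_less order_less_le_trans weight_ge_def)

definition module :: "(nat \<Rightarrow> 'a poly fract set) \<Rightarrow> 'a poly fract poly set" where
  "module R = {z. degree z < 3 \<and> (\<forall>i<3. coeff z i * denom f i \<in> R i)}"

lemma integral_closure_x: "integral_closure f ring_x = module (\<lambda>_. ring_x)"
proof -
  have "integral_closure f ring_x =
      {z. degree z < 3 \<and> (\<forall>v\<in>range ord_at. gauss_ge v c 0 z)}"
    by (rule integral_closure_eq[of _ _ "to_fract [:\<omega>:]"])
      (use cubic_valuation_places[OF f \<omega> three] in \<open>auto simp: ring_x_eq\<close>)
  also have "\<dots> = module (\<lambda>_. ring_x)"
    unfolding module_def ring_x_eq
    by (intro Collect_cong conj_cong refl) (simp add: gauss_ge_iff weight_ge_ord_at; blast)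
  finally show ?thesis .
qed

lemma integral_closure_x_inv_x:
  "integral_closure f ring_x_inv_x = module (\<lambda>_. ring_x_inv_x)"
proof -
  have "integral_closure f ring_x_inv_x =
      {z. degree z < 3 \<and> (\<forall>v\<in>ord_at ` (- {0}). gauss_ge v c 0 z)}"
    by (rule integral_closure_eq[of _ _ "to_fract [:\<omega>:]"])
      (use cubic_valuation_places[OF f \<omega> three] in \<open>auto simp: ring_x_inv_x_eq\<close>)
  also have "\<dots> = module (\<lambda>_. ring_x_inv_x)"
    unfolding module_def ring_x_inv_x_eq
    by (intro Collect_cong conj_cong refl) (simp add: gauss_ge_iff weight_ge_ord_at; blast)
  finally show ?thesis .
qed

lemma integral_closure_inv_x:
  "integral_closure f ring_inv_x = module (\<lambda>i. ring_inv (inf_order f i))"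
proof -
  have "integral_closure f ring_inv_x =
      {z. degree z < 3 \<and> (\<forall>v\<in>insert ord_inf (ord_at ` (- {0})). gauss_ge v c 0 z)}"
    by (rule integral_closure_eq[of _ _ "to_fract [:\<omega>:]"])
      (use cubic_valuation_places[OF f \<omega> three] in
        \<open>auto simp: ring_inv_x_eq ring_inv_eq ring_x_inv_x_eq\<close>)
  also have "\<dots> = module (\<lambda>i. ring_inv (inf_order f i))"
    unfolding module_def ring_inv_eq ring_x_inv_x_eq
    by (intro Collect_cong conj_cong refl)
      (simp add: gauss_ge_iff weight_ge_ord_at weight_ge_ord_inf; blast)
  finally show ?thesis .
qed

end

section \<open>Dimension of the Cech quotient\<close>

interpretation scalar_mult: vector_space "scalar_mult :: 'a::field \<Rightarrow> _"
proof
  fix a b :: 'a and x y :: "'a poly fract poly"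
  show "scalar_mult a (x + y) = scalar_mult a x + scalar_mult a y"
    by (simp add: scalar_mult_def smult_add_right)
  have "[:a + b:] = [:a:] + [:b:]" by simp
  then show "scalar_mult (a + b) x = scalar_mult a x + scalar_mult b x"
    unfolding scalar_mult_def by (simp only: to_fract_add smult_add_left)
  have "[:a:] * [:b:] = [:a * b:]" by simp
  then show "scalar_mult a (scalar_mult b x) = scalar_mult (a * b) x"
    unfolding scalar_mult_def smult_smult by (simp only: flip: to_fract_mult)
  show "scalar_mult 1 x = x"
    by (simp add: scalar_mult_def flip: one_pCons)
qed

text \<open>Exchange argument: replacing the vectors of one basis by representatives in the span of
  the other turns independence modulo \<open>W\<close> into independence. Applied both ways it makes
  the number in \<open>genus\<close> unique.\<close>

lemma quotient_dim_le:
  assumes W: "scalar_mult.subspace (W :: 'a::field poly fract poly set)"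
    and n: "quotient_dim V W n" and m: "quotient_dim V W m"
  shows "m \<le> n"
proof -
  obtain B where B: "finite B" "card B = n"
    "\<forall>x\<in>V. \<exists>c. x - (\<Sum>b\<in>B. scalar_mult (c b) b) \<in> W"
    using n unfolding quotient_dim_def by blast
  obtain B' where B': "finite B'" "card B' = m" "B' \<subseteq> V"
    "\<forall>c. (\<Sum>b\<in>B'. scalar_mult (c b) b) \<in> W \<longrightarrow> (\<forall>b\<in>B'. c b = 0)"
    using m unfolding quotient_dim_def by blast
  have "\<forall>x\<in>B'. \<exists>y\<in>scalar_mult.span B. x - y \<in> W"
  proof
    fix x assume "x \<in> B'"
    then obtain c where "x - (\<Sum>b\<in>B. scalar_mult (c b) b) \<in> W" using B'(3) B(3) by blast
    moreover have "(\<Sum>b\<in>B. scalar_mult (c b) b) \<in> scalar_mult.span B"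
      by (intro scalar_mult.span_sum scalar_mult.span_scale scalar_mult.span_base)
    ultimately show "\<exists>y\<in>scalar_mult.span B. x - y \<in> W" by blast
  qed
  then have "\<exists>\<Phi>. \<forall>x\<in>B'. \<Phi> x \<in> scalar_mult.span B \<and> x - \<Phi> x \<in> W"
    by (intro bchoice) blast
  then obtain \<Phi> where \<Phi>: "\<And>x. x \<in> B' \<Longrightarrow> \<Phi> x \<in> scalar_mult.span B \<and> x - \<Phi> x \<in> W"
    by blast
  have lift: "\<forall>b\<in>B'. c b = 0" if "(\<Sum>b\<in>B'. scalar_mult (c b) (\<Phi> b)) \<in> W" for c
  proof -
    have "(\<Sum>b\<in>B'. scalar_mult (c b) b) =
      (\<Sum>b\<in>B'. scalar_mult (c b) (\<Phi> b)) + (\<Sum>b\<in>B'. scalar_mult (c b) (b - \<Phi> b))"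
      by (simp add: scalar_mult.scale_right_diff_distrib sum_subtractf)
    also have "\<dots> \<in> W"
      using \<Phi> by (intro scalar_mult.subspace_add[OF W] that scalar_mult.subspace_sum[OF W]
          scalar_mult.subspace_scale[OF W]) auto
    finally show ?thesis using B'(4) by blast
  qed
  have inj: "inj_on \<Phi> B'"
  proof (rule inj_onI, rule ccontr)
    fix x y assume xy: "x \<in> B'" "y \<in> B'" "\<Phi> x = \<Phi> y" "x \<noteq> y"
    \<comment> \<open>Two vectors with the same representative would differ by an element of
      \<open>W\<close>, a nontrivial relation.\<close>
    define c :: "_ \<Rightarrow> 'a" where "c = (\<lambda>_. 0)(x := 1, y := - 1)"
    have "(\<Sum>b\<in>B'. scalar_mult (c b) (\<Phi> b)) = (\<Sum>b\<in>{x, y}. scalar_mult (c b) (\<Phi> b))"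
      using xy B'(1) by (intro sum.mono_neutral_right) (auto simp: c_def)
    also have "\<dots> = 0" using xy by (simp add: c_def)
    finally have "(\<Sum>b\<in>B'. scalar_mult (c b) (\<Phi> b)) \<in> W"
      using scalar_mult.subspace_0[OF W] by simp
    then have "\<forall>b\<in>B'. c b = 0" by (rule lift)
    then show False using xy by (auto simp: c_def)
  qed
  have "scalar_mult.independent (\<Phi> ` B')"
  proof (rule scalar_mult.independent_if_scalars_zero)
    fix c x assume *: "(\<Sum>x\<in>\<Phi> ` B'. scalar_mult (c x) x) = 0" "x \<in> \<Phi> ` B'"
    then have "(\<Sum>b\<in>B'. scalar_mult (c (\<Phi> b)) (\<Phi> b)) = 0"
      by (simp add: sum.reindex[OF inj])
    then have "(\<Sum>b\<in>B'. scalar_mult (c (\<Phi> b)) (\<Phi> b)) \<in> W"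
      using scalar_mult.subspace_0[OF W] by simp
    then have "\<forall>b\<in>B'. c (\<Phi> b) = 0" by (rule lift)
    then show "c x = 0" using *(2) by auto
  qed (use B'(1) in auto)
  moreover have "\<Phi> ` B' \<subseteq> scalar_mult.span B" using \<Phi> by auto
  ultimately have "card (\<Phi> ` B') \<le> card B"
    using scalar_mult.independent_span_bound B(1) by blast
  then show ?thesis using B(2) B'(2) inj by (simp add: card_image)
qed

lemma ring_invI: "degree p + m \<le> n \<Longrightarrow> to_fract p / x_elt ^ n \<in> ring_inv m"
  unfolding ring_inv_def by blast

text \<open>The x^-j with 0 < j < m form a basis of K[x, x^-1] modulo K[x] + x^-m K[x^-1], which is
  H^1 of the line bundle O(-m) on the projective line. This is independence;
  \<open>laurent_span\<close> is the other half.\<close>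

lemma laurent_independent:
  fixes c :: "nat \<Rightarrow> 'a::field"
  assumes "(\<Sum>j\<in>{0<..<m}. to_fract [:c j:] / x_elt ^ j) = P + Q" "P \<in> ring_x" "Q \<in> ring_inv m"
    and "j \<in> {0<..<m}"
  shows "c j = 0"
proof -
  obtain p where p: "P = to_fract p" using assms(2) unfolding ring_x_def by blast
  obtain q n where q: "Q = to_fract q / x_elt ^ n" "degree q + m \<le> n"
  proof (cases "Q = 0")
    case True
    then show ?thesis using that[of 0 m] by simp
  next
    case False
    then show ?thesis using assms(3) that unfolding ring_inv_def by blast
  qed
  have "x_elt ^ (n + m) * (to_fract [:c j:] / x_elt ^ j) = to_fract (monom (c j) (n + m - j))"
    if "j \<in> {0<..<m}" for j
  proof -
    have "n + m = (n + m - j) + j" using that by simp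
    then have "x_elt ^ (n + m) = x_elt ^ (n + m - j) * (x_elt ^ j :: 'a poly fract)"
      by (metis power_add)
    then have "x_elt ^ (n + m) * (to_fract [:c j:] / x_elt ^ j) =
        x_elt ^ (n + m - j) * to_fract [:c j:]" by simp
    also have "\<dots> = to_fract (monom 1 (n + m - j) * [:c j:])"
      by (simp only: x_elt_power to_fract_mult)
    finally show ?thesis by (simp add: smult_monom)
  qed
  then have "x_elt ^ (n + m) * (P + Q) = to_fract (\<Sum>j\<in>{0<..<m}. monom (c j) (n + m - j))"
    unfolding assms(1)[symmetric] by (simp add: sum_distrib_left)
  moreover have "x_elt ^ (n + m) * (P + Q) = to_fract (monom 1 (n + m) * p + monom 1 m * q)"
    by (simp add: p q(1) distrib_left power_add x_elt_power[symmetric] del: x_elt_power)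
  ultimately have "(\<Sum>j\<in>{0<..<m}. monom (c j) (n + m - j)) = monom 1 (n + m) * p + monom 1 m * q"
    by (metis to_fract_eq_iff)
  \<comment> \<open>Neither summand on the right reaches degree n + m - j: the first starts in
    degree n + m, and the second has degree at most m + deg q \<le> n.\<close>
  then have "coeff (\<Sum>j\<in>{0<..<m}. monom (c j) (n + m - j)) (n + m - j) =
      coeff (monom 1 (n + m) * p + monom 1 m * q) (n + m - j)" by simp
  moreover have "coeff (\<Sum>j\<in>{0<..<m}. monom (c j) (n + m - j)) (n + m - j) = c j"
  proof -
    have "coeff (\<Sum>j\<in>{0<..<m}. monom (c j) (n + m - j)) (n + m - j) =
        (\<Sum>i\<in>{0<..<m}. if i = j then c i else 0)"
      unfolding coeff_sum by (intro sum.cong) (use assms(4) in auto)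
    then show ?thesis using assms(4) by simp
  qed
  moreover have "coeff (monom 1 (n + m) * p + monom 1 m * q) (n + m - j) = 0"
    using assms(4) q(2) by (auto simp: coeff_monom_mult coeff_eq_0)
  ultimately show ?thesis by simp
qed

lemma laurent_span:
  fixes z :: "'a::field poly fract"
  assumes "z \<in> ring_x_inv_x"
  obtains c P Q where "P \<in> ring_x" "Q \<in> ring_inv m"
    "z - (\<Sum>j\<in>{0<..<m}. to_fract [:c j:] / x_elt ^ j) = P + Q"
proof -
  obtain p n where z: "z = to_fract p / x_elt ^ n"
    using assms unfolding ring_x_inv_x_def by blast
  define N where "N = n + m + degree p"
  define t where "t k = to_fract (monom (coeff p k) k) / x_elt ^ n" for k
  have t_high: "t k = to_fract (monom (coeff p k) (k - n))" if "n \<le> k" for k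
  proof -
    have "monom (coeff p k) k = monom (coeff p k) (k - n) * monom 1 n"
      using that by (simp add: mult_monom)
    then show ?thesis by (simp add: t_def x_elt_power)
  qed
  have t_low: "t k = to_fract [:coeff p k:] / x_elt ^ (n - k)" if "k \<le> n" for k
  proof -
    have "monom (coeff p k) k = monom 1 k * [:coeff p k:]" by (simp add: smult_monom)
    then have 1: "to_fract (monom (coeff p k) k) = x_elt ^ k * to_fract [:coeff p k:]"
      by (simp only: x_elt_power flip: to_fract_mult)
    have 2: "x_elt ^ n = x_elt ^ k * (x_elt ^ (n - k) :: 'a poly fract)"
      using that by (metis le_add_diff_inverse power_add)
    show ?thesis unfolding t_def 1 by (subst 2) simp
  qed
  \<comment> \<open>Sorted by the exponent k - n of x: nonnegative exponents form the polynomial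
    part, those at most -m the part at infinity, those strictly between the representative.\<close>
  define A B C where "A = {n..N}" "B = {k. k < n \<and> n < k + m}" "C = {k. k < n \<and> k + m \<le> n}"
  note sets = A_B_C_def
  have "(\<Sum>k\<le>N. monom (coeff p k) k) = p"
    by (rule poly_as_sum_of_monoms') (simp add: N_def)
  from arg_cong[OF this, of to_fract] have "z = (\<Sum>k\<le>N. t k)"
    unfolding z t_def by (simp flip: sum_divide_distrib)
  also have "{..N} = A \<union> (B \<union> C)" by (auto simp: sets N_def)

  also have "sum t \<dots> = sum t A + sum t (B \<union> C)"
    by (rule sum.union_disjoint) (auto simp: sets)
  also have "sum t (B \<union> C) = sum t B + sum t C"
    by (rule sum.union_disjoint) (auto simp: sets)
  finally have z_sum: "z = sum t A + (sum t B + sum t C)" .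
  define c where "c j = (if j \<le> n then coeff p (n - j) else 0)" for j
  have "sum t B = (\<Sum>j\<in>{0<..<m}. to_fract [:c j:] / x_elt ^ j)"
  proof -
    have "sum t B = (\<Sum>j\<in>{j\<in>{0<..<m}. j \<le> n}. to_fract [:c j:] / x_elt ^ j)"
      by (rule sum.reindex_bij_witness[of _ "\<lambda>j. n - j" "\<lambda>k. n - k"])
        (auto simp: sets c_def t_low)
    also have "\<dots> = (\<Sum>j\<in>{0<..<m}. to_fract [:c j:] / x_elt ^ j)"
      by (rule sum.mono_neutral_left) (auto simp: c_def)
    finally show ?thesis .
  qed
  moreover have "sum t A \<in> ring_x"
  proof -
    have "sum t A = to_fract (\<Sum>k\<in>A. monom (coeff p k) (k - n))"
      by (simp add: sets t_high)
    then show ?thesis unfolding ring_x_def by blast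
  qed
  moreover have "sum t C \<in> ring_inv m"
  proof (cases "m \<le> n")
    case True
    let ?q = "\<Sum>k\<in>C. monom (coeff p k) k"
    have "sum t C = to_fract ?q / x_elt ^ n"
      by (simp add: t_def sum_divide_distrib)
    moreover have "degree ?q \<le> n - m"
      by (intro degree_sum_le) (auto simp: sets intro!: degree_monom_le[THEN order_trans])
    ultimately show ?thesis using True by (simp only:) (intro ring_invI; linarith)
  next
    case False
    then have "C = {}" by (auto simp: sets)
    then show ?thesis by (simp add: ring_inv_def)
  qed
  ultimately show ?thesis
    using that[of "sum t A" "sum t C" c] z_sum by (simp add: algebra_simps)
qed

lemma subspace_ring_x:
  "x \<in> ring_x \<Longrightarrow> y \<in> ring_x \<Longrightarrow> x + y \<in> ring_x" "0 \<in> ring_x"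
  "x \<in> ring_x \<Longrightarrow> to_fract [:a:] * x \<in> ring_x"
proof -
  show "x + y \<in> ring_x" if "x \<in> ring_x" "y \<in> ring_x"
    using that unfolding ring_x_def by (auto simp flip: to_fract_add)
  show "0 \<in> ring_x"
    unfolding ring_x_def by (rule range_eqI[of _ _ 0]) simp
  show "to_fract [:a:] * x \<in> ring_x" if "x \<in> ring_x"
    using that unfolding ring_x_def by (auto simp flip: to_fract_mult)
qed

lemma subspace_ring_inv:
  "x \<in> ring_inv m \<Longrightarrow> y \<in> ring_inv m \<Longrightarrow> x + y \<in> ring_inv m" "0 \<in> ring_inv m"
  "x \<in> ring_inv m \<Longrightarrow> to_fract [:a:] * x \<in> ring_inv m"
proof -
  show "0 \<in> ring_inv m" by (simp add: ring_inv_def)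
  show "to_fract [:a:] * x \<in> ring_inv m" if x: "x \<in> ring_inv m"
  proof (cases "x = 0")
    case False
    then obtain p n where "x = to_fract p / x_elt ^ n" "degree p + m \<le> n"
      using x unfolding ring_inv_def by blast
    moreover have "to_fract [:a:] * to_fract p = to_fract (smult a p)"
      by (simp flip: to_fract_mult)
    ultimately have "to_fract [:a:] * x = to_fract (smult a p) / x_elt ^ n \<and> degree (smult a p) + m \<le> n"
      using degree_smult_le[of a p] by (simp add: times_divide_eq_right)
    then show ?thesis unfolding ring_inv_def by blast
  qed (simp add: ring_inv_def)
  show "x + y \<in> ring_inv m" if x: "x \<in> ring_inv m" and y: "y \<in> ring_inv m"
  proof (cases "x = 0 \<or> y = 0")
    case False
    obtain p n where p: "x = to_fract p / x_elt ^ n" "degree p + m \<le> n"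
      using x False unfolding ring_inv_def by blast
    obtain q k where q: "y = to_fract q / x_elt ^ k" "degree q + m \<le> k"
      using y False unfolding ring_inv_def by blast
    let ?r = "p * monom 1 k + q * monom 1 n"
    have "x + y = to_fract ?r / x_elt ^ (n + k)"
      by (simp add: p(1) q(1) add_frac_eq power_add flip: x_elt_power)
    moreover have "degree (p * monom 1 k) \<le> degree p + k" "degree (q * monom 1 n) \<le> degree q + n"
      by (meson degree_mult_le degree_monom_le add_left_mono order_trans)+
    then have "degree ?r \<le> n + k - m" using p(2) q(2) by (intro degree_add_le) linarith+
    then have "degree ?r + m \<le> n + k" using p(2) by linarith
    ultimately show ?thesis unfolding ring_inv_def by blast
  qed (use x y in auto)
qed

context triple_cover
begin

lemma subspace_module:
  assumes "\<And>i x y. x \<in> R i \<Longrightarrow> y \<in> R i \<Longrightarrow> x + y \<in> R i" "\<And>i. 0 \<in> R i"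
    "\<And>i x a. x \<in> R i \<Longrightarrow> to_fract [:a:] * x \<in> R i"
  shows "scalar_mult.subspace (module R)"
  unfolding scalar_mult.subspace_def module_def
  using assms degree_smult_le[of "to_fract [:a:]" x for a x]
  by (auto simp: distrib_right scalar_mult_def mult.assoc intro: degree_add_less le_less_trans)

text \<open>All three rings of functions split along 1, y, y^2 with the same denominators, so the
  quotient is the direct sum of the H^1 of O(-m) for m = \<open>inf_order f i\<close>, i <
  3.\<close>

lemma quotient_dim_iff:
  "quotient_dim (integral_closure f ring_x_inv_x)
    {u + v |u v. u \<in> integral_closure f ring_x \<and> v \<in> integral_closure f ring_inv_x} n \<longleftrightarrow>
   n = (inf_order f 1 - 1) + (inf_order f 2 - 1)"
proof -
  let ?V = "module (\<lambda>_. ring_x_inv_x)"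
  let ?U = "module (\<lambda>_. ring_x)"
  let ?U' = "module (\<lambda>i. ring_inv (inf_order f i))"
  let ?W = "{u + v |u v. u \<in> ?U \<and> v \<in> ?U'}"
  have W: "scalar_mult.subspace ?W"
    by (intro scalar_mult.subspace_sums subspace_module subspace_ring_x subspace_ring_inv)
  define J where "J = (SIGMA i:{..<3}. {0<..<inf_order f i})"
  define \<beta> where "\<beta> = (\<lambda>(i, j). monom (1 / (x_elt ^ j * denom f i)) i)"
  \<comment> \<open>The summand of 1 contributes nothing: 0 - 1 truncates to 0, the size of the
    empty interval.\<close>
  have inf0: "inf_order f 0 = 0" by (simp add: inf_order_def)
  have "card J = (\<Sum>i<3. inf_order f i - 1)" by (simp add: J_def)
  also have "\<dots> = (inf_order f 1 - 1) + (inf_order f 2 - 1)"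
    by (simp add: inf0 numeral_3_eq_3 numeral_2_eq_2)
  finally have card: "card J = (inf_order f 1 - 1) + (inf_order f 2 - 1)" .
  have finJ: "finite J" by (simp add: J_def)
  have inj: "inj \<beta>"
  proof (rule injI, clarify)
    fix i j i' j' assume "\<beta> (i, j) = \<beta> (i', j')"
    then have eq: "monom (1 / (x_elt ^ j * denom f i)) i = monom (1 / (x_elt ^ j' * denom f i')) i'"
      by (simp add: \<beta>_def)
    then have "degree (monom (1 / (x_elt ^ j * denom f i)) i) =
        degree (monom (1 / (x_elt ^ j' * denom f i')) i')" by simp
    then have i: "i = i'" by (simp add: degree_monom_eq)
    with eq have "x_elt ^ j = (x_elt ^ j' :: 'a poly fract)" by simp
    then have "monom (1::'a) j = monom 1 j'" by (simp add: x_elt_power)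
    then show "i = i' \<and> j = j'" using i by (simp add: monom_eq_iff')
  qed
  have coeff_sum_\<beta>: "coeff (\<Sum>b\<in>\<beta> ` J. scalar_mult (c b) b) i * denom f i =
      (\<Sum>j\<in>{0<..<inf_order f i}. to_fract [:c (\<beta> (i, j)):] / x_elt ^ j)" if "i < 3" for c i
  proof -
    have "(\<Sum>b\<in>\<beta> ` J. scalar_mult (c b) b) = (\<Sum>a\<in>J. scalar_mult (c (\<beta> a)) (\<beta> a))"
      using inj by (subst sum.reindex) (auto intro: inj_on_subset)
    also have "\<dots> = (\<Sum>k<3. \<Sum>j\<in>{0<..<inf_order f k}. scalar_mult (c (\<beta> (k, j))) (\<beta> (k, j)))"
      unfolding J_def by (subst sum.Sigma) (auto simp: case_prod_unfold)
    finally have "coeff (\<Sum>b\<in>\<beta> ` J. scalar_mult (c b) b) i * denom f i =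
      (\<Sum>k<3. \<Sum>j\<in>{0<..<inf_order f k}.
        coeff (scalar_mult (c (\<beta> (k, j))) (\<beta> (k, j))) i * denom f i)"
      by (simp add: coeff_sum sum_distrib_right)
    also have "\<dots> = (\<Sum>k<3. if k = i then \<Sum>j\<in>{0<..<inf_order f i}.
        to_fract [:c (\<beta> (i, j)):] / x_elt ^ j else 0)"
      by (intro sum.cong) (auto simp: scalar_mult_def \<beta>_def)
    finally show ?thesis using that by simp
  qed
  have deg_sum: "degree (\<Sum>b\<in>\<beta> ` J. scalar_mult (c b) b) < 3" for c
    by (intro degree_sum_less)
      (auto simp: \<beta>_def J_def scalar_mult_def smult_monom intro: le_less_trans[OF degree_monom_le])
  have "quotient_dim ?V ?W (card J)"
    unfolding quotient_dim_def
  proof (intro exI[of _ "\<beta> ` J"] conjI allI impI ballI)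
    show "finite (\<beta> ` J)" using finJ by simp
    show "card (\<beta> ` J) = card J"
      using inj by (intro card_image) (auto intro: inj_on_subset)
    show "\<beta> ` J \<subseteq> ?V"
    proof clarify
      fix i j assume "(i, j) \<in> J"
      have "1 / x_elt ^ j = (to_fract 1 / x_elt ^ j :: 'a poly fract)" by simp
      then have "1 / x_elt ^ j \<in> (ring_x_inv_x :: 'a poly fract set)"
        unfolding ring_x_inv_x_def by blast
      moreover have "(0 :: 'a poly fract) \<in> ring_x_inv_x"
        by (simp add: ring_x_inv_x_eq)
      ultimately show "\<beta> (i, j) \<in> ?V"
        using \<open>(i, j) \<in> J\<close> by (auto simp: module_def \<beta>_def J_def intro: le_less_trans[OF degree_monom_le])
    qed
  next
    fix c b assume sum: "(\<Sum>b\<in>\<beta> ` J. scalar_mult (c b) b) \<in> ?W" and "b \<in> \<beta> ` J"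
    then obtain i j where b: "b = \<beta> (i, j)" and ij: "i < 3" "j \<in> {0<..<inf_order f i}"
      by (auto simp: J_def)
    obtain u v where uv: "(\<Sum>b\<in>\<beta> ` J. scalar_mult (c b) b) = u + v" "u \<in> ?U" "v \<in> ?U'"
      using sum by blast
    have "(\<Sum>j\<in>{0<..<inf_order f i}. to_fract [:c (\<beta> (i, j)):] / x_elt ^ j) =
        coeff u i * denom f i + coeff v i * denom f i"
      unfolding coeff_sum_\<beta>[OF ij(1), symmetric] uv(1) by (simp add: distrib_right)
    moreover have "coeff u i * denom f i \<in> ring_x" "coeff v i * denom f i \<in> ring_inv (inf_order f i)"
      using uv ij(1) by (auto simp: module_def)
    ultimately show "c b = 0"
      unfolding b by (rule laurent_independent[OF _ _ _ ij(2)])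
  next
    fix z assume z: "z \<in> ?V"
    define S where "S i c P Q \<longleftrightarrow> P \<in> ring_x \<and> Q \<in> ring_inv (inf_order f i) \<and>
        coeff z i * denom f i - (\<Sum>j\<in>{0<..<inf_order f i}. to_fract [:c j:] / x_elt ^ j) = P + Q"
      for i c P Q
    have "\<exists>c P Q. S i c P Q" if "i < 3" for i
    proof -
      have "coeff z i * denom f i \<in> ring_x_inv_x" using z that by (simp add: module_def)
      then show ?thesis unfolding S_def by (elim laurent_span) blast
    qed
    then obtain c P Q where "\<And>i. i < 3 \<Longrightarrow> S i (c i) (P i) (Q i)"
      by metis
    then have cPQ: "\<And>i. i < 3 \<Longrightarrow> P i \<in> ring_x \<and> Q i \<in> ring_inv (inf_order f i) \<and>
        coeff z i * denom f i - (\<Sum>j\<in>{0<..<inf_order f i}. to_fract [:c i j:] / x_elt ^ j) = P i + Q i"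
      unfolding S_def .
    define lift where "lift R = (\<Sum>i<3. monom (R i / denom f i) i)" for R
    have coeff_lift: "coeff (lift R) i = (if i < 3 then R i / denom f i else 0)" for R i
      by (simp add: lift_def coeff_sum)
    have deg_lift: "degree (lift R) < 3" for R
      by (rule degree_lessI) (auto simp: coeff_lift)
    let ?c = "case_prod c \<circ> inv_into UNIV \<beta>"
    have "z - (\<Sum>b\<in>\<beta> ` J. scalar_mult (?c b) b) = lift P + lift Q"
    proof (rule poly_eqI)
      fix i
      show "coeff (z - (\<Sum>b\<in>\<beta> ` J. scalar_mult (?c b) b)) i = coeff (lift P + lift Q) i"
      proof (cases "i < 3")
        case True
        have "(coeff z i - coeff (\<Sum>b\<in>\<beta> ` J. scalar_mult (?c b) b) i) * denom f i = P i + Q i"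
          using cPQ[OF True] inj unfolding left_diff_distrib coeff_sum_\<beta>[OF True]
          by (simp add: inv_f_f)
        then show ?thesis using True
          by (simp add: coeff_lift field_simps)
      next
        case False
        then have "coeff z i = 0" using z by (intro coeff_eq_0) (auto simp: module_def)
        moreover have "coeff (\<Sum>b\<in>\<beta> ` J. scalar_mult (?c b) b) i = 0"
          using False deg_sum[of ?c] by (intro coeff_eq_0) linarith
        ultimately show ?thesis using False by (simp add: coeff_lift)
      qed
    qed
    moreover have "lift P \<in> ?U" "lift Q \<in> ?U'"
      using cPQ deg_lift by (auto simp: module_def coeff_lift)
    ultimately show "\<exists>c. z - (\<Sum>b\<in>\<beta> ` J. scalar_mult (c b) b) \<in> ?W" by blast
  qed
  then have "quotient_dim ?V ?W n \<longleftrightarrow> n = card J"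
    using quotient_dim_le[OF W] by (intro iffI order_antisym) auto
  then show ?thesis
    unfolding integral_closure_x integral_closure_x_inv_x integral_closure_inv_x card .
qed

text \<open>This is Riemann-Hurwitz, 2g - 2 = -6 + 2r for r points of ramification index 3, obtained
  here from the rounding in \<open>inf_order\<close>. Positive degree keeps the truncated
  subtractions exact.\<close>

lemma genus_eq:
  assumes "degree f > 0"
  shows "genus f + 2 = card {a. poly f a = 0} + (if 3 dvd degree f then 0 else 1)"
proof -
  define s where "s = card {a. Polynomial.order a f = 1}"
  define b where "b = card {a. Polynomial.order a f = 2}"
  have n: "degree f = s + 2 * b" using degree_f by (simp add: s_def b_def)
  have roots: "card {a. poly f a = 0} = s + b"
    unfolding s_def b_def roots_eq using finite_order_eq[of 1] finite_order_eq[of 2]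
    by (subst card_Un_disjoint) auto
  have "genus f = (inf_order f 1 - 1) + (inf_order f 2 - 1)"
    unfolding genus_def quotient_dim_iff by simp
  also have "\<dots> = ((s + 2 * b + 2) div 3 - 1) + ((2 * (s + 2 * b) + 2) div 3 - b - 1)"
    using double_root_poly(3)[OF f] by (simp add: inf_order_def n b_def)
  finally have genus: "genus f = ((s + 2 * b + 2) div 3 - 1) + ((2 * (s + 2 * b) + 2) div 3 - b - 1)" .
  show ?thesis
  proof -
    define k where "k = (s + 2 * b) div 3"
    have "0 < s + 2 * b" using assms n by simp
    consider "s + 2 * b = 3 * k" | "s + 2 * b = 3 * k + 1" | "s + 2 * b = 3 * k + 2"
      unfolding k_def by linarith
    then show ?thesis
    proof cases
      case 1
      moreover have "(3 * k + 2) div 3 = k" "(2 * (3 * k) + 2) div 3 = 2 * k" by simp_all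
      ultimately show ?thesis
        using genus \<open>0 < s + 2 * b\<close> unfolding roots n by simp
    next
      case 2
      moreover have "(3 * k + 1 + 2) div 3 = k + 1" "(2 * (3 * k + 1) + 2) div 3 = 2 * k + 1"
        by simp_all
      moreover have "\<not> 3 dvd 3 * k + 1" by presburger
      ultimately show ?thesis
        using genus unfolding roots n by (simp del: One_nat_def Suc_eq_plus1)
    next
      case 3
      moreover have "(3 * k + 2 + 2) div 3 = k + 1" "(2 * (3 * k + 2) + 2) div 3 = 2 * k + 2"
        by simp_all
      moreover have "\<not> 3 dvd 3 * k + 2" by presburger
      ultimately show ?thesis
        using genus unfolding roots n by (simp del: One_nat_def Suc_eq_plus1)
    qed
  qed
qed

end

section \<open>Frobenius on the algebraic closure of a finite field\<close>

definition frob :: "nat \<Rightarrow> 'k::finite_field alg_closure \<Rightarrow> 'k alg_closure" where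
  "frob n a = a ^ (CARD('k) ^ n)"

text \<open>The field with q^n elements for n > 0. As \<open>frob 0\<close> is the identity,
  \<open>fixed_field 0\<close> is everything, hence the conditions n > 0 below.\<close>

definition fixed_field :: "nat \<Rightarrow> 'k::finite_field alg_closure set" where
  "fixed_field n = {a. frob n a = a}"

lemma card_gt_1: "CARD('k::finite_field) > 1"
proof -
  have "card {0, 1 :: 'k} \<le> CARD('k)" by (rule card_mono) auto
  then show ?thesis by simp
qed

text \<open>Translation by 1 permutes the field, so adding 1 to each element leaves the sum of all
  elements unchanged.\<close>

lemma of_nat_card_eq_0: "of_nat CARD('k) = (0 :: 'k::finite_field)"
proof -
  have "(\<Sum>x\<in>UNIV. x) = (\<Sum>x\<in>UNIV. x + 1 :: 'k)"
    by (rule sum.reindex_bij_witness[of _ "\<lambda>x. x + 1" "\<lambda>x. x - 1"]) auto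
  then show ?thesis by (simp add: sum.distrib)
qed

lemma to_ac_power_card: "to_ac b ^ CARD('k) = to_ac (b :: 'k::finite_field)"
  by (metis finite_field_power_card_eq_same to_ac_power)

text \<open>As polynomials in y the two sides differ by one of degree less than q, which vanishes at
  the q elements of \<open>S\<close>.\<close>

lemma poly_power_linear_eq:
  fixes x :: "'b::idom"
  assumes "finite S" "card S = q" "q > 0" "\<And>b. b \<in> S \<Longrightarrow> (b + x) ^ q = b ^ q + x ^ q"
  shows "(y + x) ^ q = y ^ q + x ^ q"
proof -
  define P where "P = [:x, 1:] ^ q - monom 1 q - [:x ^ q:]"
  have poly_P: "poly P b = (b + x) ^ q - b ^ q - x ^ q" for b
    by (simp add: P_def poly_monom add.commute)
  have "P = 0"
  proof (rule ccontr)
    assume "P \<noteq> 0"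
    have deg: "degree ([:x, 1:] ^ q) = q" by (simp add: degree_power_eq)
    have lead: "coeff ([:x, 1:] ^ q) q = 1"
      using lead_coeff_power[of "[:x, 1:]" q] by (simp add: deg)
    have "degree P < q"
    proof (rule degree_lessI)
      show "\<forall>k\<ge>q. coeff P k = 0"
      proof safe
        fix k assume "q \<le> k"
        then show "coeff P k = 0"
          using assms(3) lead deg
          by (cases "k = q") (auto simp: P_def coeff_eq_0 coeff_pCons split: nat.split)
      qed
    qed (use assms(3) in simp)
    moreover have "card S \<le> card {b. poly P b = 0}"
      using assms(4) poly_roots_finite[OF \<open>P \<noteq> 0\<close>] by (intro card_mono) (auto simp: poly_P)
    moreover have "card {b. poly P b = 0} \<le> degree P"
      using \<open>P \<noteq> 0\<close> by (rule card_poly_roots_bound)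
    ultimately show False using assms(2) by simp
  qed
  then have "(y + x) ^ q - y ^ q - x ^ q = 0" using poly_P[of y] by simp
  then show ?thesis by (simp add: algebra_simps)
qed

lemma power_card_add:
  fixes x y :: "'k::finite_field alg_closure"
  shows "(x + y) ^ CARD('k) = x ^ CARD('k) + y ^ CARD('k)"
proof -
  have S: "finite (range to_ac :: 'k alg_closure set)" "card (range to_ac :: 'k alg_closure set) = CARD('k)"
    by (auto intro: card_image inj_to_ac)
  \<comment> \<open>Two rounds: additivity with both arguments in k gives it with one in k, and that
    gives the general case.\<close>
  have 1: "(x + to_ac b) ^ CARD('k) = x ^ CARD('k) + to_ac b ^ CARD('k)" for x and b :: 'k
  proof (rule poly_power_linear_eq[OF S])
    show "(a + to_ac b) ^ CARD('k) = a ^ CARD('k) + to_ac b ^ CARD('k)" if "a \<in> range to_ac" for a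
      using that by (auto simp: to_ac_power_card simp flip: to_ac_add)
  qed simp
  show ?thesis
    by (rule poly_power_linear_eq[OF S]) (use 1[of y] in \<open>auto simp: add.commute\<close>)
qed

lemma frob_0 [simp]: "frob 0 a = a"
  by (simp add: frob_def)

lemma frob_Suc: "frob (Suc n) a = frob n a ^ CARD('k)" for a :: "'k::finite_field alg_closure"
  by (simp add: frob_def mult.commute flip: power_mult)

lemma frob_frob: "frob m (frob n a) = frob (m + n) a"
  by (simp add: frob_def power_add mult.commute flip: power_mult)

lemma frob_mult: "frob n (a * b) = frob n a * frob n b"
  by (simp add: frob_def power_mult_distrib)

lemma frob_power: "frob n (a ^ m) = frob n a ^ m"
  by (simp add: frob_def mult.commute flip: power_mult)

lemma frob_zero [simp]: "frob n 0 = 0"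
  by (simp add: frob_def)

lemma frob_one [simp]: "frob n 1 = 1"
  by (simp add: frob_def)

lemma frob_eq_0_iff [simp]: "frob n a = 0 \<longleftrightarrow> a = 0"
  by (simp add: frob_def)

lemma frob_add: "frob n (a + b) = frob n a + frob n b"
  by (induction n) (simp_all add: frob_Suc power_card_add)

lemma frob_uminus: "frob n (- a) = - frob n a"
  using frob_add[of n a "- a"] by (simp add: add_eq_0_iff)

lemma frob_diff: "frob n (a - b) = frob n a - frob n b"
  using frob_add[of n a "- b"] by (simp add: frob_uminus)

lemma frob_sum: "frob n (\<Sum>x\<in>A. g x) = (\<Sum>x\<in>A. frob n (g x))"
  by (induction A rule: infinite_finite_induct) (simp_all add: frob_add)

lemma frob_prod: "frob n (\<Prod>x\<in>A. g x) = (\<Prod>x\<in>A. frob n (g x))"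
  by (simp add: frob_def prod_power_distrib)

lemma frob_inj: "frob n a = frob n b \<longleftrightarrow> a = b"
  using frob_eq_0_iff[of n "a - b"] by (simp add: frob_diff)

lemma frob_to_ac [simp]: "frob n (to_ac b) = to_ac b"
  by (induction n) (simp_all add: frob_Suc to_ac_power_card)

lemma card_roots_separable:
  fixes p :: "'a::alg_closed_field poly"
  assumes "p \<noteq> 0" "\<And>a. poly (pderiv p) a \<noteq> 0"
  shows "card {a. poly p a = 0} = degree p"
proof -
  have 1: "Polynomial.order a p = 1" if "poly p a = 0" for a
  proof -
    have "\<not> [:- a, 1:] ^ 2 dvd p"
    proof
      assume "[:- a, 1:] ^ 2 dvd p"
      then obtain r where "p = [:- a, 1:] * ([:- a, 1:] * r)"
        unfolding dvd_def power2_eq_square by (metis mult.assoc)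
      then have "poly (pderiv p) a = 0"
        by (simp add: pderiv_mult del: mult_pCons_left)
      then show False using assms(2) by blast
    qed
    moreover have "Polynomial.order a p \<noteq> 0" using that assms(1) by (simp add: order_root)
    ultimately show ?thesis using assms(1) by (simp add: order_divides)
  qed
  have "degree p = (\<Sum>a | poly p a = 0. Polynomial.order a p)"
    using alg_closed_factorization_proots(1)[OF assms(1)] assms(1)
    by (simp add: size_multiset_overloaded_eq)
  also have "\<dots> = card {a. poly p a = 0}" by (simp add: 1)
  finally show ?thesis by simp
qed

lemma card_fixed_field:
  assumes "n > 0"
  shows "card (fixed_field n :: 'k::finite_field alg_closure set) = CARD('k) ^ n"
proof -
  let ?Q = "CARD('k) ^ n"
  define p :: "'k alg_closure poly" where "p = monom 1 ?Q - monom 1 1"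
  have Q: "?Q > 1" using card_gt_1[where 'k = 'k] assms by (intro one_less_power)
  have "of_nat ?Q = (0 :: 'k alg_closure)"
    using assms of_nat_card_eq_0[where 'k = 'k] by (metis of_nat_power power_eq_0_iff to_ac_0 to_ac_of_nat)
  then have der: "pderiv p = [:- 1:]"
    using assms by (simp add: p_def pderiv_diff pderiv_monom monom_0 zero_power)
  have deg: "degree p = ?Q"
  proof (rule antisym)
    show "degree p \<le> ?Q" using Q by (intro degree_le) (auto simp: p_def)
    show "?Q \<le> degree p" using Q by (intro le_degree) (auto simp: p_def)
  qed
  have "p \<noteq> 0" using deg Q by auto
  then have "card {a. poly p a = 0} = ?Q" using card_roots_separable[of p] der deg by simp
  moreover have "fixed_field n = {a. poly p a = 0}"
    by (auto simp: fixed_field_def frob_def p_def poly_monom)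
  ultimately show ?thesis by simp
qed

lemma finite_fixed_field: "n > 0 \<Longrightarrow> finite (fixed_field n :: 'k::finite_field alg_closure set)"
  using card_fixed_field[of n, where 'k = 'k] card_gt_1[where 'k = 'k] by (metis card.infinite gr0I not_less0 zero_less_power zero_less_one order.strict_trans)

lemma fixed_field_1: "fixed_field 1 = range (to_ac :: 'k::finite_field \<Rightarrow> _)"
proof -
  have "range (to_ac :: 'k \<Rightarrow> _) \<subseteq> fixed_field 1" by (auto simp: fixed_field_def)
  moreover have "card (range (to_ac :: 'k \<Rightarrow> _)) = CARD('k)" by (auto intro: card_image inj_to_ac)
  moreover have "card (fixed_field 1 :: 'k alg_closure set) = CARD('k)"
    using card_fixed_field[of 1, where 'k = 'k] by simp
  ultimately have "range (to_ac :: 'k \<Rightarrow> _) = fixed_field 1"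
    by (intro card_subset_eq finite_fixed_field) auto
  then show ?thesis by simp
qed

section \<open>Descent of polynomials\<close>

lemma geom_add: "geom (p + q) = geom p + geom q"
  by (rule poly_eqI) (simp add: coeff_map_poly)

lemma geom_diff: "geom (p - q) = geom p - geom q"
  by (rule poly_eqI) (simp add: coeff_map_poly)

lemma geom_mult: "geom (p * q) = geom p * geom q"
  by (rule poly_eqI) (simp add: coeff_map_poly coeff_mult to_ac_sum)

lemma geom_1 [simp]: "geom 1 = 1"
  by (rule poly_eqI) (simp add: coeff_map_poly)

lemma geom_power: "geom (p ^ n) = geom p ^ n"
  by (induction n) (simp_all add: geom_mult)

lemma geom_smult: "geom (smult a p) = smult (to_ac a) (geom p)"
  by (rule poly_eqI) (simp add: coeff_map_poly)

lemma degree_geom [simp]: "degree (geom p) = degree p"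
  by (rule degree_map_poly) simp

lemma lead_coeff_geom: "lead_coeff (geom p) = to_ac (lead_coeff p)"
  by (simp add: coeff_map_poly)

lemma geom_eq_iff [simp]: "geom p = geom q \<longleftrightarrow> p = q"
  by (metis coeff_map_poly poly_eqI to_ac_0 to_ac_eq_iff)

lemma geom_eq_0_iff [simp]: "geom p = 0 \<longleftrightarrow> p = 0"
  using geom_eq_iff[of p 0] by simp

text \<open>Division with remainder commutes with extension of scalars, so a remainder that vanishes
  over the closure vanishes over k.\<close>

lemma geom_dvd_iff: "geom p dvd geom q \<longleftrightarrow> p dvd q" for p q :: "'k::field poly"
proof
  assume *: "geom p dvd geom q"
  have "q = p * (q div p) + q mod p" by simp
  then have q: "geom q = geom p * geom (q div p) + geom (q mod p)"
    by (metis geom_add geom_mult)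
  then have "geom p dvd geom (q mod p)" using * by (metis dvd_add_right_iff dvd_triv_left)
  then have "q mod p = 0"
    using degree_mod_less[of p q] dvd_imp_degree_le[of "geom p" "geom (q mod p)"] *
    by (cases "p = 0"; cases "q mod p = 0") auto
  then show "p dvd q" by blast
next
  assume "p dvd q" then show "geom p dvd geom q" by (auto simp: dvd_def geom_mult)
qed

lemma poly_geom_frob: "poly (geom p) (frob n a) = frob n (poly (geom p) a)"
  by (simp add: poly_altdef coeff_map_poly frob_sum frob_mult frob_power)

lemma map_poly_frob_mult: "map_poly (frob n) (p * q) = map_poly (frob n) p * map_poly (frob n) q"
  by (rule poly_eqI) (simp add: coeff_map_poly coeff_mult frob_sum frob_mult)

lemma map_poly_frob_1 [simp]: "map_poly (frob n) 1 = 1"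
  by (rule poly_eqI) (simp add: coeff_map_poly)

lemma map_poly_frob_power: "map_poly (frob n) (p ^ k) = map_poly (frob n) p ^ k"
  by (induction k) (simp_all add: map_poly_frob_mult)

lemma map_poly_frob_linear: "map_poly (frob n) [:- a, 1:] = [:- frob n a, 1:]"
  by (simp add: map_poly_pCons frob_uminus)

lemma map_poly_frob_geom: "map_poly (frob n) (geom p) = geom p"
  by (rule poly_eqI) (simp add: coeff_map_poly)

lemma poly_map_poly_frob: "poly (map_poly (frob n) p) (frob n a) = frob n (poly p a)"
proof -
  have "degree (map_poly (frob n) p) = degree p" by (rule degree_map_poly) simp
  then show ?thesis by (simp add: poly_altdef coeff_map_poly frob_sum frob_mult frob_power)
qed

text \<open>Frobenius on the coefficients fixes \<open>geom h\<close> and turns its factor (x - a)^e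
  into the same power of x - \<open>frob n a\<close>.\<close>

lemma order_geom_frob:
  assumes "h \<noteq> 0"
  shows "Polynomial.order (frob n a) (geom h) = Polynomial.order a (geom h)"
proof -
  obtain r where r: "geom h = [:- a, 1:] ^ Polynomial.order a (geom h) * r" "\<not> [:- a, 1:] dvd r"
    using order_decomp[of "geom h" a] assms by auto
  let ?r = "map_poly (frob n) r"
  have eq: "geom h = [:- frob n a, 1:] ^ Polynomial.order a (geom h) * ?r"
    by (metis map_poly_frob_geom map_poly_frob_linear map_poly_frob_mult map_poly_frob_power r(1))
  have "poly ?r (frob n a) \<noteq> 0"
    using r(2) by (simp add: poly_map_poly_frob flip: poly_eq_0_iff_dvd)
  then have "Polynomial.order (frob n a) ?r = 0" by (rule order_0I)
  moreover have "?r \<noteq> 0" using eq assms by (metis geom_eq_0_iff mult_zero_right)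
  ultimately show ?thesis
    by (subst eq) (simp add: order_mult order_power_n_n)
qed

lemma geom_of_ac:
  assumes "map_poly (frob 1) p = p"
  shows "geom (map_poly of_ac p) = p"
proof (rule poly_eqI)
  fix i
  have "frob 1 (coeff p i) = coeff p i"
    by (subst assms[symmetric]) (simp add: coeff_map_poly)
  then have "coeff p i \<in> range to_ac"
    using fixed_field_1 by (auto simp: fixed_field_def)
  then show "coeff (geom (map_poly of_ac p)) i = coeff p i"
    by (simp add: coeff_map_poly to_ac_of_ac)
qed

section \<open>Characteristic polynomials over the base field and the Euler product\<close>

definition conj_prod :: "nat \<Rightarrow> 'k::finite_field alg_closure \<Rightarrow> 'k alg_closure poly" where
  "conj_prod n a = (\<Prod>i<n. [:- frob i a, 1:])"

text \<open>For \<open>a\<close> in the field with $q^n$ elements: the characteristic polynomial of \<open>a\<close> over $k$.\<close>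

definition norm_poly :: "nat \<Rightarrow> 'k::finite_field alg_closure \<Rightarrow> 'k poly" where
  "norm_poly n a = map_poly of_ac (conj_prod n a)"

lemma map_poly_frob_prod: "map_poly (frob n) (\<Prod>x\<in>A. g x) = (\<Prod>x\<in>A. map_poly (frob n) (g x))"
  by (induction A rule: infinite_finite_induct) (simp_all add: map_poly_frob_mult)

lemma conj_prod_nonzero [simp]: "conj_prod n a \<noteq> 0"
  by (simp add: conj_prod_def)

lemma geom_norm_poly:
  assumes "a \<in> fixed_field n"
  shows "geom (norm_poly n a) = conj_prod n a"
  unfolding norm_poly_def
proof (rule geom_of_ac)
  have "map_poly (frob 1) (conj_prod n a) = (\<Prod>i<n. [:- frob (Suc i) a, 1:])"
    by (simp add: conj_prod_def map_poly_frob_prod map_poly_frob_linear frob_frob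
        del: map_poly_pCons)
  \<comment> \<open>Both sides are the product over 0 \<le> i \<le> n, because
    \<open>frob n a = a\<close> makes the factors for i = n and i = 0 equal.\<close>
  moreover have "[:- a, 1:] * (\<Prod>i<n. [:- frob (Suc i) a, 1:]) = [:- a, 1:] * conj_prod n a"
    using prod.lessThan_Suc_shift[of "\<lambda>i. [:- frob i a, 1:]" n] assms
    by (simp add: conj_prod_def fixed_field_def mult.commute del: mult_pCons_left mult_pCons_right)
  ultimately show "map_poly (frob 1) (conj_prod n a) = conj_prod n a"
    by (metis mult_left_cancel pCons_eq_0_iff one_neq_zero)
qed

lemma degree_conj_prod: "degree (conj_prod n a) = n"
  unfolding conj_prod_def by (subst degree_prod_sum_eq) auto

lemma lead_coeff_conj_prod: "lead_coeff (conj_prod n a) = 1"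
  unfolding conj_prod_def by (simp add: lead_coeff_prod)

definition monics :: "nat \<Rightarrow> 'k::field poly set" where
  "monics d = {h. degree h = d \<and> lead_coeff h = 1}"

lemma monics_nonzero: "h \<in> monics d \<Longrightarrow> h \<noteq> 0"
  by (auto simp: monics_def)

lemma norm_poly_in_monics:
  assumes "a \<in> fixed_field n"
  shows "norm_poly n a \<in> monics n"
  using geom_norm_poly[OF assms] degree_geom[of "norm_poly n a"] lead_coeff_geom[of "norm_poly n a"]
    degree_conj_prod[of n a] lead_coeff_conj_prod[of n a]
  by (simp add: monics_def)

lemma finite_degree_le: "finite {h :: 'k::{field, finite} poly. degree h \<le> d}"
proof (rule finite_subset)
  show "finite (Poly ` {xs :: 'k list. set xs \<subseteq> UNIV \<and> length xs \<le> Suc d})"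
    by (intro finite_imageI finite_lists_length_le) simp
  show "{h :: 'k poly. degree h \<le> d} \<subseteq> Poly ` {xs. set xs \<subseteq> UNIV \<and> length xs \<le> Suc d}"
  proof
    fix h :: "'k poly" assume "h \<in> {h. degree h \<le> d}"
    then have "h = Poly (coeffs h)" "length (coeffs h) \<le> Suc d"
      by (cases "h = 0"; simp add: length_coeffs)+
    then show "h \<in> Poly ` {xs. set xs \<subseteq> UNIV \<and> length xs \<le> Suc d}" by blast
  qed
qed

lemma finite_monics: "finite (monics d :: 'k::{field, finite} poly set)"
  by (rule finite_subset[OF _ finite_degree_le[of d]]) (auto simp: monics_def)

lemma monics_0: "monics 0 = {1 :: 'k::field poly}"
  by (auto simp: monics_def elim!: degree_eq_zeroE)

lemma monics_mult: "g \<in> monics m \<Longrightarrow> h \<in> monics n \<Longrightarrow> g * h \<in> monics (m + n)"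
  by (auto simp: monics_def degree_mult_eq lead_coeff_mult) (metis degree_mult_eq lead_coeff_mult mult_1 leading_coeff_0_iff one_neq_zero)

lemma monics_cofactor:
  assumes "g * h \<in> monics d" "g \<in> monics m"
  shows "h \<in> monics (d - m)"
proof -
  have nz: "g \<noteq> 0" "h \<noteq> 0" using monics_nonzero[OF assms(1)] by auto
  then have "degree (g * h) = degree g + degree h" by (simp add: degree_mult_eq)
  moreover have "lead_coeff (g * h) = lead_coeff g * lead_coeff h" by (rule lead_coeff_mult)
  ultimately show ?thesis using assms by (auto simp: monics_def)
qed

lemma dvd_if_order_le:
  fixes p q :: "'a::alg_closed_field poly"
  assumes "p \<noteq> 0" "q \<noteq> 0" "\<And>b. Polynomial.order b p \<le> Polynomial.order b q"
  shows "p dvd q"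
proof -
  have "proots p \<subseteq># proots q" using assms by (simp add: subseteq_mset_def)
  then obtain B where "proots q = proots p + B" by (auto simp: mset_subset_eq_exists_conv)
  then have "(\<Prod>x\<in>#proots p. [:- x, 1:]) dvd (\<Prod>x\<in>#proots q. [:- x, 1:])" by simp
  then show ?thesis
    using assms(1,2) alg_closed_factorization_proots(2)[of p] alg_closed_factorization_proots(2)[of q]
    by (metis dvd_smult leading_coeff_0_iff smult_dvd)
qed

definition period :: "'k::finite_field alg_closure \<Rightarrow> nat" where
  "period a = (LEAST n. n > 0 \<and> frob n a = a)"

lemma period:
  assumes "n > 0" "frob n a = a"
  shows "period a > 0" "frob (period a) a = a" "frob m a = a \<longleftrightarrow> period a dvd m"
proof -
  show p: "period a > 0" "frob (period a) a = a"
    using LeastI[of "\<lambda>n. n > 0 \<and> frob n a = a" n] assms unfolding period_def by blast+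
  have mult: "frob (period a * j) a = a" for j
    by (induction j) (simp_all add: p(2) flip: frob_frob)
  show "frob m a = a \<longleftrightarrow> period a dvd m"
  proof
    assume m: "frob m a = a"
    have "m = m mod period a + period a * (m div period a)" by simp
    then have "frob (m mod period a) a = a"
      using m mult by (metis frob_frob)
    moreover have "m mod period a < period a" using p(1) by simp
    ultimately have "m mod period a = 0"
      using not_less_Least[of "m mod period a" "\<lambda>n. n > 0 \<and> frob n a = a"]
      unfolding period_def by auto
    then show "period a dvd m" by auto
  qed (auto simp: dvd_def mult)
qed

lemma root_periodic:
  assumes "h \<noteq> 0" "poly (geom h) a = 0"
  obtains n where "n > 0" "frob n a = a"
proof -
  have "\<not> inj (\<lambda>n. frob n a)"
  proof
    assume "inj (\<lambda>n. frob n a)"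
    then have "infinite (range (\<lambda>n. frob n a))" by (rule range_inj_infinite)
    moreover have "range (\<lambda>n. frob n a) \<subseteq> {b. poly (geom h) b = 0}"
      using assms(2) by (auto simp: poly_geom_frob)
    ultimately show False using poly_roots_finite[of "geom h"] assms(1) finite_subset by auto
  qed
  then obtain i j where "frob i a = frob j a" "i < j"
    by (auto simp: inj_def) (metis linorder_neqE_nat)
  then have "frob i (frob (j - i) a) = frob i a" by (simp add: frob_frob)
  then show ?thesis using that[of "j - i"] \<open>i < j\<close> by (simp add: frob_inj)
qed

lemma order_conj_prod: "Polynomial.order b (conj_prod n a) = card {i. i < n \<and> frob i a = b}"
proof -
  have "Polynomial.order b (conj_prod n a) = (\<Sum>i<n. if b = frob i a then 1 else 0)"
    unfolding conj_prod_def by (subst order_prod) (auto simp: order_linear_factor)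
  also have "\<dots> = card ({..<n} \<inter> {i. b = frob i a})" by (simp add: sum.If_cases)
  also have "{..<n} \<inter> {i. b = frob i a} = {i. i < n \<and> frob i a = b}" by auto
  finally show ?thesis .
qed

lemma card_multiples: 
  fixes m :: nat
  assumes "m > 0"
  shows "card {i. i < m * j \<and> m dvd i} = j"
proof -
  have "{i. i < m * j \<and> m dvd i} = (*) m ` {..<j}" using assms by (auto simp: dvd_def)
  moreover have "inj_on ((*) m) {..<j}" using assms by (auto simp: inj_on_def)
  ultimately show ?thesis by (simp add: card_image)
qed

text \<open>\<open>norm_poly (period a * j) a\<close> is the j-th power of the minimal polynomial of
  a. Multiplicities of roots are constant on Frobenius orbits, so the one at a decides.\<close>

lemma norm_poly_dvd_iff:
  assumes "h \<noteq> 0" "a \<in> fixed_field (period a * j)" "period a > 0" "j > 0"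
  shows "norm_poly (period a * j) a dvd h \<longleftrightarrow> j \<le> Polynomial.order a (geom h)"
proof -
  let ?n = "period a * j"
  have n: "?n > 0" "frob ?n a = a" using assms by (auto simp: fixed_field_def)
  have "Polynomial.order a (conj_prod ?n a) = card {i. i < ?n \<and> period a dvd i}"
    unfolding order_conj_prod by (simp add: period(3)[OF n])
  then have order_a: "Polynomial.order a (conj_prod ?n a) = j"
    using card_multiples assms(3) by metis
  have "conj_prod ?n a dvd geom h \<longleftrightarrow> j \<le> Polynomial.order a (geom h)"
  proof
    assume "conj_prod ?n a dvd geom h"
    then show "j \<le> Polynomial.order a (geom h)"
      using dvd_imp_order_le[of "geom h" "conj_prod ?n a" a] assms(1) order_a by simp
  next
    assume le: "j \<le> Polynomial.order a (geom h)"
    show "conj_prod ?n a dvd geom h"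
    proof (rule dvd_if_order_le)
      fix b
      show "Polynomial.order b (conj_prod ?n a) \<le> Polynomial.order b (geom h)"
      proof (cases "\<exists>i. b = frob i a")
        case True
        then obtain i where b: "b = frob i a" by blast
        have "norm_poly ?n a \<noteq> 0"
          using norm_poly_in_monics[OF assms(2)] monics_nonzero by blast
        then have "Polynomial.order b (conj_prod ?n a) = j"
          using order_geom_frob[of "norm_poly ?n a" i a] order_a
          by (simp add: b geom_norm_poly[OF assms(2)])
        then show ?thesis using le order_geom_frob[OF assms(1)] b by simp
      next
        case False
        then have "{i. i < ?n \<and> frob i a = b} = {}" by auto
        then show ?thesis by (metis card.empty le0 order_conj_prod)
      qed
    qed (use assms(1) in auto)
  qed
  then show ?thesis
    using geom_dvd_iff[of "norm_poly ?n a" h] by (simp add: geom_norm_poly[OF assms(2)])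
qed

text \<open>A root a of multiplicity e contributes the values n = \<open>period a * j\<close> with 1
  \<le> j \<le> e, and multiplicities add up to d. This is the analogue of writing log h as the sum
  of the von Mangoldt function over the divisors of h, with prime powers represented by their
  roots.\<close>

lemma card_norm_poly_dvd:
  assumes h: "h \<in> monics d"
  shows "card (SIGMA n:{1..d}. {a \<in> fixed_field n. norm_poly n a dvd h}) = d"
proof -
  have nz: "h \<noteq> 0" using monics_nonzero[OF h] .
  let ?R = "{a. poly (geom h) a = 0}"
  let ?N = "\<lambda>a. {n\<in>{1..d}. a \<in> fixed_field n \<and> norm_poly n a dvd h}"
  have finR: "finite ?R" using nz by (intro poly_roots_finite) simp
  have root: "a \<in> ?R" if "n \<ge> 1" "a \<in> fixed_field n" "norm_poly n a dvd h" for n a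
  proof -
    have "conj_prod n a dvd geom h"
      using that geom_dvd_iff[of "norm_poly n a" h] by (simp add: geom_norm_poly)
    moreover have "poly (conj_prod n a) a = 0"
      using that(1) unfolding conj_prod_def poly_prod by (auto intro!: bexI[of _ 0])
    ultimately show ?thesis by (auto simp: dvd_def)
  qed
  have card_N: "card (?N a) = Polynomial.order a (geom h)" if a: "a \<in> ?R" for a
  proof -
    obtain n where n: "n > 0" "frob n a = a" using root_periodic[OF nz] a by blast
    let ?m = "period a"
    have "?N a = (*) ?m ` {1..Polynomial.order a (geom h)}"
    proof (rule equalityI; rule subsetI)
      fix k assume k: "k \<in> ?N a"
      then have "?m dvd k" using period(3)[OF n] by (auto simp: fixed_field_def)
      then obtain j where j: "k = ?m * j" by (auto simp: dvd_def)
      then have "j > 0" using k by (cases j) auto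
      then show "k \<in> (*) ?m ` {1..Polynomial.order a (geom h)}"
        using norm_poly_dvd_iff[OF nz, of a j] k period(1)[OF n] unfolding j by auto
    next
      fix k assume "k \<in> (*) ?m ` {1..Polynomial.order a (geom h)}"
      then obtain j where "k = ?m * j" "j \<in> {1..Polynomial.order a (geom h)}" by blast
      then have j: "k = ?m * j" "j > 0" "j \<le> Polynomial.order a (geom h)" by auto
      have fixed: "a \<in> fixed_field k" using period(3)[OF n] j(1) by (simp add: fixed_field_def)
      then have dvd: "norm_poly k a dvd h"
        using norm_poly_dvd_iff[OF nz, of a j] period(1)[OF n] j by simp
      then have "k \<le> d"
        using dvd_imp_degree_le[OF dvd nz] norm_poly_in_monics[OF fixed] h by (simp add: monics_def)
      moreover have "k \<ge> 1" using j(1,2) period(1)[OF n] by simp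
      ultimately show "k \<in> ?N a" using fixed dvd by simp
    qed
    moreover have "inj_on ((*) ?m) {1..Polynomial.order a (geom h)}"
      using period(1)[OF n] by (auto simp: inj_on_def)
    ultimately show ?thesis by (simp add: card_image)
  qed
  have "card (SIGMA n:{1..d}. {a \<in> fixed_field n. norm_poly n a dvd h}) = card (SIGMA a:?R. ?N a)"
    by (rule bij_betw_same_card[of prod.swap])
      (use root in \<open>auto intro!: bij_betw_byWitness[of _ prod.swap]\<close>)
  also have "\<dots> = (\<Sum>a\<in>?R. Polynomial.order a (geom h))"
    using finR card_N by (subst card_SigmaI) (auto intro!: sum.cong)
  also have "\<dots> = degree (geom h)"
    using alg_closed_factorization_proots(1)[of "geom h"] nz
    by (simp add: size_multiset_overloaded_eq)
  finally show ?thesis using h by (simp add: monics_def)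
qed

text \<open>The logarithmic derivative of the Euler product $\prod_P (1 - \varphi(P) T^{\deg P})^{-1}$,
  multiplied out.\<close>

lemma euler_log_derivative:
  fixes \<phi> :: "'k::finite_field poly \<Rightarrow> 'c::comm_ring_1"
  assumes \<phi>: "\<And>g h m n. g \<in> monics m \<Longrightarrow> h \<in> monics n \<Longrightarrow> \<phi> (g * h) = \<phi> g * \<phi> h"
  defines "s \<equiv> \<lambda>d. \<Sum>h\<in>monics d. \<phi> h"
    and "S \<equiv> \<lambda>n. \<Sum>a\<in>fixed_field n. \<phi> (norm_poly n a)"
  shows "of_nat d * s d = (\<Sum>n\<in>{1..d}. S n * s (d - n))"
proof -
  let ?A = "\<lambda>h :: 'k poly. SIGMA n:{1..d}. {a \<in> fixed_field n. norm_poly n a dvd h}"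
  let ?B = "SIGMA n:{1..d}. (fixed_field n :: 'k alg_closure set) \<times> (monics (d - n) :: 'k poly set)"
  define J where "J = (\<lambda>(n, a, h :: 'k poly). (norm_poly n a * h, n, a))"
  define I where "I = (\<lambda>(h :: 'k poly, n, a). (n, a, h div norm_poly n a))"
  note IJ = I_def J_def
  have fin: "finite (fixed_field n :: 'k alg_closure set)" if "n \<in> {1..d}" for n
    using that by (intro finite_fixed_field) simp
  have "(\<Sum>n\<in>{1..d}. S n * s (d - n)) =
      (\<Sum>n\<in>{1..d}. \<Sum>(a, h)\<in>fixed_field n \<times> monics (d - n). \<phi> (norm_poly n a) * \<phi> h)"
    by (simp add: S_def s_def sum_product sum.cartesian_product)
  also have "\<dots> = (\<Sum>(n, a, h)\<in>?B. \<phi> (norm_poly n a) * \<phi> h)"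
    using fin finite_monics
    by (subst sum.Sigma) (auto simp: case_prod_unfold intro!: finite_cartesian_product)
  also have "\<dots> = (\<Sum>(n, a, h)\<in>?B. \<phi> (norm_poly n a * h))"
    by (intro sum.cong refl) (auto simp: \<phi>[OF norm_poly_in_monics])
  \<comment> \<open>A monic of degree d arises as such a product once for each pair (n, a) with
    \<open>norm_poly n a\<close> dividing it, hence d times.\<close>
  also have "\<dots> = (\<Sum>(h, n, a)\<in>(SIGMA h:monics d. ?A h). \<phi> h)"
  proof (rule sum.reindex_bij_witness)
    fix x assume "x \<in> ?B"
    then obtain n a h where x: "x = (n, a, h)"
      and nah: "n \<in> {1..d}" "a \<in> fixed_field n" "h \<in> monics (d - n)" by blast
    note N = norm_poly_in_monics[OF nah(2)]
    show "I (J x) = x"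
      using monics_nonzero[OF N] x by (simp add: IJ)
    show "J x \<in> (SIGMA h:monics d. ?A h)"
      using monics_mult[OF N nah(3)] nah x by (simp add: IJ)
    show "(case J x of (h, n, a) \<Rightarrow> \<phi> h) =
        (case x of (n, a, h) \<Rightarrow> \<phi> (norm_poly n a * h))"
      by (simp add: x IJ)
  next
    fix y assume "y \<in> (SIGMA h:monics d. ?A h)"
    then obtain h n a where y: "y = (h, n, a)" and h: "h \<in> monics d"
      and na: "n \<in> {1..d}" "a \<in> fixed_field n" "norm_poly n a dvd h" by blast
    show "J (I y) = y"
      using na(3) y by (simp add: IJ)
    show "I y \<in> ?B"
      using na h y by (simp add: IJ monics_cofactor[OF _ norm_poly_in_monics[OF na(2)]])
  qed
  also have "\<dots> = (\<Sum>h\<in>monics d. \<Sum>x\<in>?A h. \<phi> h)"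
    using fin finite_monics by (subst sum.Sigma) (auto simp: case_prod_unfold)
  also have "\<dots> = (\<Sum>h\<in>monics d. of_nat d * \<phi> h)"
    by (intro sum.cong refl) (simp add: card_norm_poly_dvd[unfolded One_nat_def] del: card_SigmaI)
  finally show ?thesis by (simp add: s_def sum_distrib_left)
qed

lemma cube_root_minus_1: "z ^ 3 = 1 \<Longrightarrow> z \<noteq> 1 \<Longrightarrow> z\<^sup>2 + z + 1 = 0" for z :: "'b::idom"
proof -
  assume z: "z ^ 3 = 1" "z \<noteq> 1"
  have "(z - 1) * (z\<^sup>2 + z + 1) = z ^ 3 - 1"
    by (simp add: power2_eq_square power3_eq_cube algebra_simps)
  then show ?thesis using z by simp
qed

lemma power_mod_3: "z ^ 3 = 1 \<Longrightarrow> z ^ n = z ^ (n mod 3)" for z :: "'b::field"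
proof -
  assume z: "z ^ 3 = 1"
  have "z ^ n = z ^ (3 * (n div 3) + n mod 3)" by simp
  also have "\<dots> = (z ^ 3) ^ (n div 3) * z ^ (n mod 3)" by (simp only: power_add power_mult)
  finally show ?thesis using z by simp
qed

lemma order_conj_prod_period:
  assumes "n > 0" "frob n a = a"
  shows "Polynomial.order b (conj_prod (period a) a) \<le> 1"
proof -
  have "card {i. i < period a \<and> frob i a = b} \<le> card {0::nat}" if ex: "i0 < period a" "frob i0 a = b" for i0
  proof -
    have "i = j" if "i \<le> j" "j < period a" "frob i a = frob j a" for i j
    proof -
      have "frob i (frob (j - i) a) = frob i a" using that by (simp add: frob_frob)
      then have "period a dvd j - i"
        using period(3)[OF assms] by (simp add: frob_inj)
      then show ?thesis using that by (auto dest: dvd_imp_le)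
    qed
    then have "i = i0" if "i < period a" "frob i a = b" for i
      using that ex by (metis nat_le_linear)
    then have "{i. i < period a \<and> frob i a = b} \<subseteq> {i0}" by auto
    then have "card {i. i < period a \<and> frob i a = b} \<le> card {i0}" by (intro card_mono) auto
    then show ?thesis by simp
  qed
  note 1 = this
  show ?thesis
    unfolding order_conj_prod
  proof (cases "\<exists>i0<period a. frob i0 a = b")
    case True
    then show "card {i. i < period a \<and> frob i a = b} \<le> 1" using 1 by auto
  next
    case False
    then have "{i. i < period a \<and> frob i a = b} = {}" by auto
    then show "card {i. i < period a \<and> frob i a = b} \<le> 1" by (simp only: card.empty)
  qed
qed

lemma order_conj_prod_eq:
  assumes "n > 0" "frob n a = a"
  shows "Polynomial.order b (conj_prod (period a) a) = (if \<exists>i. b = frob i a then 1 else 0)"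
proof (cases "\<exists>i. b = frob i a")
  case True
  then obtain i where b: "b = frob i a" by blast
  have "frob i a = frob (i mod period a) (frob (period a * (i div period a)) a)"
    by (simp add: frob_frob)
  also have "frob (period a * (i div period a)) a = a"
    using period(3)[OF assms] by simp
  finally have "{j. j < period a \<and> frob j a = b} \<noteq> {}"
    using period(1)[OF assms] b by (auto intro!: exI[of _ "i mod period a"])
  then have "Polynomial.order b (conj_prod (period a) a) \<noteq> 0"
    unfolding order_conj_prod by simp
  then show ?thesis using order_conj_prod_period[OF assms, of b] True by simp
next
  case False
  then have "{i. i < period a \<and> frob i a = b} = {}" by auto
  then show ?thesis using False by (metis card.empty order_conj_prod)
qed

lemma fixed_field_mult: "a \<in> fixed_field n \<Longrightarrow> b \<in> fixed_field n \<Longrightarrow> a * b \<in> fixed_field n"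
  by (simp add: fixed_field_def frob_mult)

lemma fixed_field_power: "a \<in> fixed_field n \<Longrightarrow> a ^ m \<in> fixed_field n"
  by (simp add: fixed_field_def frob_power)

lemma monics_add: "h \<in> monics d \<Longrightarrow> degree p < d \<Longrightarrow> h + p \<in> monics d"
  by (auto simp: monics_def degree_add_eq_left coeff_eq_0)

text \<open>A nonzero polynomial vanishing at a has degree at least m = \<open>period a\<close>, so
  the q^m polynomials of smaller degree take distinct values at a and exhaust the field with q^m
  elements.\<close>

lemma evaluation_surj:
  fixes a b :: "'k::finite_field alg_closure"
  assumes n: "n > 0" "frob n a = a" and b: "b \<in> fixed_field (period a)"
  shows "\<exists>v. poly (geom v) a = b"
proof -
  let ?m = "period a"
  note m = period(1,2)[OF n]
  have a: "a \<in> fixed_field ?m" using m by (simp add: fixed_field_def)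
  let ?L = "{xs :: 'k list. set xs \<subseteq> UNIV \<and> length xs = ?m}"
  let ?ev = "\<lambda>xs. poly (geom (Poly xs)) a"
  have zero: "h = 0" if "degree h < ?m \<or> h = 0" "poly (geom h) a = 0" for h :: "'k poly"
  proof (rule ccontr)
    assume "h \<noteq> 0"
    then have "Polynomial.order a (geom h) \<ge> 1" using that(2) order_root[of "geom h" a] by auto
    then have "norm_poly (?m * 1) a dvd h"
      using norm_poly_dvd_iff[of h a 1] \<open>h \<noteq> 0\<close> a m by simp
    then have "?m \<le> degree h"
      using dvd_imp_degree_le[of "norm_poly ?m a" h] \<open>h \<noteq> 0\<close> norm_poly_in_monics[OF a]
      by (simp add: monics_def)
    then show False using that(1) \<open>h \<noteq> 0\<close> by simp
  qed
  have "inj_on ?ev ?L"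
  proof (rule inj_onI)
    fix xs ys assume xy: "xs \<in> ?L" "ys \<in> ?L" "?ev xs = ?ev ys"
    let ?h = "Poly xs - Poly ys"
    have "degree ?h < ?m \<or> ?h = 0"
      using xy(1,2) m(1)
      by (cases "Poly xs = Poly ys") (auto intro!: degree_lessI simp: nth_default_def)
    moreover have "poly (geom ?h) a = 0" using xy(3) by (simp add: geom_diff)
    ultimately have "Poly xs = Poly ys" using zero[of ?h] by simp
    then have eq: "nth_default 0 xs i = nth_default 0 ys i" for i
      unfolding coeff_Poly_eq[symmetric] by (simp only:)
    show "xs = ys"
    proof (rule nth_equalityI)
      show "length xs = length ys" using xy(1,2) by simp
      show "xs ! i = ys ! i" if "i < length xs" for i
        using eq[of i] that xy(1,2) by (simp add: nth_default_nth)
    qed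
  qed
  then have "card (?ev ` ?L) = CARD('k) ^ ?m"
    using card_lists_length_eq[of "UNIV :: 'k set" ?m] by (simp add: card_image)
  moreover have "?ev ` ?L \<subseteq> fixed_field ?m"
    using m(2) by (auto simp: fixed_field_def simp flip: poly_geom_frob)
  ultimately have "?ev ` ?L = fixed_field ?m"
    using card_fixed_field[OF m(1), where 'k = 'k] finite_fixed_field[OF m(1), where 'k = 'k]
    by (intro card_subset_eq) auto
  then have "b \<in> ?ev ` ?L" using b by (simp only:)
  then show ?thesis by blast
qed

section \<open>The cubic character\<close>

locale cubic_cover =
  fixes f :: "'k::finite_field poly" and r :: 'k
    and \<rho> :: "'l::{alg_closed_field, field_char_0}"
  assumes card_mod_3: "CARD('k) mod 3 = 1"
    and r: "r ^ 3 = 1" "r \<noteq> 1"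
    and \<rho>: "\<rho> ^ 3 = 1" "\<rho> \<noteq> 1"
    and cube_free_f: "cube_free f"
    and irreducible_kummer: "irreducible (kummer_poly (geom f))"
begin

lemma f_nonzero: "f \<noteq> 0"
proof
  assume "f = 0"
  then have "(0 :: 'k poly) dvd 1" using cube_free_f unfolding cube_free_def by (metis dvd_0_right)
  then show False by simp
qed

text \<open>In characteristic 3 the equation r^3 = 1 reads (r - 1)^3 = 0.\<close>

lemma three_nonzero: "(3 :: 'k) \<noteq> 0"
proof
  assume 3: "(3 :: 'k) = 0"
  have "(r - 1) ^ 3 = r ^ 3 - 1 - 3 * (r\<^sup>2 - r)"
    by (simp add: power2_eq_square power3_eq_cube algebra_simps)
  then show False using r 3 by simp
qed

text \<open>A constant is a cube d^3 in the algebraic closure, and y^3 - d^3 has the factor y -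
  d.\<close>

lemma degree_f_pos: "degree f > 0"
proof (rule ccontr)
  assume "\<not> ?thesis"
  then obtain c where c: "geom f = [:c:]"
    by (metis degree_eq_zeroE degree_geom gr0I)
  obtain d where d: "d ^ 3 = c" using nth_root_exists[of 3 c] by auto
  define e where "e = to_fract [:d:]"
  have "to_fract [:c:] = e ^ 3"
    by (simp add: e_def d[symmetric] power3_eq_cube flip: to_fract_mult)
  then have "kummer_poly (geom f) = [:- e, 1:] * [:e\<^sup>2, e, 1:]"
    by (simp add: kummer_poly_def c power3_eq_cube power2_eq_square monom_altdef algebra_simps)
  then have "[:- e, 1:] dvd 1 \<or> [:e\<^sup>2, e, 1:] dvd 1"
    using irreducible_kummer by (metis irreducibleD)
  then show False by (auto simp: is_unit_poly_iff)
qed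

text \<open>Cube-freeness passes to the closure: the minimal polynomial P of a root of multiplicity
  at least 3 is separable and all its roots have that multiplicity in f, so P^3 divides f already
  over k.\<close>

lemma order_f_le_2: "Polynomial.order a (geom f) \<le> 2"
proof (rule ccontr)
  assume gt: "\<not> ?thesis"
  then have "poly (geom f) a = 0" by (auto simp: order_root)
  then obtain n where n: "n > 0" "frob n a = a" using root_periodic f_nonzero by blast
  have a: "a \<in> fixed_field (period a)" using period(2)[OF n] by (simp add: fixed_field_def)
  let ?P = "norm_poly (period a) a"
  have "geom (?P ^ 3) dvd geom f"
  proof (rule dvd_if_order_le)
    fix b
    have "Polynomial.order b (geom (?P ^ 3)) = 3 * Polynomial.order b (conj_prod (period a) a)"
      unfolding geom_power geom_norm_poly[OF a] by (simp add: power3_eq_cube order_mult)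
    also have "\<dots> \<le> Polynomial.order b (geom f)"
      using gt order_geom_frob[OF f_nonzero, of _ a] by (auto simp: order_conj_prod_eq[OF n])
    finally show "Polynomial.order b (geom (?P ^ 3)) \<le> Polynomial.order b (geom f)" .
  qed (use f_nonzero monics_nonzero[OF norm_poly_in_monics[OF a]] in auto)
  then have "?P dvd 1" using cube_free_f by (auto simp: geom_dvd_iff cube_free_def)
  moreover have "degree ?P > 0"
    using norm_poly_in_monics[OF a] period(1)[OF n] by (simp add: monics_def)
  ultimately show False by (auto simp: is_unit_poly_iff)
qed

sublocale triple_cover "geom f" "to_ac r"
proof
  show "(to_ac r)\<^sup>2 + to_ac r + 1 = 0"
    using cube_root_minus_1[OF r] by (simp flip: to_ac_power to_ac_add to_ac_1)
  show "(3 :: 'k alg_closure) \<noteq> 0"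
    using three_nonzero to_ac_eq_0_iff[of "3 :: 'k"] by simp
qed (use f_nonzero order_f_le_2 in auto)

abbreviation "Z \<equiv> {a. poly (geom f) a = 0}"

lemma finite_Z: "finite Z"
  using f_nonzero by (intro poly_roots_finite) simp

lemma genus_f: "genus (geom f) + 2 = card Z + (if 3 dvd degree f then 0 else 1)"
  using genus_eq degree_f_pos by simp

lemma to_ac_r_power_eq_iff: "to_ac r ^ i = to_ac r ^ j \<longleftrightarrow> i mod 3 = j mod 3"
proof
  have r2: "r\<^sup>2 \<noteq> 1" "r\<^sup>2 \<noteq> r"
  proof -
    show "r\<^sup>2 \<noteq> 1" using r by (auto simp: power2_eq_square power3_eq_cube)
    show "r\<^sup>2 \<noteq> r" using r by (auto simp: power2_eq_square)
  qed
  assume "to_ac r ^ i = to_ac r ^ j"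
  then have "r ^ i = r ^ j" by (simp flip: to_ac_power)
  then have "r ^ (i mod 3) = r ^ (j mod 3)"
    using power_mod_3[OF r(1), of i] power_mod_3[OF r(1), of j] by simp
  moreover have "i mod 3 = 0 \<or> i mod 3 = 1 \<or> i mod 3 = 2" "j mod 3 = 0 \<or> j mod 3 = 1 \<or> j mod 3 = 2"
    by linarith+
  ultimately show "i mod 3 = j mod 3"
    using r(2) r2 by (elim disjE) (auto dest: sym)
next
  assume "i mod 3 = j mod 3"
  moreover have "to_ac r ^ 3 = 1" using r(1) by (simp flip: to_ac_power)
  ultimately show "to_ac r ^ i = to_ac r ^ j"
    using power_mod_3[of "to_ac r" i] power_mod_3[of "to_ac r" j] by simp
qed

lemma \<rho>_power_eq: "i mod 3 = j mod 3 \<Longrightarrow> \<rho> ^ i = \<rho> ^ j"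
  using power_mod_3[OF \<rho>(1), of i] power_mod_3[OF \<rho>(1), of j] by simp

text \<open>Both r and \<rho> have order 3, so the symbol does not depend on the exponent chosen by
  \<open>LEAST\<close>.\<close>

lemma cubic_symbol_eqI:
  assumes "a \<noteq> 0" "a ^ ((CARD('k) ^ n - 1) div 3) = to_ac r ^ j"
  shows "cubic_symbol r \<rho> n a = \<rho> ^ j"
proof -
  define i where "i = (LEAST i. a ^ ((CARD('k) ^ n - 1) div 3) = to_ac r ^ i)"
  have "a ^ ((CARD('k) ^ n - 1) div 3) = to_ac r ^ i"
    unfolding i_def by (rule LeastI) (rule assms)
  then have "i mod 3 = j mod 3" using assms(2) by (simp add: to_ac_r_power_eq_iff)
  then have "\<rho> ^ i = \<rho> ^ j" by (rule \<rho>_power_eq)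
  then show ?thesis using assms(1) unfolding cubic_symbol_def i_def by (simp only: if_False)
qed

lemma cube_root_of_unityE:
  assumes "b ^ 3 = (1 :: 'k alg_closure)"
  obtains j where "b = to_ac r ^ j"
proof -
  let ?r = "to_ac r"
  have r3: "?r ^ 3 = 1" using r(1) by (simp flip: to_ac_power)
  have "(b - 1) * (b - ?r) * (b - ?r\<^sup>2) = b ^ 3 - ?r ^ 3 - (b\<^sup>2 - b * ?r) * (?r\<^sup>2 + ?r + 1)"
    by (simp add: power2_eq_square power3_eq_cube algebra_simps)
  also have "\<dots> = 0" by (simp only: assms r3 \<omega>) simp
  finally have "b = 1 \<or> b = ?r \<or> b = ?r\<^sup>2" by simp
  then show ?thesis using that[of 0] that[of 1] that[of 2] by auto
qed

lemma card_power_mod_3: "(CARD('k) ^ n - 1) div 3 * 3 = CARD('k) ^ n - 1"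
proof -
  have "CARD('k) ^ n mod 3 = 1" using power_mod[of "CARD('k)" 3 n] card_mod_3 by simp
  then show ?thesis by presburger
qed

lemma cubic_symbolE:
  assumes "a \<in> fixed_field n" "a \<noteq> 0"
  obtains j where "a ^ ((CARD('k) ^ n - 1) div 3) = to_ac r ^ j" "cubic_symbol r \<rho> n a = \<rho> ^ j"
proof -
  have "a ^ (CARD('k) ^ n) = a" using assms(1) by (simp add: fixed_field_def frob_def)
  moreover have "CARD('k) ^ n = Suc (CARD('k) ^ n - 1)" using card_gt_1[where 'k = 'k] by simp
  ultimately have "a * a ^ (CARD('k) ^ n - 1) = a" by (metis power_Suc)
  then have "(a ^ ((CARD('k) ^ n - 1) div 3)) ^ 3 = 1"
    using assms(2) card_power_mod_3[of n] by (simp flip: power_mult)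
  then obtain j where "a ^ ((CARD('k) ^ n - 1) div 3) = to_ac r ^ j" by (rule cube_root_of_unityE)
  then show ?thesis using that cubic_symbol_eqI assms(2) by blast
qed

lemma cubic_symbol_0 [simp]: "cubic_symbol r \<rho> n 0 = 0"
  by (simp add: cubic_symbol_def)

lemma \<rho>_nonzero: "\<rho> \<noteq> 0"
  using \<rho>(1) by auto

lemma cubic_symbol_eq_0_iff: "cubic_symbol r \<rho> n a = 0 \<longleftrightarrow> a = 0"
  using \<rho>_nonzero by (simp add: cubic_symbol_def)

lemma cubic_symbol_1 [simp]: "cubic_symbol r \<rho> n 1 = 1"
  using cubic_symbol_eqI[of 1 n 0] by simp

lemma cubic_symbol_mult:
  assumes "a \<in> fixed_field n" "b \<in> fixed_field n"
  shows "cubic_symbol r \<rho> n (a * b) = cubic_symbol r \<rho> n a * cubic_symbol r \<rho> n b"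
proof (cases "a = 0 \<or> b = 0")
  case False
  obtain i where i: "a ^ ((CARD('k) ^ n - 1) div 3) = to_ac r ^ i" "cubic_symbol r \<rho> n a = \<rho> ^ i"
    using cubic_symbolE assms(1) False by blast
  obtain j where j: "b ^ ((CARD('k) ^ n - 1) div 3) = to_ac r ^ j" "cubic_symbol r \<rho> n b = \<rho> ^ j"
    using cubic_symbolE assms(2) False by blast
  have "cubic_symbol r \<rho> n (a * b) = \<rho> ^ (i + j)"
    using False i(1) j(1) by (intro cubic_symbol_eqI) (auto simp: power_mult_distrib power_add)
  then show ?thesis by (simp add: i j power_add)
qed auto

lemma cubic_symbol_power:
  assumes "a \<in> fixed_field n"
  shows "cubic_symbol r \<rho> n (a ^ m) = cubic_symbol r \<rho> n a ^ m"
  using assms by (induction m) (auto simp: cubic_symbol_mult fixed_field_power)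

lemma cubic_symbol_cube:
  assumes "a \<in> fixed_field n" "a \<noteq> 0"
  shows "cubic_symbol r \<rho> n a ^ 3 = 1"
proof -
  obtain j where "cubic_symbol r \<rho> n a = \<rho> ^ j" using assms by (rule cubic_symbolE)
  moreover have "(\<rho> ^ j) ^ 3 = (\<rho> ^ 3) ^ j" by (simp add: mult.commute flip: power_mult)
  ultimately show ?thesis using \<rho>(1) by simp
qed

text \<open>(q^n - 1)/3 is (q - 1)/3 times 1 + q + ... + q^(n-1), and raising to the latter power is
  the norm to k.\<close>

lemma cubic_symbol_norm:
  fixes a :: "'k alg_closure"
  assumes "n > 0"
  shows "cubic_symbol r \<rho> n a = cubic_symbol r \<rho> 1 (\<Prod>i<n. frob i a)"
proof -
  define e where "e = (CARD('k) - 1) div 3"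
  have "(\<Sum>i<n. CARD('k) ^ i) * (CARD('k) - 1) = CARD('k) ^ n - 1"
    by (induction n) (auto simp: algebra_simps)
  moreover have "e * 3 = CARD('k) - 1" using card_mod_3 unfolding e_def by presburger
  ultimately have "(\<Sum>i<n. CARD('k) ^ i) * e * 3 = CARD('k) ^ n - 1" by (simp add: mult.assoc)
  then have exp: "(\<Sum>i<n. CARD('k) ^ i) * e = (CARD('k) ^ n - 1) div 3" by simp
  have "(\<Prod>i<n. frob i a) = a ^ (\<Sum>i<n. CARD('k) ^ i)" by (simp add: frob_def power_sum)
  then have "(\<Prod>i<n. frob i a) ^ e = a ^ ((CARD('k) ^ n - 1) div 3)"
    using exp by (simp flip: power_mult)
  moreover have "(\<Prod>i<n. frob i a) = 0 \<longleftrightarrow> a = 0"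
    using assms by (auto simp: prod_zero_iff)
  ultimately show ?thesis by (simp add: cubic_symbol_def e_def)
qed

end

section \<open>The character modulo the radical and its sums\<close>

lemma frob_divide: "frob n (a / b) = frob n a / frob n b"
  by (simp add: frob_def power_divide)

lemma frob_prod_mset: "frob n (\<Prod>x\<in>#A. g x) = (\<Prod>x\<in>#A. frob n (g x))"
  by (induction A) (simp_all add: frob_mult)

lemma frob_surj: "\<exists>b. frob n b = a" for a :: "'k::finite_field alg_closure"
proof -
  have "CARD('k) ^ n > 0" using card_gt_1[where 'k = 'k] by simp
  then show "\<exists>b. frob n b = (a :: 'k alg_closure)"
    unfolding frob_def by (rule nth_root_exists)
qed

lemma proots_frob:
  fixes h :: "'k::finite_field poly"
  assumes "h \<noteq> 0"
  shows "image_mset (frob n) (proots (geom h)) = proots (geom h)"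
proof (rule multiset_eqI)
  fix b :: "'k alg_closure"
  obtain a where a: "frob n a = b" using frob_surj by blast
  have "count (image_mset (frob n) M) (frob n a) = count M a" for M
    by (induction M) (auto simp: frob_inj)
  then have "count (image_mset (frob n) (proots (geom h))) (frob n a) =
      count (proots (geom h)) (frob n a)"
    using assms order_geom_frob[OF assms, of n a] by simp
  then show "count (image_mset (frob n) (proots (geom h))) b = count (proots (geom h)) b"
    by (simp only: a)
qed

definition set_poly :: "'k::finite_field alg_closure set \<Rightarrow> 'k poly" where
  "set_poly Y = map_poly of_ac (\<Prod>x\<in>Y. [:- x, 1:])"

lemma geom_set_poly:
  assumes "finite Y" "frob 1 ` Y \<subseteq> Y"
  shows "geom (set_poly Y) = (\<Prod>x\<in>Y. [:- x, 1:])"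
  unfolding set_poly_def
proof (rule geom_of_ac)
  have inj: "inj_on (frob 1) Y" by (simp add: inj_on_def frob_inj)
  then have img: "frob 1 ` Y = Y" using assms endo_inj_surj by blast
  have "map_poly (frob 1) (\<Prod>x\<in>Y. [:- x, 1:]) = (\<Prod>x\<in>Y. [:- frob 1 x, 1:])"
    by (simp add: map_poly_frob_prod map_poly_frob_linear del: map_poly_pCons)
  also have "\<dots> = (\<Prod>x\<in>frob 1 ` Y. [:- x, 1:])"
    using inj by (simp add: prod.reindex)
  finally show "map_poly (frob 1) (\<Prod>x\<in>Y. [:- x, 1:]) = (\<Prod>x\<in>Y. [:- x, 1:])"
    by (simp only: img)
qed

lemma prod_prod_mset_swap:
  "(\<Prod>i\<in>I. \<Prod>x\<in>#A. g i x) = (\<Prod>x\<in>#A. \<Prod>i\<in>I. g i x)"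
  for g :: "'i \<Rightarrow> 'a \<Rightarrow> 'b::comm_monoid_mult"
  by (induction A) (simp_all add: prod.distrib)

lemma poly_prod_mset_linear: "poly (\<Prod>x\<in>#A. [:- x, 1:]) y = (\<Prod>x\<in>#A. y - x)"
  for y :: "'b::comm_ring_1"
  by (induction A) (simp_all add: algebra_simps)

context cubic_cover
begin

abbreviation "csym \<equiv> cubic_symbol r \<rho> 1"
abbreviation "A \<equiv> proots (geom f)"
abbreviation "lc \<equiv> to_ac (lead_coeff f)"

text \<open>The resultant of \<open>f / lead_coeff f\<close> and \<open>h\<close>, up to a sign, which is a cube.\<close>

definition res :: "'k poly \<Rightarrow> 'k alg_closure" where
  "res h = (\<Prod>\<alpha>\<in>#A. poly (geom h) \<alpha>)"

definition chi' :: "'k poly \<Rightarrow> 'l" where "chi' h = csym (res h)"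

text \<open>\<open>chi'\<close> depends only on the values of h at the roots of f. The leading
  coefficient of f enters through the degree of h alone, so on monics of a fixed degree
  \<open>chi\<close> is a constant multiple of \<open>chi'\<close>.\<close>

definition chi :: "'k poly \<Rightarrow> 'l" where "chi h = csym lc ^ degree h * chi' h"

lemma set_A [simp]: "set_mset A = Z"
  using f_nonzero by simp

lemma size_A: "size A = degree f"
  using alg_closed_factorization_proots(1)[of "geom f"] f_nonzero by simp

lemma lc_nonzero: "lc \<noteq> 0"
  using f_nonzero by simp

lemma lc_fixed: "lc \<in> fixed_field n"
  by (simp add: fixed_field_def)

lemma res_fixed: "res h \<in> fixed_field 1"
proof -
  have "frob 1 (res h) = (\<Prod>\<alpha>\<in>#A. poly (geom h) (frob 1 \<alpha>))"
    by (simp add: res_def frob_prod_mset poly_geom_frob)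
  also have "\<dots> = (\<Prod>\<alpha>\<in>#image_mset (frob 1) A. poly (geom h) \<alpha>)"
    by (simp add: image_mset.compositionality comp_def)
  also have "\<dots> = res h" by (simp only: proots_frob[OF f_nonzero] res_def)
  finally show ?thesis by (simp add: fixed_field_def)
qed

lemma res_mult: "res (g * h) = res g * res h"
  by (simp add: res_def geom_mult prod_mset.distrib)

lemma res_1 [simp]: "res 1 = 1"
  by (simp add: res_def)

lemma chi'_mult: "chi' (g * h) = chi' g * chi' h"
  unfolding chi'_def res_mult by (intro cubic_symbol_mult res_fixed)

lemma chi_mult: "g \<in> monics m \<Longrightarrow> h \<in> monics n \<Longrightarrow> chi (g * h) = chi g * chi h"
proof -
  assume g: "g \<in> monics m" and h: "h \<in> monics n"
  then have "degree (g * h) = degree g + degree h"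
    using monics_mult[OF g h] by (simp add: monics_def)
  then show ?thesis by (simp add: chi_def chi'_mult power_add)
qed

lemma chi'_eq_0_iff: "chi' h = 0 \<longleftrightarrow> (\<exists>\<alpha>\<in>Z. poly (geom h) \<alpha> = 0)"
  by (auto simp: chi'_def cubic_symbol_eq_0_iff res_def prod_mset_zero_iff)

lemma chi'_cong:
  assumes "\<And>\<alpha>. \<alpha> \<in> Z \<Longrightarrow> poly (geom g) \<alpha> = poly (geom h) \<alpha>"
  shows "chi' g = chi' h"
proof -
  have "res g = res h" unfolding res_def
    using assms by (intro arg_cong[of _ _ prod_mset] image_mset_cong) simp
  then show ?thesis by (simp add: chi'_def)
qed

text \<open>-1 is its own cube; this disposes of the sign in the symmetry of the resultant.\<close>

lemma sym_minus_one_power: "csym ((- 1) ^ n) = 1"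
proof -
  have "(- 1 :: 'k alg_closure) \<in> fixed_field 1" by (simp add: fixed_field_def frob_uminus)
  then have 1: "csym (- 1) ^ 3 = 1" and 2: "csym ((- 1) ^ m) = csym (- 1) ^ m" for m
    by (simp_all add: cubic_symbol_cube cubic_symbol_power del: One_nat_def)
  have "(- 1 :: 'k alg_closure) ^ 3 = - 1" by (simp add: power3_eq_cube)
  then have "csym (- 1) = 1" using 1 2[of 3] by simp
  then show ?thesis using 2 by simp
qed

lemma poly_geom_f: "poly (geom f) x = lc * (\<Prod>\<alpha>\<in>#A. x - \<alpha>)"
proof -
  have "geom f = smult (lead_coeff (geom f)) (\<Prod>x\<in>#A. [:- x, 1:])"
    using alg_closed_factorization_proots(2)[of "geom f"] f_nonzero by simp
  then have "poly (geom f) x = poly (smult (lead_coeff (geom f)) (\<Prod>x\<in>#A. [:- x, 1:])) x"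
    by simp
  then show ?thesis by (simp only: poly_smult poly_prod_mset_linear lead_coeff_geom)
qed

text \<open>The norm of f(a) is lc^n times the product of all differences
  \<open>frob i a - \<alpha>\<close> over the roots \<alpha> of f; evaluating the characteristic
  polynomial of a at these roots gives the same product up to sign.\<close>

lemma chi_norm_poly:
  assumes "n > 0" "a \<in> fixed_field n"
  shows "chi (norm_poly n a) = cubic_symbol r \<rho> n (poly (geom f) a)"
proof -
  define w where "w = (\<Prod>\<alpha>\<in>#A. \<Prod>i<n. frob i a - \<alpha>)"
  define \<epsilon> where "\<epsilon> = (- 1 :: 'k alg_closure) ^ (n * size A)"
  have \<epsilon>: "\<epsilon> * \<epsilon> = 1" by (simp add: \<epsilon>_def flip: power_mult_distrib)
  have \<epsilon>_fixed: "\<epsilon> \<in> fixed_field 1" unfolding \<epsilon>_def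
    by (intro fixed_field_power) (simp add: fixed_field_def frob_uminus)
  have "poly (conj_prod n a) \<alpha> = (- 1) ^ n * (\<Prod>i<n. frob i a - \<alpha>)" for \<alpha>
  proof -
    have "poly (conj_prod n a) \<alpha> = (\<Prod>i<n. (- 1) * (frob i a - \<alpha>))"
      by (simp add: conj_prod_def poly_prod)
    also have "\<dots> = (- 1) ^ n * (\<Prod>i<n. frob i a - \<alpha>)"
      by (subst prod.distrib) simp
    finally show ?thesis .
  qed
  then have res: "res (norm_poly n a) = \<epsilon> * w"
    by (simp add: res_def geom_norm_poly[OF assms(2)] prod_mset.distrib w_def \<epsilon>_def power_mult)
  have w: "w = \<epsilon> * res (norm_poly n a)"
    by (simp add: res \<epsilon> flip: mult.assoc)
  have "frob i (poly (geom f) a) = lc * (\<Prod>\<alpha>\<in>#A. frob i a - \<alpha>)" for i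
    unfolding poly_geom_frob[symmetric] by (rule poly_geom_f)
  then have "(\<Prod>i<n. frob i (poly (geom f) a)) = lc ^ n * w"
    by (simp add: prod.distrib prod_prod_mset_swap w_def)
  then have "cubic_symbol r \<rho> n (poly (geom f) a) = csym (lc ^ n * w)"
    by (simp only: cubic_symbol_norm[OF assms(1)])
  also have "\<dots> = csym lc ^ n * (csym \<epsilon> * csym (res (norm_poly n a)))"
    unfolding w using \<epsilon>_fixed res_fixed lc_fixed
    by (simp add: cubic_symbol_mult cubic_symbol_power fixed_field_mult fixed_field_power
        del: One_nat_def)
  also have "\<dots> = chi (norm_poly n a)"
    using norm_poly_in_monics[OF assms(2)]
    by (simp add: chi_def chi'_def \<epsilon>_def sym_minus_one_power monics_def del: One_nat_def)
  finally show ?thesis ..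
qed

lemma frob_Z: "frob n a \<in> Z \<longleftrightarrow> a \<in> Z"
  by (simp add: poly_geom_frob)

definition rad :: "'k poly" where "rad = set_poly Z"

lemma geom_rad: "geom rad = (\<Prod>x\<in>Z. [:- x, 1:])"
  unfolding rad_def using finite_Z frob_Z by (intro geom_set_poly) auto

lemma degree_rad: "degree rad = card Z"
proof -
  have "degree (geom rad) = card Z"
    unfolding geom_rad by (subst degree_prod_sum_eq) auto
  then show ?thesis by simp
qed

lemma rad_nonzero: "rad \<noteq> 0"
proof
  assume "rad = 0"
  then have "(\<Prod>x\<in>Z. [:- x, 1:]) = 0" using geom_rad by simp
  then show False using finite_Z by (simp add: prod_zero_iff)
qed

lemma card_Z_pos: "card Z > 0"
proof -
  obtain a where "poly (geom f) a = 0"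
    using alg_closed_imp_poly_has_root[of "geom f"] degree_f_pos by auto
  then show ?thesis using finite_Z by (auto simp: card_gt_0_iff)
qed

lemma poly_rad: "\<alpha> \<in> Z \<Longrightarrow> poly (geom rad) \<alpha> = 0"
  unfolding geom_rad poly_prod using finite_Z by (auto intro!: prod_zero)

lemma poly_mod_rad: "\<alpha> \<in> Z \<Longrightarrow> poly (geom (h mod rad)) \<alpha> = poly (geom h) \<alpha>"
proof -
  assume "\<alpha> \<in> Z"
  have "geom h = geom (rad * (h div rad) + h mod rad)" by simp
  then show ?thesis using poly_rad[OF \<open>\<alpha> \<in> Z\<close>] by (simp only: geom_add geom_mult poly_add poly_mult) simp
qed

lemma rad_dvd:
  assumes "\<And>\<alpha>. \<alpha> \<in> Z \<Longrightarrow> poly (geom h) \<alpha> = 0"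
  shows "rad dvd h"
proof (cases "h = 0")
  case False
  have "geom rad dvd geom h"
  proof (rule dvd_if_order_le)
    fix b
    have "Polynomial.order b (geom rad) = (if b \<in> Z then 1 else 0)"
      unfolding geom_rad using finite_Z by (subst order_prod) (auto simp: order_linear_factor)
    moreover have "Polynomial.order b (geom h) \<ge> 1" if "b \<in> Z"
      using assms[OF that] False order_root[of "geom h" b] by auto
    ultimately show "Polynomial.order b (geom rad) \<le> Polynomial.order b (geom h)" by auto
  qed (use False rad_nonzero in auto)
  then show ?thesis by (simp add: geom_dvd_iff)
qed simp

lemma exists_noncube:
  assumes "n > 0"
  obtains t :: "'k alg_closure" where "t \<in> fixed_field n" "t \<noteq> 0" "cubic_symbol r \<rho> n t \<noteq> 1"
proof -
  let ?M = "(CARD('k) ^ n - 1) div 3"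
  let ?p = "monom 1 ?M - 1 :: 'k alg_closure poly"
  have "CARD('k) ^ n > 1" using card_gt_1[where 'k = 'k] assms by (intro one_less_power)
  then have M: "?M > 0" "?M < CARD('k) ^ n - 1"
    using card_power_mod_3[of n] by linarith+
  have deg: "degree ?p \<le> ?M" by (intro degree_diff_le degree_monom_le) simp
  have nz: "?p \<noteq> 0"
  proof
    assume "?p = 0"
    then have "coeff ?p ?M = 0" by simp
    then show False using M(1) by simp
  qed
  have "\<not> fixed_field n - {0} \<subseteq> {t. poly ?p t = 0}"
  proof
    assume "fixed_field n - {0} \<subseteq> {t. poly ?p t = 0}"
    then have "card (fixed_field n - {0 :: 'k alg_closure}) \<le> card {t. poly ?p t = 0}"
      by (intro card_mono poly_roots_finite nz)
    also have "\<dots> \<le> ?M" using card_poly_roots_bound[OF nz] deg by simp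
    finally have "CARD('k) ^ n - 1 \<le> ?M"
      using card_fixed_field[OF assms, where 'k = 'k] finite_fixed_field[OF assms, where 'k = 'k]
      by (simp add: fixed_field_def)
    then show False using M by simp
  qed
  then obtain t where "t \<in> fixed_field n" "t \<noteq> 0" "poly ?p t \<noteq> 0" by blast
  then have t: "t \<in> fixed_field n" "t \<noteq> 0" "t ^ ?M \<noteq> 1" by (simp_all add: poly_monom)
  obtain j where j: "t ^ ?M = to_ac r ^ j" "cubic_symbol r \<rho> n t = \<rho> ^ j"
    using cubic_symbolE[OF t(1,2)] .
  have "j mod 3 \<noteq> 0" using t(3) j(1) to_ac_r_power_eq_iff[of j 0] by auto
  then have "j mod 3 = 1 \<or> j mod 3 = 2" by linarith
  then have "\<rho> ^ j = \<rho> \<or> \<rho> ^ j = \<rho>\<^sup>2" using \<rho>_power_eq[of j 1] \<rho>_power_eq[of j 2] by auto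
  moreover have "\<rho>\<^sup>2 \<noteq> 1" using \<rho> by (auto simp: power2_eq_square power3_eq_cube)
  ultimately show ?thesis using that t j \<rho>(2) by auto
qed

text \<open>Only the values at the roots count. With value t at a root a of multiplicity e,
  conjugate values at its conjugates and 1 at the other roots, \<open>chi'\<close> is the e-th power
  of the symbol of t; as e is 1 or 2, a noncube t gives a value other than 1.\<close>

lemma exists_nontrivial:
  obtains u where "chi' u \<noteq> 0" "chi' u \<noteq> 1"
proof -
  obtain a where a: "a \<in> Z" using card_Z_pos by (auto simp: card_gt_0_iff)
  then obtain n where n: "n > 0" "frob n a = a" using root_periodic f_nonzero by blast
  let ?m = "period a"
  note m = period(1,2)[OF n]
  obtain t where t: "t \<in> fixed_field ?m" "t \<noteq> 0" "cubic_symbol r \<rho> ?m t \<noteq> 1"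
    using exists_noncube[OF m(1)] .
  define orb where "orb = (\<lambda>i. frob i a) ` {..<?m}"
  have frob_orb: "frob 1 x \<in> orb \<longleftrightarrow> x \<in> orb" for x
  proof -
    have orb_eq: "orb = range (\<lambda>i. frob i a)"
    proof -
      have red: "frob i a = frob (i mod ?m) a" for i
      proof -
        have "frob i a = frob (i mod ?m) (frob (?m * (i div ?m)) a)" by (simp add: frob_frob)
        also have "frob (?m * (i div ?m)) a = a" using period(3)[OF n] by simp
        finally show ?thesis .
      qed
      have "frob (i mod ?m) a \<in> orb" for i
        unfolding orb_def using m(1) by (intro imageI) simp
      then have "frob i a \<in> orb" for i by (subst red)
      then show ?thesis unfolding orb_def by blast
    qed
    show ?thesis
    proof
      assume "frob 1 x \<in> orb"
      then obtain i where i: "frob 1 x = frob i a" by (auto simp: orb_eq)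
      also have "frob i a = frob i (frob ?m a)" by (simp add: m)
      also have "\<dots> = frob 1 (frob (i + ?m - 1) a)" using m(1) by (simp add: frob_frob)
      finally show "x \<in> orb" unfolding frob_inj orb_eq by (rule range_eqI)
    next
      assume "x \<in> orb"
      then obtain i where "x = frob i a" by (auto simp: orb_eq)
      then show "frob 1 x \<in> orb" unfolding orb_eq by (intro range_eqI[of _ _ "Suc i"]) (simp add: frob_frob)
    qed
  qed
  define E where "E = set_poly (Z - orb)"
  have E: "geom E = (\<Prod>x\<in>Z - orb. [:- x, 1:])"
    unfolding E_def using finite_Z frob_Z frob_orb by (intro geom_set_poly) auto
  have a_orb: "a \<in> orb" unfolding orb_def using m(1) by (intro image_eqI[of _ _ 0]) auto
  have Ea: "poly (geom E) a \<noteq> 0"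
    unfolding E poly_prod using finite_Z a_orb by (auto simp: prod_zero_iff)
  have "poly (geom E) a \<in> fixed_field ?m"
    using m(2) by (simp add: fixed_field_def flip: poly_geom_frob)
  then have "(t - 1) / poly (geom E) a \<in> fixed_field ?m"
    using t(1) by (simp add: fixed_field_def frob_divide frob_diff)
  then obtain v where v: "poly (geom v) a = (t - 1) / poly (geom E) a"
    using evaluation_surj[OF n] by blast
  \<comment> \<open>\<open>u\<close> is \<open>t\<close> at the root \<open>a\<close> and 1 at the roots not conjugate to \<open>a\<close>.\<close>
  define u where "u = 1 + E * v"
  have ua: "poly (geom u) a = t"
    using Ea by (simp add: u_def geom_add geom_mult v)
  have u_orb: "poly (geom u) (frob i a) = frob i t" for i
    by (simp add: poly_geom_frob ua)
  have u_other: "poly (geom u) x = 1" if "x \<in> Z - orb" for x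
  proof -
    have "poly (geom E) x = 0" unfolding E poly_prod using that finite_Z by (auto intro!: prod_zero)
    then show ?thesis by (simp add: u_def geom_add geom_mult)
  qed
  let ?e = "Polynomial.order a (geom f)"
  have orbZ: "orb \<subseteq> Z" using a frob_Z by (auto simp: orb_def)
  have inj: "inj_on (\<lambda>i. frob i a) {..<?m}"
  proof -
    have "i = j" if "i < j" "j < ?m" "frob i a = frob j a" for i j
    proof -
      have "frob i (frob (j - i) a) = frob i a" using that by (simp add: frob_frob)
      then have "?m dvd j - i" using period(3)[OF n] by (simp add: frob_inj)
      then show ?thesis using that by (auto dest: dvd_imp_le)
    qed
    then show ?thesis by (intro linorder_inj_onI) auto
  qed
  have "res u = (\<Prod>x\<in>Z. poly (geom u) x ^ Polynomial.order x (geom f))"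
    unfolding res_def using f_nonzero
    by (subst image_prod_mset_multiplicity) simp
  also have "\<dots> = (\<Prod>x\<in>orb. poly (geom u) x ^ Polynomial.order x (geom f))"
    using finite_Z orbZ u_other by (intro prod.mono_neutral_right) auto
  also have "\<dots> = (\<Prod>i<?m. frob i t ^ ?e)"
    unfolding orb_def using inj
    by (subst prod.reindex) (auto simp: u_orb order_geom_frob[OF f_nonzero] intro!: prod.cong)
  also have "\<dots> = (\<Prod>i<?m. frob i t) ^ ?e" by (simp add: prod_power_distrib)
  finally have "res u = (\<Prod>i<?m. frob i t) ^ ?e" .
  moreover have "(\<Prod>i<?m. frob i t) \<in> fixed_field 1"
  proof -
    \<comment> \<open>The norm is fixed by Frobenius: shifting the index replaces the factor t by
      its equal \<open>frob ?m t\<close>.\<close>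
    have "t * frob 1 (\<Prod>i<?m. frob i t) = t * (\<Prod>i<?m. frob i t)"
      using prod.lessThan_Suc_shift[of "\<lambda>i. frob i t" ?m] t(1)
      by (auto simp: frob_prod frob_frob fixed_field_def mult.commute)
    then show ?thesis using t(2) by (simp add: fixed_field_def)
  qed
  ultimately have chi'_u: "chi' u = cubic_symbol r \<rho> ?m t ^ ?e"
    by (simp add: chi'_def cubic_symbol_power cubic_symbol_norm[OF m(1), of t] del: One_nat_def)
  let ?s = "cubic_symbol r \<rho> ?m t"
  have s: "?s ^ 3 = 1" "?s \<noteq> 0" using t cubic_symbol_cube cubic_symbol_eq_0_iff by auto
  have "?e \<noteq> 0" using a f_nonzero by (simp add: order_root)
  then have e: "?e = 1 \<or> ?e = 2" using order_f_le_2[of a] by linarith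
  moreover have "?s\<^sup>2 \<noteq> 1" using s t(3) by (auto simp: power2_eq_square power3_eq_cube)
  ultimately have "?s ^ ?e \<noteq> 1" using t(3) by auto
  then show ?thesis using that[of u] chi'_u s(2) by simp
qed

text \<open>Orthogonality. The closure hypothesis lets residues modulo \<open>rad\<close> be changed
  within \<open>T\<close>; it holds for \<open>monics d\<close> with d \<ge> \<open>card Z\<close>
  and also for all polynomials of degree less than \<open>card Z\<close>.\<close>

lemma sum_chi'_eq_0:
  assumes T: "finite T" and closed: "\<And>h p. h \<in> T \<Longrightarrow> degree p < card Z \<Longrightarrow> h + p \<in> T"
  shows "(\<Sum>h\<in>T. chi' h) = 0"
proof -
  obtain u where u: "chi' u \<noteq> 0" "chi' u \<noteq> 1" by (rule exists_nontrivial)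
  \<comment> \<open>\<open>\<phi>\<close> multiplies the residue of \<open>h\<close> modulo \<open>rad\<close> by \<open>u\<close> without changing the quotient, so that
    monic polynomials of large degree remain monic.\<close>
  define \<phi> where "\<phi> h = h + ((u * h) mod rad - h mod rad)" for h
  have deg_mod: "degree (h mod rad) < card Z" for h
    using degree_mod_less[OF rad_nonzero, of h] card_Z_pos by (auto simp: degree_rad)
  have poly_\<phi>: "poly (geom (\<phi> h)) \<alpha> = poly (geom u) \<alpha> * poly (geom h) \<alpha>" if "\<alpha> \<in> Z" for h \<alpha>
    by (simp add: \<phi>_def geom_add geom_diff poly_mod_rad[OF that] geom_mult)
  have chi'_\<phi>: "chi' (\<phi> h) = chi' u * chi' h" for h
    unfolding chi'_mult[symmetric] by (rule chi'_cong) (simp add: poly_\<phi> geom_mult)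
  have inj: "inj_on \<phi> T"
  proof (rule inj_onI)
    fix g h assume eq: "\<phi> g = \<phi> h"
    have "poly (geom g) \<alpha> = poly (geom h) \<alpha>" if "\<alpha> \<in> Z" for \<alpha>
    proof -
      have "poly (geom u) \<alpha> \<noteq> 0" using u(1) that by (auto simp: chi'_eq_0_iff)
      moreover have "poly (geom (\<phi> g)) \<alpha> = poly (geom (\<phi> h)) \<alpha>" by (simp only: eq)
      ultimately show ?thesis using poly_\<phi>[OF that] by simp
    qed
    then have rad: "rad dvd g - h" by (intro rad_dvd) (simp add: geom_diff)
    then have "rad dvd u * g - u * h" by (metis dvd_mult right_diff_distrib)
    then have "g mod rad = h mod rad" "(u * g) mod rad = (u * h) mod rad"
      using rad by (simp_all add: mod_eq_dvd_iff)
    then show "g = h" using eq by (simp add: \<phi>_def)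
  qed
  have "\<phi> ` T \<subseteq> T"
    unfolding \<phi>_def using deg_mod by (auto intro!: closed degree_diff_less)
  then have "bij_betw \<phi> T T"
    using inj T by (simp add: bij_betw_def endo_inj_surj)
  then have "(\<Sum>h\<in>T. chi' h) = (\<Sum>h\<in>T. chi' (\<phi> h))"
    by (rule sum.reindex_bij_betw[symmetric])
  also have "\<dots> = chi' u * (\<Sum>h\<in>T. chi' h)" by (simp add: chi'_\<phi> sum_distrib_left)
  finally show ?thesis using u(2) by simp
qed

lemma sum_monics_chi'_eq_0: "card Z \<le> d \<Longrightarrow> (\<Sum>h\<in>monics d. chi' h) = 0"
  by (intro sum_chi'_eq_0 finite_monics monics_add) auto

text \<open>Scaling multiplies the resultant by a power of a with exponent deg f, which is a
  cube.\<close>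

lemma chi'_smult:
  assumes "a \<noteq> 0" "3 dvd degree f"
  shows "chi' (smult a h) = chi' h"
proof -
  obtain m where m: "degree f = 3 * m" using assms(2) by (auto simp: dvd_def)
  have a: "to_ac a \<in> fixed_field 1" by (simp add: fixed_field_def)
  have "res (smult a h) = to_ac a ^ degree f * res h"
    by (simp add: res_def geom_smult prod_mset.distrib size_A)
  then have "chi' (smult a h) = (csym (to_ac a) ^ 3) ^ m * chi' h"
    using a res_fixed by (simp add: chi'_def cubic_symbol_mult cubic_symbol_power fixed_field_power
        m power_mult del: One_nat_def)
  then show ?thesis using cubic_symbol_cube[OF a] assms(1) by simp
qed

text \<open>By \<open>chi'_smult\<close> the sum over all nonzero polynomials of degree less than
  \<open>card Z\<close> is q - 1 times the sum over the monic ones, and it vanishes by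
  orthogonality. This is the zero of the affine L-series that cancels the Euler factor at
  infinity.\<close>

lemma sum_chi'_small_degree:
  assumes "3 dvd degree f"
  shows "(\<Sum>d<card Z. \<Sum>h\<in>monics d. chi' h) = 0"
proof -
  let ?N = "card Z"
  let ?P = "{h :: 'k poly. degree h < ?N}"
  let ?M = "SIGMA d:{..<?N}. (monics d :: 'k poly set)"
  have finP: "finite ?P"
    by (rule finite_subset[OF _ finite_degree_le[of ?N]]) auto
  have finM: "finite ?M" using finite_monics by auto
  have "Z \<noteq> {}" using card_Z_pos by (metis card.empty less_irrefl)
  then have chi'_0: "chi' 0 = 0" by (auto simp: chi'_eq_0_iff)
  have "(\<Sum>h\<in>?P. chi' h) = 0"
    using finP by (intro sum_chi'_eq_0) (auto intro: degree_add_less)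
  then have "0 = (\<Sum>h\<in>?P - {0}. chi' h)"
    using finP chi'_0 by (subst sum.mono_neutral_left[of ?P]) auto
  also have "\<dots> = (\<Sum>(a, d, h)\<in>(UNIV - {0}) \<times> ?M. chi' (smult a h))"
    by (rule sum.reindex_bij_witness[of _ "\<lambda>(a, d, h). smult a h"
          "\<lambda>h. (lead_coeff h, degree h, smult (inverse (lead_coeff h)) h)"])
      (auto simp: monics_def)
  also have "\<dots> = (\<Sum>a\<in>UNIV - {0 :: 'k}. \<Sum>(d, h)\<in>?M. chi' h)"
    unfolding sum.cartesian_product[symmetric]
    by (intro sum.cong refl) (auto simp: chi'_smult assms)
  also have "\<dots> = of_nat (CARD('k) - 1) * (\<Sum>d<?N. \<Sum>h\<in>monics d. chi' h)"
    using finite_monics by (subst sum.Sigma) (auto simp: card_Diff_singleton)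
  finally show ?thesis using card_gt_1[where 'k = 'k] by simp
qed

section \<open>The L-polynomial and its degree\<close>

definition s :: "nat \<Rightarrow> 'l" where "s d = (\<Sum>h\<in>monics d. chi h)"

lemma s_eq: "s d = csym lc ^ d * (\<Sum>h\<in>monics d. chi' h)"
  unfolding s_def sum_distrib_left by (intro sum.cong) (auto simp: chi_def monics_def)

lemma s_0 [simp]: "s 0 = 1"
  by (simp add: s_eq monics_0 chi'_def)

lemma s_eq_0: "card Z \<le> d \<Longrightarrow> s d = 0"
  by (simp add: s_eq sum_monics_chi'_eq_0)

text \<open>The character at the place at infinity: its n-th power is the term of that point in the
  n-th trace.\<close>

definition \<kappa> :: 'l where "\<kappa> = (if 3 dvd degree f then csym lc else 0)"

text \<open>The L-series $\sum_d$ \<open>s d\<close> $T^d$ of the affine part, times the Euler factor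
  $(1 - \kappa T)^{-1}$ at infinity.\<close>

definition l :: "nat \<Rightarrow> 'l" where "l i = (\<Sum>j\<le>i. s j * \<kappa> ^ (i - j))"

lemma l_0: "l 0 = 1"
  by (simp add: l_def)

text \<open>If 3 does not divide deg f, then g = \<open>card Z - 1\<close> and the sums over monics
  vanish from degree \<open>card Z\<close> on. Otherwise g = \<open>card Z - 2\<close>, and
  \<open>l i\<close> is a multiple of the sum over all monics of degree less than
  \<open>card Z\<close>, which vanishes as well.\<close>

lemma l_eq_0:
  assumes "genus (geom f) < i"
  shows "l i = 0"
proof (cases "3 dvd degree f")
  case False
  \<comment> \<open>Here \<kappa> = 0, and 0^0 = 1 leaves the term j = i.\<close>
  then have "l i = (\<Sum>j\<le>i. if j = i then s i else 0)"
    unfolding l_def by (intro sum.cong) (auto simp: \<kappa>_def)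
  also have "\<dots> = 0" using s_eq_0 genus_f False assms by simp
  finally show ?thesis .
next
  case True
  have "l i = (\<Sum>j\<le>i. csym lc ^ i * (\<Sum>h\<in>monics j. chi' h))"
    unfolding l_def using True
    by (intro sum.cong) (auto simp: \<kappa>_def s_eq simp flip: power_add)
  also have "\<dots> = csym lc ^ i * (\<Sum>j\<le>i. \<Sum>h\<in>monics j. chi' h)" by (simp add: sum_distrib_left)
  also have "(\<Sum>j\<le>i. \<Sum>h\<in>monics j. chi' h) = (\<Sum>j<card Z. \<Sum>h\<in>monics j. chi' h)"
    using genus_f True assms sum_monics_chi'_eq_0
    by (intro sum.mono_neutral_right) auto
  also have "\<dots> = 0" using sum_chi'_small_degree True .
  finally show ?thesis by simp
qed

end

section \<open>Logarithmic derivatives and power sums\<close>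

text \<open>\<open>S\<close> is X F'/F, multiplied out so that no inverse of \<open>F\<close> is
  involved. In coefficients (\<open>log_deriv_iff\<close>) these are Newton's identities.\<close>

definition log_deriv :: "'a::comm_ring_1 fps \<Rightarrow> 'a fps \<Rightarrow> bool" where
  "log_deriv F S \<longleftrightarrow> fps_X * fps_deriv F = F * S"

lemma log_deriv_mult:
  assumes "log_deriv F S" "log_deriv G T"
  shows "log_deriv (F * G) (S + T)"
proof -
  have "fps_X * fps_deriv (F * G) = (fps_X * fps_deriv F) * G + F * (fps_X * fps_deriv G)"
    by (simp add: algebra_simps)
  also have "\<dots> = (F * G) * (S + T)"
    using assms by (simp add: log_deriv_def algebra_simps)
  finally show ?thesis by (simp add: log_deriv_def)
qed

lemma log_deriv_1: "log_deriv 1 0"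
  by (simp add: log_deriv_def)

lemma log_deriv_iff:
  assumes "S 0 = 0"
  shows "log_deriv (Abs_fps F) (Abs_fps S) \<longleftrightarrow>
    (\<forall>n. of_nat n * F n = (\<Sum>k\<in>{1..n}. S k * F (n - k)))"
proof -
  have "(\<Sum>i\<in>{0..n}. F i * S (n - i)) = (\<Sum>k\<in>{1..n}. S k * F (n - k))" for n
  proof -
    have "(\<Sum>i\<in>{0..n}. F i * S (n - i)) = (\<Sum>k\<in>{0..n}. S k * F (n - k))"
      by (rule sum.reindex_bij_witness[of _ "\<lambda>k. n - k" "\<lambda>k. n - k"]) (auto simp: mult.commute)
    also have "\<dots> = (\<Sum>k\<in>{1..n}. S k * F (n - k))"
      using assms by (intro sum.mono_neutral_right) (auto simp: not_le)
    finally show ?thesis .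
  qed
  moreover have "(fps_X * fps_deriv (Abs_fps F)) $ n = of_nat n * F n" for n
    by (cases n) simp_all
  ultimately show ?thesis
    by (simp add: log_deriv_def fps_eq_iff fps_mult_nth)
qed

text \<open>The recursion determines n times the n-th coefficient; characteristic 0 permits the
  division by n.\<close>

lemma log_deriv_unique:
  fixes F :: "'a::{idom, ring_char_0} fps"
  assumes "log_deriv F S" "log_deriv G S" "S $ 0 = 0" "F $ 0 = G $ 0"
  shows "F = G"
proof -
  have rec: "of_nat n * H $ n = (\<Sum>k\<in>{1..n}. S $ k * H $ (n - k))" if "log_deriv H S" for H n
    using log_deriv_iff[of "fps_nth S" "fps_nth H"] that assms(3) by (simp add: fps_nth_inverse)
  have "F $ n = G $ n" for n
  proof (induction n rule: less_induct)
    case (less n)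
    show ?case
    proof (cases "n = 0")
      case False
      have "of_nat n * F $ n = of_nat n * G $ n"
        unfolding rec[OF assms(1)] rec[OF assms(2)] using less False by (intro sum.cong) auto
      then show ?thesis using False by simp
    qed (use assms(4) in simp)
  qed
  then show ?thesis by (simp add: fps_eq_iff)
qed

lemma log_deriv_linear:
  "log_deriv (1 - fps_const a * fps_X) (Abs_fps (\<lambda>n. if n = 0 then 0 else - (a ^ n)))"
proof -
  have F: "1 - fps_const a * fps_X = Abs_fps (\<lambda>n. if n = 0 then 1 else if n = 1 then - a else 0)"
    by (rule fps_ext) (auto simp: fps_eq_iff)
  have "of_nat n * (if n = 0 then 1 else if n = 1 then - a else 0) =
      (\<Sum>k\<in>{1..n}. (if k = 0 then 0 else - (a ^ k)) *
         (if n - k = 0 then 1 else if n - k = 1 then - a else 0))" for n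
  proof -
    have "(\<Sum>k\<in>{1..n}. (if k = 0 then 0 else - (a ^ k)) *
         (if n - k = 0 then 1 else if n - k = 1 then - a else 0)) =
      (\<Sum>k\<in>{1..n}. (if k = n then - (a ^ n) else 0) + (if k = n - 1 then a ^ n else 0))"
    proof (intro sum.cong refl)
      fix k assume k: "k \<in> {1..n}"
      consider "k = n" | "k = n - 1" "k \<noteq> n" | "k < n - 1" using k by force
      then show "(if k = 0 then 0 else - (a ^ k)) *
         (if n - k = 0 then 1 else if n - k = 1 then - a else 0) =
         (if k = n then - (a ^ n) else 0) + (if k = n - 1 then a ^ n else 0)"
        using k by cases (auto simp: power_Suc2[symmetric] simp del: power_Suc split: nat.splits)
    qed
    also have "\<dots> = of_nat n * (if n = 0 then 1 else if n = 1 then - a else 0)"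
      by (simp add: sum.distrib) arith
    finally show ?thesis by simp
  qed
  then show ?thesis unfolding F by (subst log_deriv_iff) auto
qed

lemma log_deriv_geometric:
  "log_deriv (Abs_fps (\<lambda>n. a ^ n)) (Abs_fps (\<lambda>n. if n = 0 then 0 else a ^ n))"
  by (subst log_deriv_iff) (auto simp flip: power_add)

lemma log_deriv_prod_mset:
  "log_deriv (\<Prod>a\<in>#M. 1 - fps_const a * fps_X)
    (Abs_fps (\<lambda>n. if n = 0 then 0 else - (\<Sum>a\<in>#M. a ^ n)))"
proof (induction M)
  case empty
  have "Abs_fps (\<lambda>n. if n = 0 then 0 else - (\<Sum>a\<in>#{#}. a ^ n)) = (0 :: 'a fps)"
    by (simp add: fps_eq_iff)
  then show ?case using log_deriv_1 by simp
next
  case (add a M)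
  have "Abs_fps (\<lambda>n. if n = 0 then 0 else - (a ^ n)) +
      Abs_fps (\<lambda>n. if n = 0 then 0 else - (\<Sum>a\<in>#M. a ^ n)) =
      Abs_fps (\<lambda>n. if n = 0 then 0 else - (\<Sum>a\<in>#add_mset a M. a ^ n))"
    by (simp add: fps_eq_iff)
  then show ?case using log_deriv_mult[OF log_deriv_linear[of a] add] by simp
qed

text \<open>The roots are taken of the reversal with respect to g rather than to the actual degree,
  so that a drop in degree shows up as roots 0, which do not affect the power sums for n \<ge>
  1.\<close>

lemma multiset_of_log_deriv:
  fixes l t :: "nat \<Rightarrow> 'l::alg_closed_field"
  assumes l: "l 0 = 1" "\<And>i. g < i \<Longrightarrow> l i = 0"
    and ld: "log_deriv (Abs_fps l) (Abs_fps (\<lambda>n. if n = 0 then 0 else - t n))"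
  obtains M where "size M = g" "\<And>n. n \<ge> 1 \<Longrightarrow> (\<Sum>a\<in>#M. a ^ n) = t n"
    "(\<Prod>a\<in>#M. [:- a, 1:]) = (\<Sum>i\<le>g. monom (l i) (g - i))"
proof -
  define p where "p = (\<Sum>i\<le>g. monom (l i) (g - i))"
  have coeff_p: "coeff p k = (if k \<le> g then l (g - k) else 0)" for k
  proof -
    have "coeff p k = (\<Sum>i\<le>g. if i = g - k \<and> k \<le> g then l i else 0)"
      unfolding p_def coeff_sum by (intro sum.cong) auto
    then show ?thesis by (cases "k \<le> g") auto
  qed
  have deg: "degree p = g"
  proof (rule antisym)
    show "degree p \<le> g" by (rule degree_le) (auto simp: coeff_p)
    show "g \<le> degree p" by (rule le_degree) (auto simp: coeff_p l)
  qed
  have lead: "lead_coeff p = 1" by (simp add: deg coeff_p l)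
  then have "p \<noteq> 0" by auto
  define M where "M = proots p"
  have "p = smult (lead_coeff p) (\<Prod>a\<in>#M. [:- a, 1:])"
    unfolding M_def using \<open>p \<noteq> 0\<close> by (rule alg_closed_factorization_proots)
  then have M2: "p = (\<Prod>a\<in>#M. [:- a, 1:])" by (simp only: lead smult_1_left)
  have M1: "size M = g"
    unfolding M_def deg[symmetric] using \<open>p \<noteq> 0\<close> by (rule alg_closed_factorization_proots)
  note M = M1 M2
  have "fps_of_poly (reflect_poly p) = Abs_fps l"
    by (rule fps_ext) (auto simp: coeff_reflect_poly deg coeff_p l)
  moreover have "fps_of_poly (reflect_poly (\<Prod>a\<in>#M. [:- a, 1:])) = (\<Prod>a\<in>#M. 1 - fps_const a * fps_X)"
  proof (induction M)
    case (add a M)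
    have "reflect_poly [:- a, 1:] = [:1, - a:]" by (simp add: reflect_poly_def)
    moreover have "fps_of_poly [:1, - a:] = 1 - fps_const a * fps_X"
      by (auto simp: fps_eq_iff coeff_pCons split: nat.split)
    ultimately show ?case using add
      by (simp add: reflect_poly_mult fps_of_poly_mult del: mult_pCons_left)
  qed simp
  ultimately have prod: "(\<Prod>a\<in>#M. 1 - fps_const a * fps_X) = Abs_fps l"
    by (simp only: M(2)[symmetric])
  have eq: "Abs_fps l * Abs_fps (\<lambda>n. if n = 0 then 0 else - (\<Sum>a\<in>#M. a ^ n)) =
      Abs_fps l * Abs_fps (\<lambda>n. if n = 0 then 0 else - t n)"
    using ld log_deriv_prod_mset[of M] unfolding prod log_deriv_def by (simp only:)
  have "Abs_fps l \<noteq> 0"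
  proof
    assume "Abs_fps l = 0"
    then have "Abs_fps l $ 0 = 0" by (simp only: fps_zero_nth)
    then show False using l(1) by simp
  qed
  from mult_left_cancel[OF this, THEN iffD1, OF eq]
  have "Abs_fps (\<lambda>n. if n = 0 then 0 else - (\<Sum>a\<in>#M. a ^ n)) $ n =
      Abs_fps (\<lambda>n. if n = 0 then 0 else - t n) $ n" for n
    by (simp only:)
  note fpsn = this
  have "(\<Sum>a\<in>#M. a ^ n) = t n" if "n \<ge> 1" for n
    using that fpsn[of n] by simp
  then show ?thesis using M(1) M(2)[symmetric] unfolding p_def by (intro that[of M])
qed

text \<open>By linearity every polynomial has the same sum over both multisets; one that vanishes at
  all their elements except b reads off the multiplicity of b, as the characteristic is 0.\<close>

lemma multiset_eq_if_power_sums_eq: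
  fixes M N :: "'l::field_char_0 multiset"
  assumes size: "size M = size N"
    and sums: "\<And>n. n \<ge> 1 \<Longrightarrow> (\<Sum>a\<in>#M. a ^ n) = (\<Sum>a\<in>#N. a ^ n)"
  shows "M = N"
proof -
  have poly_sum: "(\<Sum>a\<in>#K. poly p a) = (\<Sum>i\<le>degree p. coeff p i * (\<Sum>a\<in>#K. a ^ i))"
    for K :: "'l multiset" and p
    by (induction K) (simp_all add: poly_altdef sum.distrib algebra_simps)
  have sum0: "(\<Sum>a\<in>#M. a ^ i) = (\<Sum>a\<in>#N. a ^ i)" for i
    using sums[of i] size by (cases "i = 0") auto
  have eq: "(\<Sum>a\<in>#M. poly p a) = (\<Sum>a\<in>#N. poly p a)" for p
    unfolding poly_sum sum0 ..
  show ?thesis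
  proof (rule multiset_eqI)
    fix b
    define p where "p = (\<Prod>x\<in>set_mset M \<union> set_mset N - {b}. [:- x, 1:])"
    have nz: "poly p b \<noteq> 0" by (auto simp: p_def poly_prod prod_zero_iff)
    have "(\<Sum>a\<in>#K. poly p a) = of_nat (count K b) * poly p b"
      if "set_mset K \<subseteq> set_mset M \<union> set_mset N" for K
      using that
    proof (induction K)
      case (add x K)
      have "poly p x = 0" if "x \<noteq> b"
        using that add.prems unfolding p_def poly_prod by (intro prod_zero) auto
      then show ?case using add by (auto simp: algebra_simps)
    qed simp
    from this[of M] this[of N] have "of_nat (count M b) * poly p b = of_nat (count N b) * poly p b"
      using eq[of p] by auto
    then show "count M b = count N b" using nz by simp
  qed
qed

section \<open>Frobenius eigenvalues from the L-polynomial\<close>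

context cubic_cover
begin

lemma log_deriv_s: "log_deriv (Abs_fps s) (Abs_fps (\<lambda>n. if n = 0 then 0 else
    \<Sum>a\<in>fixed_field n. cubic_symbol r \<rho> n (poly (geom f) a)))"
proof (subst log_deriv_iff; safe?)
  fix n
  have "of_nat n * s n = (\<Sum>k\<in>{1..n}. (\<Sum>a\<in>fixed_field k. chi (norm_poly k a)) * s (n - k))"
    unfolding s_def by (rule euler_log_derivative) (rule chi_mult)
  also have "\<dots> = (\<Sum>k\<in>{1..n}. (if k = 0 then 0 else
      \<Sum>a\<in>fixed_field k. cubic_symbol r \<rho> k (poly (geom f) a)) * s (n - k))"
    by (intro sum.cong refl arg_cong2[where f = "(*)"]) (auto simp: chi_norm_poly)
  finally show "of_nat n * s n = \<dots>" .
qed simp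

lemma frobenius_trace_eq:
  assumes "n > 0"
  shows "frobenius_trace r \<rho> f n =
    - ((\<Sum>a\<in>fixed_field n. cubic_symbol r \<rho> n (poly (geom f) a)) + \<kappa> ^ n)"
proof -
  have P1: "P1_points n = insert None (Some ` (fixed_field n :: 'k alg_closure set))"
    by (simp add: P1_points_def fixed_field_def frob_def)
  have "(\<Prod>i<n. frob i lc) = lc ^ n" by simp
  then have "cubic_symbol r \<rho> n lc = csym lc ^ n"
    using cubic_symbol_norm[OF assms, of lc] cubic_symbol_power[OF lc_fixed, of 1 n] by simp
  then have "cubic_symbol r \<rho> n (eval_P1 (geom f) None) = \<kappa> ^ n"
    using assms by (simp add: eval_P1_def \<kappa>_def coeff_map_poly zero_power)
  then show ?thesis
    unfolding frobenius_trace_def P1 using finite_fixed_field[OF assms, where 'k = 'k]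
    by (simp add: sum.reindex eval_P1_def add.commute)
qed

lemma log_deriv_l:
  "log_deriv (Abs_fps l) (Abs_fps (\<lambda>n. if n = 0 then 0 else - frobenius_trace r \<rho> f n))"
proof -
  have "Abs_fps l = Abs_fps s * Abs_fps (\<lambda>n. \<kappa> ^ n)"
    by (simp add: fps_eq_iff fps_mult_nth l_def atLeast0AtMost)
  moreover have "Abs_fps (\<lambda>n. if n = 0 then 0 else - frobenius_trace r \<rho> f n) =
      Abs_fps (\<lambda>n. if n = 0 then 0 else
        \<Sum>a\<in>fixed_field n. cubic_symbol r \<rho> n (poly (geom f) a)) +
      Abs_fps (\<lambda>n. if n = 0 then 0 else \<kappa> ^ n)"
    by (simp add: fps_eq_iff frobenius_trace_eq)
  ultimately show ?thesis
    using log_deriv_mult[OF log_deriv_s log_deriv_geometric[of \<kappa>]] by simp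
qed

lemma ch_rho_eq:
  "ch_rho r \<rho> f = (\<Sum>i\<le>genus (geom f). monom (l i) (genus (geom f) - i))"
proof -
  obtain M where M: "size M = genus (geom f)"
    "\<And>n. n \<ge> 1 \<Longrightarrow> (\<Sum>a\<in>#M. a ^ n) = frobenius_trace r \<rho> f n"
    "(\<Prod>a\<in>#M. [:- a, 1:]) = (\<Sum>i\<le>genus (geom f). monom (l i) (genus (geom f) - i))"
    using multiset_of_log_deriv[OF l_0 l_eq_0 log_deriv_l] by blast
  have "frobenius_eigenvalues r \<rho> f = M"
    unfolding frobenius_eigenvalues_def
  proof (rule the_equality)
    fix N assume "size N = genus (geom f) \<and>
      (\<forall>n\<ge>1. (\<Sum>a\<in>#N. a ^ n) = frobenius_trace r \<rho> f n)"
    then show "N = M" using M(1,2) by (intro multiset_eq_if_power_sums_eq) auto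
  qed (use M in blast)
  then show ?thesis unfolding ch_rho_def using M(3) by simp
qed

end

section \<open>Cycles of a permutation\<close>

lemma funpow_fixed_iff:
  assumes "permutation \<sigma>"
  shows "(\<sigma> ^^ n) x = x \<longleftrightarrow> card (orbit \<sigma> x) dvd n"
proof -
  have x: "x \<in> orbit \<sigma> x" using assms by (rule permutation_self_in_orbit)
  define m where "m = funpow_dist1 \<sigma> x x"
  have m: "(\<sigma> ^^ m) x = x" unfolding m_def using x by (rule funpow_dist1_prop)
  have "card (orbit \<sigma> x) = m"
    using orbit_conv_funpow_dist1[OF x] inj_on_funpow_dist1[OF x]
    by (simp add: card_image m_def del: atLeast0LessThan)
  moreover have "(\<sigma> ^^ n) x = x \<longleftrightarrow> m dvd n"
  proof
    assume "(\<sigma> ^^ n) x = x"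
    then have "(\<sigma> ^^ (n mod m)) x = x" using funpow_mod_eq[OF m, of n] by simp
    moreover have "n mod m < m" by (simp add: m_def)
    ultimately have "n mod m = 0"
      using funpow_dist1_least[of "n mod m" \<sigma> x x] unfolding m_def[symmetric] by blast
    then show "m dvd n" by auto
  next
    assume "m dvd n"
    then show "(\<sigma> ^^ n) x = x" using funpow_mod_eq[OF m, of n] by simp
  qed
  ultimately show ?thesis by simp
qed

text \<open>By \<open>funpow_fixed_iff\<close> a cycle consists of fixed points of the n-th iterate
  entirely or not at all, according to whether its length divides n.\<close>

lemma card_fixed_points:
  assumes R: "\<sigma> permutes R" "finite R"
  shows "card {x\<in>R. (\<sigma> ^^ n) x = x} = (\<Sum>C\<in>orbit \<sigma> ` R. if card C dvd n then card C else 0)"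
proof -
  have perm: "permutation \<sigma>" using R by (auto simp: permutation_permutes)
  have fib: "{x\<in>R. orbit \<sigma> x = C} = C" if C: "C \<in> orbit \<sigma> ` R" for C
  proof -
    from C obtain y where y: "y \<in> R" "C = orbit \<sigma> y" by blast
    have "x \<in> R" "orbit \<sigma> x = C" if "x \<in> C" for x
      using that y permutes_orbit_subset[OF R(1) y(1)] orbit_cyclic_eq3[OF cyclic_on_orbit[OF R]]
      by auto
    then show ?thesis using permutation_self_in_orbit[OF perm] by blast
  qed
  have "card {x\<in>R. (\<sigma> ^^ n) x = x} = (\<Sum>x\<in>R. if card (orbit \<sigma> x) dvd n then 1 else 0)"
    using R(2) by (simp add: funpow_fixed_iff[OF perm] sum.If_cases Int_def)
  also have "\<dots> = (\<Sum>C\<in>orbit \<sigma> ` R. \<Sum>x | x \<in> R \<and> orbit \<sigma> x = C.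
      if card (orbit \<sigma> x) dvd n then 1 else 0)"
    using R(2) by (rule sum.image_gen)
  also have "\<dots> = (\<Sum>C\<in>orbit \<sigma> ` R. \<Sum>x\<in>C. if card C dvd n then 1 else 0)"
  proof (rule sum.cong[OF refl])
    fix C assume C: "C \<in> orbit \<sigma> ` R"
    have "(\<Sum>x | x \<in> R \<and> orbit \<sigma> x = C. if card (orbit \<sigma> x) dvd n then 1 else 0) =
        (\<Sum>x | x \<in> R \<and> orbit \<sigma> x = C. if card C dvd n then 1 else (0::nat))"
      by (intro sum.cong) auto
    then show "(\<Sum>x | x \<in> R \<and> orbit \<sigma> x = C. if card (orbit \<sigma> x) dvd n then 1 else 0) =
        (\<Sum>x\<in>C. if card C dvd n then 1 else (0::nat))"
      unfolding fib[OF C] .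
  qed
  also have "\<dots> = (\<Sum>C\<in>orbit \<sigma> ` R. if card C dvd n then card C else 0)"
    by (intro sum.cong) auto
  finally show ?thesis .
qed

lemma sum_card_orbits:
  assumes "\<sigma> permutes R" "finite R"
  shows "(\<Sum>C\<in>orbit \<sigma> ` R. card C) = card R"
  using card_fixed_points[OF assms, of 0] by simp

lemma card_orbit_pos:
  assumes "\<sigma> permutes R" "finite R" "C \<in> orbit \<sigma> ` R"
  shows "card C > 0"
proof -
  obtain x where x: "x \<in> R" "C = orbit \<sigma> x" using assms(3) by blast
  then show ?thesis
    using permutes_orbit_subset[OF assms(1) x(1)] orbit_nonempty[of \<sigma> x]
      finite_subset[OF _ assms(2)] by (simp add: card_gt_0_iff)
qed

text \<open>X F'/F is -c times the sum of the X^(c j) with j > 0; multiplication by 1 - X^c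
  telescopes it to -c X^c.\<close>

lemma log_deriv_one_minus_power:
  assumes "c > 0"
  shows "log_deriv (1 - fps_X ^ c)
    (Abs_fps (\<lambda>n. if n = 0 then 0 else - of_nat (if c dvd n then c else 0)) :: 'a::comm_ring_1 fps)"
    (is "log_deriv _ ?S")
proof -
  have "?S $ n - (if n < c then 0 else ?S $ (n - c)) = (if n = c then - of_nat c else 0)" for n
  proof -
    consider "n < c" | "n = c" | "n > c" by linarith
    then show ?thesis
    proof cases
      case 1
      then show ?thesis using assms by (auto dest: dvd_imp_le)
    next
      case 3
      then have "c dvd n \<longleftrightarrow> c dvd n - c" by (simp add: dvd_minus_self)
      then show ?thesis using 3 assms by auto
    qed (use assms in auto)
  qed
  then have "(1 - fps_X ^ c) * ?S = - (of_nat c * fps_X ^ c)"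
    by (auto simp: fps_eq_iff left_diff_distrib fps_X_power_mult_nth fps_mult_of_nat_nth)
  also have "of_nat c * fps_X ^ c = fps_X * (of_nat c * fps_X ^ (c - 1) :: 'a fps)"
    using assms by (simp add: power_eq_if mult.left_commute)
  finally show ?thesis
    by (simp add: log_deriv_def fps_deriv_power fps_of_nat)
qed

lemma log_deriv_prod:
  assumes "finite I" "\<And>i. i \<in> I \<Longrightarrow> log_deriv (F i) (S i)"
  shows "log_deriv (\<Prod>i\<in>I. F i) (\<Sum>i\<in>I. S i)"
  using assms by (induction I rule: finite_induct) (auto intro: log_deriv_mult log_deriv_1)

lemma log_deriv_cycles:
  assumes "\<sigma> permutes R" "finite R"
  shows "log_deriv (\<Prod>C\<in>orbit \<sigma> ` R. 1 - fps_X ^ card C)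
    (Abs_fps (\<lambda>n. if n = 0 then 0 else - of_nat (card {x\<in>R. (\<sigma> ^^ n) x = x})) ::
      'a::comm_ring_1 fps)"
proof -
  have fin: "finite (orbit \<sigma> ` R)" using assms(2) by simp
  note pos = card_orbit_pos[OF assms]
  let ?S = "\<lambda>C. Abs_fps (\<lambda>n. if n = 0 then 0 else - of_nat (if card C dvd n then card C else 0)) :: 'a fps"
  have "(\<Sum>C\<in>orbit \<sigma> ` R. ?S C) $ n =
      (if n = 0 then 0 else - of_nat (card {x\<in>R. (\<sigma> ^^ n) x = x}))" for n
    by (simp add: fps_sum_nth card_fixed_points[OF assms] sum_negf)
  then have "(\<Sum>C\<in>orbit \<sigma> ` R. ?S C) =
      Abs_fps (\<lambda>n. if n = 0 then 0 else - of_nat (card {x\<in>R. (\<sigma> ^^ n) x = x}))"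
    by (simp add: fps_eq_iff)
  moreover have "log_deriv (\<Prod>C\<in>orbit \<sigma> ` R. 1 - fps_X ^ card C) (\<Sum>C\<in>orbit \<sigma> ` R. ?S C)"
    using fin pos by (intro log_deriv_prod log_deriv_one_minus_power)
  ultimately show ?thesis by simp
qed

lemma prod_cycle_count:
  fixes h :: "nat \<Rightarrow> 'a::comm_monoid_mult"
  assumes "\<sigma> permutes R" "finite R"
  shows "(\<Prod>C\<in>orbit \<sigma> ` R. h (card C)) = (\<Prod>i = 1..card R. h i ^ cycle_count R \<sigma> i)"
proof -
  have fin: "finite (orbit \<sigma> ` R)" using assms(2) by simp
  have "card C \<in> {1..card R}" if "C \<in> orbit \<sigma> ` R" for C
  proof -
    have "C \<subseteq> R" using that permutes_orbit_subset[OF assms(1)] by auto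
    then show ?thesis
      using card_mono[OF assms(2)] card_orbit_pos[OF assms that] by (simp add: Suc_le_eq)
  qed
  then have "(\<Prod>C\<in>orbit \<sigma> ` R. h (card C)) =
      (\<Prod>i = 1..card R. \<Prod>C | C \<in> orbit \<sigma> ` R \<and> card C = i. h (card C))"
    using fin by (intro prod.group[symmetric]) auto
  also have "\<dots> = (\<Prod>i = 1..card R. h i ^ cycle_count R \<sigma> i)"
  proof (rule prod.cong[OF refl])
    fix i
    have "{C. C \<in> orbit \<sigma> ` R \<and> card C = i} = {C. (\<exists>P\<in>R. C = orbit \<sigma> P) \<and> card C = i}" by auto
    then show "(\<Prod>C | C \<in> orbit \<sigma> ` R \<and> card C = i. h (card C)) = h i ^ cycle_count R \<sigma> i"
      by (simp add: cycle_count_def)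
  qed
  finally show ?thesis .
qed

lemma of_int_3_eq_0: "3 dvd k \<Longrightarrow> of_int k = (0 :: 3)"
proof -
  have 3: "(3 :: 3) = 0" by simp
  assume "3 dvd k"
  then obtain j where "k = 3 * j" by (auto simp: dvd_def)
  then show ?thesis by (simp only: of_int_mult of_int_numeral 3 mult_zero_left)
qed

section \<open>Reduction modulo $1 - \rho$\<close>

context cubic_cover
begin

lemma \<rho>_square: "\<rho> * \<rho> = - 1 - \<rho>"
  using cube_root_minus_1[OF \<rho>] by (simp add: power2_eq_square algebra_simps eq_neg_iff_add_eq_0)

lemma eisenstein_independent:
  assumes "of_int a + of_int b * \<rho> = 0"
  shows "a = 0 \<and> b = 0"
proof -
  \<comment> \<open>The second factor is the conjugate a + b \<rho>^2, so the product is the norm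
    a^2 - a b + b^2, and four times the norm is (2a - b)^2 + 3 b^2.\<close>
  have "(of_int a + of_int b * \<rho>) * (of_int a - of_int b - of_int b * \<rho>) =
      of_int a * of_int a - of_int a * of_int b - of_int b * of_int b * (\<rho> + \<rho> * \<rho>)"
    by (simp add: algebra_simps)
  also have "\<dots> = of_int (a * a - a * b + b * b)" by (simp add: \<rho>_square)
  finally have "a * a - a * b + b * b = 0" using assms by (metis mult_zero_left of_int_eq_0_iff)
  then have "(2 * a - b)\<^sup>2 + 3 * b\<^sup>2 = 0" by (simp add: power2_eq_square algebra_simps)
  then have "b\<^sup>2 = 0" "(2 * a - b)\<^sup>2 = 0"
    using zero_le_power2[of b] zero_le_power2[of "2 * a - b"] by linarith+
  then show ?thesis by simp
qed

text \<open>\<rho> is 1 modulo 1 - \<rho>. For uniqueness, comparing coordinates with respect to 1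
  and \<rho> gives m = a + b - 3 y, so m is determined modulo 3.\<close>

lemma reduce_eq: "reduce \<rho> (of_int a + of_int b * \<rho>) = of_int (a + b)"
  unfolding reduce_def
proof (rule the_equality)
  have "of_int a + of_int b * \<rho> = of_int (a + b) + (1 - \<rho>) * (of_int (- b) + of_int 0 * \<rho>)"
    by (simp add: algebra_simps)
  then show "\<exists>m w. (of_int (a + b) :: 3) = of_int m \<and> w \<in> eisenstein \<rho> \<and>
      of_int a + of_int b * \<rho> = of_int m + (1 - \<rho>) * w"
    unfolding eisenstein_def by blast
next
  fix c :: 3
  assume "\<exists>m w. c = of_int m \<and> w \<in> eisenstein \<rho> \<and>
      of_int a + of_int b * \<rho> = of_int m + (1 - \<rho>) * w"
  then obtain m x y where m: "c = of_int m"
    "of_int a + of_int b * \<rho> = of_int m + (1 - \<rho>) * (of_int x + of_int y * \<rho>)"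
    unfolding eisenstein_def by blast
  have "of_int (a - m - x - y) + of_int (b - 2 * y + x) * \<rho> =
      (of_int a + of_int b * \<rho>) - (of_int m + (of_int x + of_int y * \<rho> - of_int x * \<rho>
        - of_int y * (- 1 - \<rho>)))"
    by (simp add: algebra_simps)
  also have "\<dots> = (of_int a + of_int b * \<rho>) - (of_int m + (1 - \<rho>) * (of_int x + of_int y * \<rho>))"
    unfolding \<rho>_square[symmetric] by (simp add: algebra_simps)
  also have "\<dots> = 0" using m(2) by simp
  finally have "a - m - x - y = 0" "b - 2 * y + x = 0" using eisenstein_independent by blast+
  then have "m = a + b - 3 * y" by linarith
  then have "of_int m = (of_int (a + b) - of_int (3 * y) :: 3)" by (simp only: of_int_diff)
  then show "c = of_int (a + b)" using m(1) of_int_3_eq_0[of "3 * y"] by simp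
qed

lemma eisensteinI: "of_int a + of_int b * \<rho> \<in> eisenstein \<rho>"
  unfolding eisenstein_def by blast

lemma reduce_add:
  assumes "x \<in> eisenstein \<rho>" "y \<in> eisenstein \<rho>"
  shows "x + y \<in> eisenstein \<rho>" "reduce \<rho> (x + y) = reduce \<rho> x + reduce \<rho> y"
proof -
  obtain a b c d where xy: "x = of_int a + of_int b * \<rho>" "y = of_int c + of_int d * \<rho>"
    using assms unfolding eisenstein_def by blast
  have eq: "x + y = of_int (a + c) + of_int (b + d) * \<rho>" by (simp add: xy algebra_simps)
  show "x + y \<in> eisenstein \<rho>" unfolding eq by (rule eisensteinI)
  show "reduce \<rho> (x + y) = reduce \<rho> x + reduce \<rho> y"
    unfolding eq unfolding xy reduce_eq by simp
qed

lemma reduce_mult: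
  assumes "x \<in> eisenstein \<rho>" "y \<in> eisenstein \<rho>"
  shows "x * y \<in> eisenstein \<rho>" "reduce \<rho> (x * y) = reduce \<rho> x * reduce \<rho> y"
proof -
  obtain a b c d where xy: "x = of_int a + of_int b * \<rho>" "y = of_int c + of_int d * \<rho>"
    using assms unfolding eisenstein_def by blast
  have "x * y = of_int a * of_int c + (of_int a * of_int d + of_int b * of_int c) * \<rho> +
      of_int b * of_int d * (\<rho> * \<rho>)" by (simp add: xy algebra_simps)
  also have "\<dots> = of_int (a * c - b * d) + of_int (a * d + b * c - b * d) * \<rho>"
    unfolding \<rho>_square by (simp add: algebra_simps)
  finally have eq: "x * y = of_int (a * c - b * d) + of_int (a * d + b * c - b * d) * \<rho>" .
  show "x * y \<in> eisenstein \<rho>" unfolding eq by (rule eisensteinI)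
  have "a * c - b * d + (a * d + b * c - b * d) = (a + b) * (c + d) - 3 * (b * d)"
    by (simp add: algebra_simps)
  then have eq3: "(of_int (a * c - b * d + (a * d + b * c - b * d)) :: 3) =
      of_int ((a + b) * (c + d))"
    by (simp only: of_int_diff of_int_3_eq_0[OF dvd_triv_left] diff_0_right)
  then show "reduce \<rho> (x * y) = reduce \<rho> x * reduce \<rho> y"
    unfolding eq unfolding xy reduce_eq
    by (simp only: eq3 of_int_mult)
qed

lemma reduce_0_1_\<rho>:
  "0 \<in> eisenstein \<rho>" "reduce \<rho> 0 = 0" "1 \<in> eisenstein \<rho>" "reduce \<rho> 1 = 1"
  "\<rho> \<in> eisenstein \<rho>" "reduce \<rho> \<rho> = 1"
  using eisensteinI[of 0 0] reduce_eq[of 0 0] eisensteinI[of 1 0] reduce_eq[of 1 0]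
    eisensteinI[of 0 1] reduce_eq[of 0 1] by simp_all

lemma reduce_power:
  assumes "x \<in> eisenstein \<rho>"
  shows "x ^ n \<in> eisenstein \<rho> \<and> reduce \<rho> (x ^ n) = reduce \<rho> x ^ n"
  using assms by (induction n) (auto simp: reduce_0_1_\<rho> reduce_mult)

lemma reduce_sum:
  assumes "\<And>i. i \<in> I \<Longrightarrow> h i \<in> eisenstein \<rho>"
  shows "(\<Sum>i\<in>I. h i) \<in> eisenstein \<rho> \<and> reduce \<rho> (\<Sum>i\<in>I. h i) = (\<Sum>i\<in>I. reduce \<rho> (h i))"
  using assms
  by (induction I rule: infinite_finite_induct) (auto simp: reduce_0_1_\<rho> reduce_add)

lemma reduce_cubic_symbol:
  "cubic_symbol r \<rho> n a \<in> eisenstein \<rho>"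
  "reduce \<rho> (cubic_symbol r \<rho> n a) = (if a = 0 then 0 else 1)"
  by (auto simp: cubic_symbol_def reduce_0_1_\<rho> reduce_power)

lemma reduce_chi:
  "chi h \<in> eisenstein \<rho>" "reduce \<rho> (chi h) = (if chi h = 0 then 0 else 1)"
proof -
  note * = reduce_cubic_symbol reduce_power[OF reduce_cubic_symbol(1)]
  show "chi h \<in> eisenstein \<rho>"
    unfolding chi_def chi'_def using * by (intro reduce_mult) auto
  show "reduce \<rho> (chi h) = (if chi h = 0 then 0 else 1)"
    unfolding chi_def chi'_def using * lc_nonzero
    by (subst reduce_mult) (auto simp: cubic_symbol_eq_0_iff)
qed

text \<open>The L-series of the trivial character modulo the radical of \<open>f\<close>.\<close>

definition t :: "nat \<Rightarrow> int" where "t d = (\<Sum>h\<in>monics d. if chi h = 0 then 0 else 1)"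

lemma reduce_s: "s d \<in> eisenstein \<rho>" "reduce \<rho> (s d) = of_int (t d)"
proof -
  have "reduce \<rho> (s d) = (\<Sum>h\<in>monics d. reduce \<rho> (chi h))"
    unfolding s_def by (rule reduce_sum[THEN conjunct2]) (rule reduce_chi)
  then show "reduce \<rho> (s d) = of_int (t d)"
    by (simp add: t_def reduce_chi if_distrib[of of_int] cong: if_cong)
  show "s d \<in> eisenstein \<rho>"
    unfolding s_def by (rule reduce_sum[THEN conjunct1]) (rule reduce_chi)
qed

lemma reduce_\<kappa>: "\<kappa> \<in> eisenstein \<rho>" "reduce \<rho> \<kappa> = (if 3 dvd degree f then 1 else 0)"
  using lc_nonzero by (auto simp: \<kappa>_def reduce_0_1_\<rho> reduce_cubic_symbol)

lemma reduce_l: "l i \<in> eisenstein \<rho>"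
  "reduce \<rho> (l i) = (\<Sum>j\<le>i. of_int (t j) * (if 3 dvd degree f then 1 else 0) ^ (i - j))"
proof -
  have 1: "s j * \<kappa> ^ (i - j) \<in> eisenstein \<rho>" for j
    using reduce_s(1) reduce_power[OF reduce_\<kappa>(1)] by (intro reduce_mult) auto
  show "l i \<in> eisenstein \<rho>" unfolding l_def by (rule reduce_sum[THEN conjunct1]) (rule 1)
  have "reduce \<rho> (l i) = (\<Sum>j\<le>i. reduce \<rho> (s j * \<kappa> ^ (i - j)))"
    unfolding l_def by (rule reduce_sum[THEN conjunct2]) (rule 1)
  also have "\<dots> = (\<Sum>j\<le>i. of_int (t j) * (if 3 dvd degree f then 1 else 0) ^ (i - j))"
    using reduce_power[OF reduce_\<kappa>(1)] reduce_\<kappa>(2) reduce_s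
    by (intro sum.cong refl) (simp add: reduce_mult)
  finally show "reduce \<rho> (l i) =
    (\<Sum>j\<le>i. of_int (t j) * (if 3 dvd degree f then 1 else 0) ^ (i - j))" .
qed

lemma log_deriv_t: "log_deriv (Abs_fps t) (Abs_fps (\<lambda>n. if n = 0 then 0 else
    int (CARD('k) ^ n) - int (card {a\<in>Z. frob n a = a})))"
proof (subst log_deriv_iff; safe?)
  fix n
  have S: "(\<Sum>a\<in>fixed_field k. if chi (norm_poly k a) = 0 then 0 else 1) =
      int (CARD('k) ^ k) - int (card {a\<in>Z. frob k a = a})" if "k > 0" for k
  proof -
    have "(\<Sum>a\<in>fixed_field k. if chi (norm_poly k a) = 0 then 0 else 1) =
        (\<Sum>a\<in>fixed_field k. 1 - (if a \<in> Z then 1 else 0 :: int))"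
      using that by (intro sum.cong refl) (auto simp: chi_norm_poly cubic_symbol_eq_0_iff)
    also have "\<dots> = int (CARD('k) ^ k) - int (card (fixed_field k \<inter> Z))"
      using finite_fixed_field[OF that, where 'k = 'k] card_fixed_field[OF that, where 'k = 'k]
      by (simp add: sum_subtractf sum.If_cases Int_def)
    also have "fixed_field k \<inter> Z = {a\<in>Z. frob k a = a}" by (auto simp: fixed_field_def)
    finally show ?thesis .
  qed
  have "of_nat n * t n = (\<Sum>k\<in>{1..n}.
      (\<Sum>a\<in>fixed_field k. if chi (norm_poly k a) = 0 then 0 else 1) * t (n - k))"
    unfolding t_def by (rule euler_log_derivative) (simp add: chi_mult)
  also have "\<dots> = (\<Sum>k\<in>{1..n}. (if k = 0 then 0 else
      int (CARD('k) ^ k) - int (card {a\<in>Z. frob k a = a})) * t (n - k))"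
    by (intro sum.cong refl arg_cong2[where f = "(*)"]) (subst S; simp)
  finally show "of_nat n * t n = \<dots>" .
qed simp

lemma t_0: "t 0 = 1"
  by (simp add: t_def monics_0 chi_def chi'_def)

end

section \<open>Reduction and reversal of power series\<close>

lemma map_poly_of_int_mult:
  "map_poly of_int (p * q) = (map_poly of_int p * map_poly of_int q :: 'a::comm_ring_1 poly)"
  by (rule poly_eqI) (simp add: coeff_map_poly coeff_mult)

lemma map_poly_of_int_prod:
  "map_poly of_int (\<Prod>i\<in>I. p i) = (\<Prod>i\<in>I. map_poly of_int (p i) :: 'a::comm_ring_1 poly)"
  by (induction I rule: infinite_finite_induct) (simp_all add: map_poly_of_int_mult)

definition fps_of_int :: "int fps \<Rightarrow> 'a::comm_ring_1 fps" where
  "fps_of_int F = Abs_fps (\<lambda>n. of_int (F $ n))"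

lemma fps_of_int_mult: "fps_of_int (F * G) = fps_of_int F * fps_of_int G"
  by (simp add: fps_of_int_def fps_eq_iff fps_mult_nth)

lemma fps_of_int_linear:
  "fps_of_int (1 - fps_const a * fps_X) = 1 - fps_const (of_int a) * fps_X"
  by (simp add: fps_of_int_def fps_eq_iff)

lemma fps_prod_nth_0: "(\<Prod>i\<in>I. F i) $ 0 = (\<Prod>i\<in>I. F i $ 0)"
  for F :: "'i \<Rightarrow> 'a::comm_ring_1 fps"
  by (induction I rule: infinite_finite_induct) simp_all

lemma geometric_fps: "(1 - fps_const a * fps_X) * Abs_fps (\<lambda>n. a ^ n) = (1 :: 'a::comm_ring_1 fps)"
proof (rule fps_ext)
  fix n
  show "((1 - fps_const a * fps_X) * Abs_fps (\<lambda>n. a ^ n)) $ n = (1 :: 'a fps) $ n"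
    by (cases n) (simp_all add: left_diff_distrib mult.assoc)
qed

text \<open>\<open>F\<close> is T^n p(1/T) for a prescribed formal degree n, so that p can be
  recovered from \<open>F\<close> and n even when \<open>F\<close> has degree less than n.\<close>

definition reversed :: "nat \<Rightarrow> 'a::comm_ring_1 poly \<Rightarrow> 'a fps \<Rightarrow> bool" where
  "reversed n p F \<longleftrightarrow> (\<forall>j. coeff p j = (if j \<le> n then F $ (n - j) else 0)) \<and> (\<forall>k>n. F $ k = 0)"

lemma reversed_unique: "reversed n p F \<Longrightarrow> reversed n q F \<Longrightarrow> p = q"
  by (auto simp: reversed_def poly_eq_iff)

lemma reversed_linear:
  assumes "reversed n p F"
  shows "reversed (Suc n) (p * [:- 1, 1:]) (F * (1 - fps_X))"
  unfolding reversed_def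
proof (intro conjI allI impI)
  have F: "(F * (1 - fps_X)) $ k = F $ k - (if k = 0 then 0 else F $ (k - 1))" for k
    by (simp add: right_diff_distrib)
  fix k
  show "(F * (1 - fps_X)) $ k = 0" if "Suc n < k"
    using that assms by (auto simp: F reversed_def)
  have "p * [:- 1, 1:] = pCons 0 p - p" by simp
  then have "coeff (p * [:- 1, 1:]) k = (if k = 0 then 0 else coeff p (k - 1)) - coeff p k"
    by (simp add: coeff_pCons split: nat.split)
  then show "coeff (p * [:- 1, 1:]) k = (if k \<le> Suc n then (F * (1 - fps_X)) $ (Suc n - k) else 0)"
    using assms by (cases k) (auto simp: F reversed_def Suc_diff_le)
qed

text \<open>Computed over \<open>int\<close>, where degrees of products add up, and then mapped to
  the target ring, which may have zero divisors.\<close>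

lemma reversed_prod:
  assumes "finite I" "\<And>i. i \<in> I \<Longrightarrow> c i > 0"
  shows "reversed (\<Sum>i\<in>I. c i) (\<Prod>i\<in>I. monom 1 (c i) - 1 :: 'a::comm_ring_1 poly)
    (fps_of_int (\<Prod>i\<in>I. 1 - fps_X ^ c i))"
proof -
  let ?P = "\<Prod>i\<in>I. 1 - monom 1 (c i) :: int poly"
  have deg: "degree (1 - monom 1 (c i) :: int poly) = c i" if "i \<in> I" for i
  proof (rule antisym)
    show "degree (1 - monom 1 (c i) :: int poly) \<le> c i"
      using assms(2)[OF that] by (intro degree_le) (auto simp: coeff_1)
    show "c i \<le> degree (1 - monom 1 (c i) :: int poly)"
      using assms(2)[OF that] by (intro le_degree) (auto simp: coeff_1)
  qed
  have nz: "1 - monom 1 (c i) \<noteq> (0 :: int poly)" if "i \<in> I" for i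
    using deg[OF that] assms(2)[OF that] by (metis degree_0 less_irrefl)
  have degP: "degree ?P = (\<Sum>i\<in>I. c i)"
    using nz deg by (subst degree_prod_sum_eq) (auto intro: sum.cong)
  have "reflect_poly (1 - monom 1 (c i) :: int poly) = monom 1 (c i) - 1" if "i \<in> I" for i
    using assms(2)[OF that]
    by (intro poly_eqI) (auto simp: coeff_reflect_poly deg[OF that] coeff_1)
  then have refl: "reflect_poly ?P = (\<Prod>i\<in>I. monom 1 (c i) - 1)"
    by (simp add: reflect_poly_prod)
  have "fps_of_poly ?P = (\<Prod>i\<in>I. 1 - fps_X ^ c i)"
    by (simp add: fps_of_poly_prod fps_of_poly_diff fps_of_poly_monom)
  then have F: "(\<Prod>i\<in>I. 1 - fps_X ^ c i) $ k = coeff ?P k" for k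
    by (metis fps_of_poly_nth)
  have map: "(\<Prod>i\<in>I. monom 1 (c i) - 1 :: 'a poly) = map_poly of_int (reflect_poly ?P)"
  proof -
    have "map_poly of_int (monom 1 (c i) - 1 :: int poly) = (monom 1 (c i) - 1 :: 'a poly)" for i
      by (rule poly_eqI) (simp add: coeff_map_poly)
    then show ?thesis by (simp add: refl map_poly_of_int_prod)
  qed
  show ?thesis
    unfolding reversed_def map fps_of_int_def
    by (auto simp: coeff_map_poly coeff_reflect_poly degP F coeff_eq_0)
qed

section \<open>Ramification points and the comparison modulo 3\<close>

context cubic_cover
begin

lemma eval_P1_eq_0_iff:
  "eval_P1 (geom f) a = 0 \<longleftrightarrow> a \<in> Some ` Z \<union> (if 3 dvd degree f then {} else {None})"
  using f_nonzero by (auto simp: eval_P1_def coeff_map_poly split: option.splits)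

lemma card_cube_roots:
  fixes v :: "'k alg_closure"
  shows "card {y. y ^ 3 = v} < 3 \<longleftrightarrow> v = 0"
proof (cases "v = 0")
  case False
  obtain y where y: "y ^ 3 = v" using nth_root_exists[of 3 v] by auto
  let ?r = "to_ac r"
  have r3: "?r ^ 3 = 1" using r(1) by (simp flip: to_ac_power)
  have r2: "?r\<^sup>2 \<noteq> 1" "?r \<noteq> 1" "?r\<^sup>2 \<noteq> ?r"
    using to_ac_r_power_eq_iff[of 2 0] to_ac_r_power_eq_iff[of 1 0] to_ac_r_power_eq_iff[of 2 1]
    by auto
  have "y \<noteq> 0" using y False by auto
  then have "card {y, y * ?r, y * ?r\<^sup>2} = 3" using r2 by auto
  moreover have "{y, y * ?r, y * ?r\<^sup>2} \<subseteq> {y. y ^ 3 = v}"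
  proof -
    have "(?r\<^sup>2) ^ 3 = (?r ^ 3)\<^sup>2" by (simp flip: power_mult)
    then show ?thesis using y r3 by (simp add: power_mult_distrib)
  qed
  moreover have "finite {y. y ^ 3 = v}"
  proof -
    have "cubic v \<noteq> 0" by simp
    then have "finite {y. poly (cubic v) y = 0}" by (rule poly_roots_finite)
    then show ?thesis by (simp add: cubic_def poly_monom)
  qed
  ultimately have "3 \<le> card {y. y ^ 3 = v}" by (metis card_mono)
  then show ?thesis using False by simp
qed simp

lemma ramification_points_eq:
  "ramification_points f = (\<lambda>a. (a, 0)) ` (Some ` Z \<union> (if 3 dvd degree f then {} else {None}))"
proof -
  have fib: "{Q \<in> curve_points f. fst Q = a} = Pair a ` {y. y ^ 3 = eval_P1 (geom f) a}" for a
    by (auto simp: curve_points_def)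
  have "card {Q \<in> curve_points f. fst Q = a} < 3 \<longleftrightarrow> eval_P1 (geom f) a = 0" for a
    unfolding fib by (subst card_image) (auto simp: card_cube_roots inj_on_def)
  then have "ramification_points f = {P \<in> curve_points f. eval_P1 (geom f) (fst P) = 0}"
    unfolding ramification_points_def by blast
  also have "\<dots> = (\<lambda>a. (a, 0)) ` {a. eval_P1 (geom f) a = 0}"
    by (auto simp: curve_points_def)
  also have "{a. eval_P1 (geom f) a = 0} = Some ` Z \<union> (if 3 dvd degree f then {} else {None})"
    using eval_P1_eq_0_iff by blast
  finally show ?thesis .
qed

lemma finite_ramification_points: "finite (ramification_points f)"
  unfolding ramification_points_eq using finite_Z by auto

lemma card_ramification_points: "card (ramification_points f) = genus (geom f) + 2"
proof -
  have "card (ramification_points f) =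
      card (Some ` Z \<union> (if 3 dvd degree f then {} else {None}))"
    unfolding ramification_points_eq by (rule card_image) (simp add: inj_on_def)
  also have "\<dots> = card Z + (if 3 dvd degree f then 0 else 1)"
    using finite_Z by (subst card_Un_disjoint) (auto simp: card_image)
  finally show ?thesis using genus_f by simp
qed

text \<open>\<sigma> is known to be Frobenius on the ramification points only, so the induction also
  keeps the iterates inside that set. The summand 1 is the point at infinity, which Frobenius
  fixes.\<close>

lemma card_fixed_ramification_points:
  assumes "\<sigma> permutes ramification_points f" "\<forall>P\<in>ramification_points f. \<sigma> P = frobenius P"
  shows "card {P \<in> ramification_points f. (\<sigma> ^^ n) P = P} =
    card {a\<in>Z. frob n a = a} + (if 3 dvd degree f then 0 else 1)"
proof -
  have snd: "snd P = 0" if "P \<in> ramification_points f" for P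
    using that by (auto simp: ramification_points_eq)
  have pow: "(\<sigma> ^^ n) P \<in> ramification_points f \<and> (\<sigma> ^^ n) P = (map_option (frob n) (fst P), 0)"
    if P: "P \<in> ramification_points f" for P
  proof (induction n)
    case 0
    show ?case using P snd[OF P] by (cases "fst P") (simp_all add: prod_eq_iff)
  next
    case (Suc n)
    then have "\<sigma> ((\<sigma> ^^ n) P) \<in> ramification_points f"
      using permutes_in_image[OF assms(1)] by blast
    then have "(\<sigma> ^^ Suc n) P \<in> ramification_points f" by simp
    moreover have "(\<sigma> ^^ Suc n) P = frobenius (map_option (frob n) (fst P), 0)"
      using Suc assms(2) by auto
    moreover have "map_option (\<lambda>b. b ^ CARD('k)) (map_option (frob n) (fst P)) =
        map_option (frob (Suc n)) (fst P)"
      by (cases "fst P") (simp_all add: frob_Suc)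
    ultimately show ?case by (simp add: frobenius_def)
  qed
  have "{P \<in> ramification_points f. (\<sigma> ^^ n) P = P} =
      {P \<in> ramification_points f. (map_option (frob n) (fst P), 0) = P}"
    using pow by auto
  also have "\<dots> = (\<lambda>a. (a, 0)) `
      (Some ` {a\<in>Z. frob n a = a} \<union> (if 3 dvd degree f then {} else {None}))"
    by (auto simp: ramification_points_eq)
  finally have "card {P \<in> ramification_points f. (\<sigma> ^^ n) P = P} =
      card (Some ` {a\<in>Z. frob n a = a} \<union> (if 3 dvd degree f then {} else {None}))"
    by (simp add: card_image inj_on_def)
  also have "\<dots> = card {a\<in>Z. frob n a = a} + (if 3 dvd degree f then 0 else 1)"
    using finite_Z by (subst card_Un_disjoint) (auto simp: card_image)
  finally show ?thesis .
qed

text \<open>Both sides have constant term 1 and the same logarithmic derivative: that of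
  \<open>t\<close> is q^n minus the number of fixed roots, the factor with q cancels q^n, and the
  last factor accounts for a ramified point at infinity. Over \<open>int\<close> this comparison is
  conclusive.\<close>

lemma trivial_L_series:
  assumes "\<sigma> permutes ramification_points f" "\<forall>P\<in>ramification_points f. \<sigma> P = frobenius P"
  shows "Abs_fps t * (1 - fps_const (int CARD('k)) * fps_X) *
      (1 - fps_const (if 3 dvd degree f then 0 else 1) * fps_X) =
    (\<Prod>C\<in>orbit \<sigma> ` ramification_points f. 1 - fps_X ^ card C)"
    (is "?F = ?G")
proof (rule log_deriv_unique)
  let ?\<kappa> = "if 3 dvd degree f then 0 else 1 :: int"
  let ?S = "Abs_fps (\<lambda>n. if n = 0 then 0 else
      - of_nat (card {P \<in> ramification_points f. (\<sigma> ^^ n) P = P}))"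
  have "?S = Abs_fps (\<lambda>n. if n = 0 then 0 else int (CARD('k) ^ n) - int (card {a\<in>Z. frob n a = a})) +
      Abs_fps (\<lambda>n. if n = 0 then 0 else - (int CARD('k) ^ n)) +
      Abs_fps (\<lambda>n. if n = 0 then 0 else - (?\<kappa> ^ n))"
    by (auto simp: fps_eq_iff card_fixed_ramification_points[OF assms] zero_power)
  then show "log_deriv ?F ?S"
    using log_deriv_mult[OF log_deriv_mult[OF log_deriv_t log_deriv_linear[of "int CARD('k)"]]
        log_deriv_linear[of ?\<kappa>]] by (simp only:)
  show "log_deriv ?G ?S"
    by (rule log_deriv_cycles[OF assms(1) finite_ramification_points])
  show "?S $ 0 = 0" by simp
  have "(1 - fps_X ^ card C) $ 0 = (1 :: int)" if "C \<in> orbit \<sigma> ` ramification_points f" for C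
    using card_orbit_pos[OF assms(1) finite_ramification_points that] by simp
  then have "(\<Prod>C\<in>orbit \<sigma> ` ramification_points f. 1 - fps_X ^ card C) $ 0 = (1 :: int)"
    by (simp add: fps_prod_nth_0)
  then show "?F $ 0 = ?G $ 0" by (simp add: t_0)
qed

lemma ch_rho_mod:
  assumes "\<sigma> permutes ramification_points f" "\<forall>P\<in>ramification_points f. \<sigma> P = frobenius P"
  shows "map_poly (reduce \<rho>) (ch_rho r \<rho> f) * [:- 1, 1:] ^ 2 =
    (\<Prod>C\<in>orbit \<sigma> ` ramification_points f. monom 1 (card C) - 1)"
proof -
  let ?g = "genus (geom f)"
  let ?L = "Abs_fps (\<lambda>i. reduce \<rho> (l i))"
  let ?p = "map_poly (reduce \<rho>) (ch_rho r \<rho> f)"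
  let ?T = "fps_of_int (Abs_fps t) :: 3 fps"
  define \<epsilon> :: 3 where "\<epsilon> = (if 3 dvd degree f then 1 else 0)"
  have "coeff (ch_rho r \<rho> f) j = (if j \<le> ?g then l (?g - j) else 0)" for j
  proof -
    have "coeff (ch_rho r \<rho> f) j = (\<Sum>i\<le>?g. if i = ?g - j \<and> j \<le> ?g then l i else 0)"
      unfolding ch_rho_eq coeff_sum by (intro sum.cong) auto
    then show ?thesis by (cases "j \<le> ?g") auto
  qed
  then have "reversed ?g ?p ?L"
    by (auto simp: reversed_def coeff_map_poly reduce_0_1_\<rho> l_eq_0)
  from reversed_linear[OF reversed_linear[OF this]]
  have lhs: "reversed (?g + 2) (?p * [:- 1, 1:] ^ 2) (?L * (1 - fps_X) ^ 2)"
    by (simp add: power2_eq_square mult.assoc del: mult_pCons_left mult_pCons_right)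
  have L_eq: "?L = ?T * Abs_fps (\<lambda>n. \<epsilon> ^ n)"
    by (simp add: fps_eq_iff fps_mult_nth reduce_l(2) fps_of_int_def \<epsilon>_def atLeast0AtMost)
  have L: "(1 - fps_const \<epsilon> * fps_X) * ?L = ?T"
    unfolding L_eq mult.left_commute[of _ ?T] geometric_fps by (rule mult_1_right)

  have q: "of_int (int CARD('k)) = (1 :: 3)"
  proof -
    have "int CARD('k) = 3 * (int CARD('k) div 3) + 1" using card_mod_3 by presburger
    then have "(of_int (int CARD('k)) :: 3) = of_int (3 * (int CARD('k) div 3)) + 1"
      by (metis of_int_1 of_int_add)
    then show ?thesis by (simp only: of_int_3_eq_0[OF dvd_triv_left] add_0)
  qed
  have "fps_of_int (\<Prod>C\<in>orbit \<sigma> ` ramification_points f. 1 - fps_X ^ card C) =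
      ?T * (1 - fps_X) * (1 - fps_const (1 - \<epsilon>) * fps_X)"
    unfolding trivial_L_series[OF assms, symmetric] fps_of_int_mult fps_of_int_linear q
    by (simp add: \<epsilon>_def)
  \<comment> \<open>Exactly one of \<epsilon> and 1 - \<epsilon> is 1, so the Euler factor at
    infinity and the factor for a ramified infinity together always give one 1 - X; the other one is
    1 - q X.\<close>
  also have "\<dots> = ?L * (1 - fps_X) ^ 2"
    unfolding L[symmetric] by (simp add: \<epsilon>_def power2_eq_square algebra_simps)
  finally have G: "fps_of_int (\<Prod>C\<in>orbit \<sigma> ` ramification_points f. 1 - fps_X ^ card C) =
      ?L * (1 - fps_X) ^ 2" .
  have "reversed (\<Sum>C\<in>orbit \<sigma> ` ramification_points f. card C)
      (\<Prod>C\<in>orbit \<sigma> ` ramification_points f. monom 1 (card C) - 1) (?L * (1 - fps_X) ^ 2)"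
    unfolding G[symmetric] using finite_ramification_points
    by (intro reversed_prod card_orbit_pos[OF assms(1) finite_ramification_points]) auto
  then show ?thesis
    using lhs reversed_unique
    by (simp only: sum_card_orbits[OF assms(1) finite_ramification_points] card_ramification_points) 
qed

lemma coeff_ch_rho_eisenstein: "coeff (ch_rho r \<rho> f) i \<in> eisenstein \<rho>"
  unfolding ch_rho_eq coeff_sum
  by (rule reduce_sum[THEN conjunct1]) (auto simp: reduce_l reduce_0_1_\<rho>)

end

text \<open>The monic polynomial (x - 1)^2 is not a zero divisor, so multiplying by it instead of
  dividing determines the same quotient.\<close>

theorem theorem6p3:
  fixes f :: "'k::finite_field poly"
    and r :: 'k
    and \<rho> :: "'l::{alg_closed_field, field_char_0}"
    and g :: nat
    and \<sigma> :: "'k alg_closure option \<times> 'k alg_closure \<Rightarrow> 'k alg_closure option \<times> 'k alg_closure"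
  assumes "CARD('k) mod 3 = 1"
    and "r ^ 3 = 1" and "r \<noteq> 1"
    and "\<rho> ^ 3 = 1" and "\<rho> \<noteq> 1"
    and "cube_free f"
    and "irreducible (kummer_poly (geom f))"
    and "g = genus (geom f)"
    and "\<sigma> permutes ramification_points f"
    and "\<forall>P\<in>ramification_points f. \<sigma> P = frobenius P"
  shows "card (ramification_points f) = g + 2 \<and>
    (\<forall>i. coeff (ch_rho r \<rho> f) i \<in> eisenstein \<rho>) \<and>
    map_poly (reduce \<rho>) (ch_rho r \<rho> f) * [:- 1, 1:] ^ 2 =
      (\<Prod>i = 1..g + 2. (monom 1 i - 1) ^ cycle_count (ramification_points f) \<sigma> i)"
proof -
  interpret cubic_cover f r \<rho>
    using assms by unfold_locales
  show ?thesis
    using card_ramification_points coeff_ch_rho_eisenstein ch_rho_mod[OF assms(9,10)] assms(8)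
      prod_cycle_count[OF assms(9) finite_ramification_points, of "\<lambda>i. monom 1 i - 1"]
    by simp
qed

end
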